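(* Let $(M,g)$ be a connected compact Riemannian homogeneous space. Then for each $\alpha\in(0,\pi/2)$ and each $\lambda>0$, \[ N(\lambda)\ \le\ \frac{\operatorname{vol}_g(M)}{\int_0^{\pi/2} V(\theta/\sqrt{\lambda})\,\sin(2\theta)\,d\theta}\ \le\ \frac{\operatorname{vol}_g(M)}{\cos^2\alpha\cdot V(\alpha\cdot\lambda^{-1/2})}. \]
   Context: A Riemannian homogeneous space is a smooth Riemannian manifold $(M,g)$ (without boundary) such that for every $x,y\in M$ there is an isometry $\iota:M\to M$ with $\iota(x)=y$. $\operatorname{vol}_g$ (also written $\mu$) is the Riemannian volume measure. $V(r)$ denotes the volume of an open ball of radius $r$ in $M$ for the Riemannian distance; by homogeneity it does not depend on the center. $\Delta=\Delta_g$ is the nonnegative Laplace--Beltrami operator, i.e. $\int_M (\Delta u)\,\overline{v}\,d\mu=\int_M g(\nabla u,\nabla\overline v)\,d\mu$. The eigenvalue counting function $N(\lambda)$ is the dimension of $\mathcal{H}_\lambda$, the direct sum of the eigenspaces of $\Delta$ with eigenvalue at most $\lambda$ (so eigenvalues, including $0$, are counted with multiplicity). *)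

theory Defs
  imports "HOL-Analysis.Analysis" "HOL-Library.Function_Algebras"
begin

section \<open>Smooth maps between open subsets of normed spaces\<close>

text \<open>Intended for open \<open>S\<close>; all values are then determined by the restriction of \<open>f\<close> to \<open>S\<close>.\<close>

primrec Ck_on :: "nat \<Rightarrow> 'e::real_normed_vector set \<Rightarrow> ('e \<Rightarrow> 'f::real_normed_vector) \<Rightarrow> bool" where
  "Ck_on 0 S f \<longleftrightarrow> continuous_on S f"
| "Ck_on (Suc k) S f \<longleftrightarrow>
     (\<forall>x\<in>S. f differentiable (at x)) \<and> (\<forall>v. Ck_on k S (\<lambda>x. frechet_derivative f (at x) v))"

definition smooth_on :: "'e::real_normed_vector set \<Rightarrow> ('e \<Rightarrow> 'f::real_normed_vector) \<Rightarrow> bool" where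
  "smooth_on S f \<longleftrightarrow> (\<forall>k. Ck_on k S f)"


section \<open>Riemannian manifolds\<close>

text \<open>
  The manifold is the whole type \<open>'a\<close>, with its topology; its dimension is \<open>CARD('n)\<close>.
  A chart is a pair of a domain and a coordinate map, the latter being meaningful only on
  the domain. The range of a chart is open in \<open>real ^ 'n\<close>, so there is no boundary.
\<close>

type_synonym ('a, 'n) chart = "'a set \<times> ('a \<Rightarrow> real ^ 'n)"

definition chart_inv :: "('a, 'n::finite) chart \<Rightarrow> real ^ 'n \<Rightarrow> 'a" where
  "chart_inv c = inv_into (fst c) (snd c)"

definition is_chart :: "('a::topological_space, 'n::finite) chart \<Rightarrow> bool" where
  "is_chart c \<longleftrightarrow> open (fst c) \<and> open (snd c ` fst c) \<and>
     homeomorphism (fst c) (snd c ` fst c) (snd c) (chart_inv c)"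

text \<open>
  The coordinate expression of a map \<open>f\<close> in the chart \<open>c\<close> of the source and \<open>c'\<close> of the target,
  and the open set of coordinates on which it is meaningful.
\<close>

definition coord_map :: "('a, 'n::finite) chart \<Rightarrow> ('a, 'n) chart \<Rightarrow> ('a \<Rightarrow> 'a) \<Rightarrow> real ^ 'n \<Rightarrow> real ^ 'n" where
  "coord_map c c' f = snd c' \<circ> f \<circ> chart_inv c"

definition coord_dom :: "('a, 'n::finite) chart \<Rightarrow> ('a, 'n) chart \<Rightarrow> ('a \<Rightarrow> 'a) \<Rightarrow> (real ^ 'n) set" where
  "coord_dom c c' f = snd c ` (fst c \<inter> f -` fst c')"

text \<open>
  A Riemannian metric is given by the matrices \<open>g c p = (g\<^sub>i\<^sub>j(p))\<close> of its components in
  the charts \<open>c\<close> of the atlas; \<open>metric_trans\<close> is the transformation law of a covariant 2-tensor.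
\<close>

locale riemannian_manifold =
  fixes \<A> :: "('a::{t2_space, second_countable_topology}, 'n::finite) chart set"
    and g :: "('a, 'n) chart \<Rightarrow> 'a \<Rightarrow> real ^ 'n ^ 'n"
  assumes charts: "\<And>c. c \<in> \<A> \<Longrightarrow> is_chart c"
    and cover: "\<And>p. \<exists>c\<in>\<A>. p \<in> fst c"
    and compatible: "\<And>c c'. c \<in> \<A> \<Longrightarrow> c' \<in> \<A> \<Longrightarrow> smooth_on (coord_dom c c' id) (coord_map c c' id)"
    and metric_sym: "\<And>c p. c \<in> \<A> \<Longrightarrow> p \<in> fst c \<Longrightarrow> transpose (g c p) = g c p"
    and metric_pos: "\<And>c p v. c \<in> \<A> \<Longrightarrow> p \<in> fst c \<Longrightarrow> v \<noteq> 0 \<Longrightarrow> v \<bullet> (g c p *v v) > 0"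
    and metric_smooth: "\<And>c. c \<in> \<A> \<Longrightarrow> smooth_on (snd c ` fst c) (\<lambda>x. g c (chart_inv c x))"
    and metric_trans: "\<And>c c' p v w. c \<in> \<A> \<Longrightarrow> c' \<in> \<A> \<Longrightarrow> p \<in> fst c \<Longrightarrow> p \<in> fst c' \<Longrightarrow>
      (let D = frechet_derivative (coord_map c c' id) (at (snd c p))
       in v \<bullet> (g c p *v w) = D v \<bullet> (g c' p *v D w))"
begin

definition chart_at :: "'a \<Rightarrow> ('a, 'n) chart" where
  "chart_at p = (SOME c. c \<in> \<A> \<and> p \<in> fst c)"


subsection \<open>Isometries and homogeneity\<close>

definition smooth_map :: "('a \<Rightarrow> 'a) \<Rightarrow> bool" where
  "smooth_map f \<longleftrightarrow> continuous_on UNIV f \<and>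
     (\<forall>c\<in>\<A>. \<forall>c'\<in>\<A>. smooth_on (coord_dom c c' f) (coord_map c c' f))"

definition isometry :: "('a \<Rightarrow> 'a) \<Rightarrow> bool" where
  "isometry \<iota> \<longleftrightarrow> bij \<iota> \<and> smooth_map \<iota> \<and> smooth_map (inv \<iota>) \<and>
     (\<forall>c\<in>\<A>. \<forall>c'\<in>\<A>. \<forall>p. p \<in> fst c \<and> \<iota> p \<in> fst c' \<longrightarrow>
       (let D = frechet_derivative (coord_map c c' \<iota>) (at (snd c p))
        in \<forall>v w. v \<bullet> (g c p *v w) = D v \<bullet> (g c' (\<iota> p) *v D w)))"

definition homogeneous :: bool where
  "homogeneous \<longleftrightarrow> (\<forall>x y. \<exists>\<iota>. isometry \<iota> \<and> \<iota> x = y)"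


subsection \<open>Riemannian distance\<close>

definition C1_curve :: "(real \<Rightarrow> 'a) \<Rightarrow> real \<Rightarrow> real \<Rightarrow> bool" where
  "C1_curve \<gamma> a b \<longleftrightarrow> continuous_on {a..b} \<gamma> \<and>
     (\<forall>c\<in>\<A>. \<exists>D. continuous_on ({a..b} \<inter> \<gamma> -` fst c) D \<and>
       (\<forall>t\<in>{a..b} \<inter> \<gamma> -` fst c.
         ((snd c \<circ> \<gamma>) has_vector_derivative D t) (at t within {a..b})))"

definition piecewise_C1_curve :: "(real \<Rightarrow> 'a) \<Rightarrow> bool" where
  "piecewise_C1_curve \<gamma> \<longleftrightarrow> (\<exists>(k::nat) (t::nat \<Rightarrow> real). t 0 = 0 \<and> t k = 1 \<and>
     (\<forall>i<k. t i < t (Suc i) \<and> C1_curve \<gamma> (t i) (t (Suc i))))"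

text \<open>At the finitely many break points of a piecewise C1 curve the value is irrelevant.\<close>

definition speed :: "(real \<Rightarrow> 'a) \<Rightarrow> real \<Rightarrow> real" where
  "speed \<gamma> t = (let c = chart_at (\<gamma> t); v = vector_derivative (snd c \<circ> \<gamma>) (at t)
     in sqrt (v \<bullet> (g c (\<gamma> t) *v v)))"

definition curve_length :: "(real \<Rightarrow> 'a) \<Rightarrow> real" where
  "curve_length \<gamma> = integral {0..1} (speed \<gamma>)"

definition rdist :: "'a \<Rightarrow> 'a \<Rightarrow> ennreal" where
  "rdist x y = (INF \<gamma> \<in> {\<gamma>. piecewise_C1_curve \<gamma> \<and> \<gamma> 0 = x \<and> \<gamma> 1 = y}. ennreal (curve_length \<gamma>))"

definition rball :: "'a \<Rightarrow> real \<Rightarrow> 'a set" where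
  "rball x r = {y. rdist x y < ennreal r}"


subsection \<open>Riemannian volume\<close>

text \<open>The unique Borel measure given by \<open>\<surd>(det g\<^sub>i\<^sub>j) dx\<close> in every chart.\<close>

definition vol :: "'a measure" where
  "vol = (THE \<mu>. sets \<mu> = sets borel \<and>
     (\<forall>c\<in>\<A>. \<forall>B\<in>sets borel. B \<subseteq> fst c \<longrightarrow>
       emeasure \<mu> B = (\<integral>\<^sup>+x\<in>snd c ` B. ennreal (sqrt (det (g c (chart_inv c x)))) \<partial>lborel)))"

definition ball_volume :: "'a \<Rightarrow> real \<Rightarrow> real" where
  "ball_volume x r = measure vol (rball x r)"


subsection \<open>Laplace--Beltrami operator and eigenvalue counting function\<close>

definition smooth_fun :: "('a \<Rightarrow> complex) \<Rightarrow> bool" where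
  "smooth_fun u \<longleftrightarrow> (\<forall>c\<in>\<A>. smooth_on (snd c ` fst c) (u \<circ> chart_inv c))"

definition partial :: "('a, 'n) chart \<Rightarrow> ('a \<Rightarrow> complex) \<Rightarrow> 'a \<Rightarrow> 'n \<Rightarrow> complex" where
  "partial c u p i = frechet_derivative (u \<circ> chart_inv c) (at (snd c p)) (axis i 1)"

text \<open>
  Components of the gradient in the chart \<open>c\<close>, and the complex bilinear (not sesquilinear)
  extension of the metric to complex tangent vectors.
\<close>

definition grad :: "('a, 'n) chart \<Rightarrow> ('a \<Rightarrow> complex) \<Rightarrow> 'a \<Rightarrow> complex ^ 'n" where
  "grad c u p = (\<chi> i. \<Sum>j\<in>UNIV. of_real (matrix_inv (g c p) $ i $ j) * partial c u p j)"

definition metric_complex :: "('a, 'n) chart \<Rightarrow> 'a \<Rightarrow> complex ^ 'n \<Rightarrow> complex ^ 'n \<Rightarrow> complex" where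
  "metric_complex c p X Y = (\<Sum>i\<in>UNIV. \<Sum>j\<in>UNIV. of_real (g c p $ i $ j) * X $ i * Y $ j)"

definition grad_inner :: "('a \<Rightarrow> complex) \<Rightarrow> ('a \<Rightarrow> complex) \<Rightarrow> 'a \<Rightarrow> complex" where
  "grad_inner u v p = (let c = chart_at p in metric_complex c p (grad c u p) (grad c v p))"

text \<open>
  \<open>has_laplacian u w\<close> says that \<open>w = \<Delta> u\<close> for the nonnegative Laplace--Beltrami operator.
  On a compact manifold the support condition on the test function \<open>v\<close> is void.
\<close>

definition has_laplacian :: "('a \<Rightarrow> complex) \<Rightarrow> ('a \<Rightarrow> complex) \<Rightarrow> bool" where
  "has_laplacian u w \<longleftrightarrow> smooth_fun u \<and> smooth_fun w \<and>
     (\<forall>v. smooth_fun v \<and> compact (closure {x. v x \<noteq> 0}) \<longrightarrow>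
       (LINT x|vol. w x * cnj (v x)) = (LINT x|vol. grad_inner u (\<lambda>y. cnj (v y)) x))"

definition eigenspace :: "real \<Rightarrow> ('a \<Rightarrow> complex) set" where
  "eigenspace \<kappa> = {u. has_laplacian u (\<lambda>x. of_real \<kappa> * u x)}"

end

interpretation cfun: vector_space "\<lambda>(a::complex) (f::'a \<Rightarrow> complex) x. a * f x"
  by unfold_locales (auto simp: fun_eq_iff algebra_simps)

text \<open>Complex dimension, with value \<open>\<infinity>\<close> for infinite-dimensional spaces.\<close>

definition cdim :: "('a \<Rightarrow> complex) set \<Rightarrow> enat" where
  "cdim V = (SUP B \<in> {B. finite B \<and> B \<subseteq> V \<and> cfun.independent B}. enat (card B))"

context riemannian_manifold
begin

definition eigenspace_sum :: "real \<Rightarrow> ('a \<Rightarrow> complex) set" where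
  "eigenspace_sum lam = cfun.span (\<Union>\<kappa>\<in>{..lam}. eigenspace \<kappa>)"

definition counting_function :: "real \<Rightarrow> enat" where
  "counting_function lam = cdim (eigenspace_sum lam)"

end

end

theory Submission
  imports Defs
begin

text \<open>
  The idea. Let \<open>\<phi>\<^sub>1, \<dots>, \<phi>\<^sub>N\<close> be orthonormal in
  \<open>L\<^sup>2\<close>, in the span of the eigenspaces with eigenvalues at most
  \<open>\<lambda>\<close>, and let \<open>\<Phi> = (\<phi>\<^sub>1, \<dots>,
  \<phi>\<^sub>N)\<close>, a map to \<open>\<complex>\<^sup>N\<close>. The function
  \<open>\<bar>\<Phi>\<bar>\<^sup>2\<close> has mean value \<open>N / vol M\<close>, and the
  squared norm \<open>\<bar>d\<Phi>\<bar>\<^sup>2\<close> of the differential has mean value at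
  most \<open>\<lambda> N / vol M\<close>. Suppose that both functions are constant, as they are
  when the \<open>\<phi>\<^sub>j\<close> are a basis of a space that is invariant under
  isometries. Then \<open>\<Phi>\<close> maps into a sphere, and along a curve of length
  \<open>\<ell>\<close> its direction turns by an angle of at most \<open>\<surd>\<lambda>
  \<ell>\<close>. Hence \<open>\<bar>\<langle>\<Phi>(p), \<Phi>(y)\<rangle>\<bar> \<ge>
  \<bar>\<Phi>(p)\<bar> \<bar>\<Phi>(y)\<bar> cos (\<surd>\<lambda> d(p, y))\<close> as long as
  the angle is at most \<open>\<pi>/2\<close> (lemma \<open>sphere_path_inner_ge_cos\<close>).
  By orthonormality the square of the left-hand side has integral
  \<open>\<bar>\<Phi>(p)\<bar>\<^sup>2\<close> over \<open>y\<close>. Dividing by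
  \<open>\<bar>\<Phi>(p)\<bar>\<^sup>2\<close> gives \<open>1 \<ge> N / vol M \<cdot>
  \<integral> cos\<^sup>2 (min (\<surd>\<lambda> d(p, y)) (\<pi>/2)) dy\<close>, and the layer
  cake formula turns the integral into \<open>\<integral> V(\<theta>/\<surd>\<lambda>) sin
  (2\<theta>) d\<theta>\<close> (lemma \<open>integral_cos2_weight\<close>). The second
  inequality of the theorem keeps only the ball of radius
  \<open>\<alpha>/\<surd>\<lambda>\<close>, on which the integrand is at least
  \<open>cos\<^sup>2 \<alpha>\<close>.

  A finite orthonormal family need not span an invariant space, and constancy is obtained by
  averaging. If \<open>f\<close> is continuous, then the average of \<open>f \<circ>
  \<tau>\<close> over a suitable finite list of composites \<open>\<tau>\<close> of isometries
  is uniformly close to the mean value of \<open>f\<close> (lemma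
  \<open>list_avg_small_oscillation\<close>): isometries keep the modulus of continuity, and by
  homogeneity and compactness a fixed number of isometries carries every point close to a given
  minimum, so that one averaging step shrinks the oscillation by a fixed factor. The argument
  above is applied to the family of all \<open>\<phi>\<^sub>j \<circ> \<tau>\<close>, for which,
  divided by the number of the \<open>\<tau>\<close>, \<open>\<bar>\<Phi>\<bar>\<^sup>2\<close>
  is at least \<open>N / vol M - \<epsilon>\<close> and
  \<open>\<bar>d\<Phi>\<bar>\<^sup>2\<close> is at most \<open>\<lambda> N / vol M +
  \<epsilon>\<close> everywhere. The composites with different \<open>\<tau>\<close> need not be
  orthogonal to each other, but Bessel's inequality survives by convexity (lemma
  \<open>kernel_sum_Bessel\<close>). Letting \<open>\<epsilon>\<close> tend to \<open>0\<close>
  bounds the size of every finite linearly independent set, and so the dimension, which is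
  thereby shown to be finite.

  The remaining parts provide the geometry. The change of variables formula gives existence,
  uniqueness and isometry invariance of the volume measure. Estimates in charts show that the
  Riemannian distance induces the given topology, so that balls are open and continuous
  functions are uniformly continuous for the distance.
\<close>

section \<open>Change of variables in \<open>real ^ 'n\<close>\<close>

text \<open>
  A copy of a finite index type that carries a well-order. The change of variables formula is
  stated for well-ordered index types; Lebesgue measure and determinants do not depend on the
  order, so that it carries over to every \<open>real ^ 'n\<close> by reindexing.
\<close>

typedef 'n ranked = "UNIV :: 'n set" by simp

lemma bij_Rep_ranked: "bij Rep_ranked"
  by (rule bijI') (auto simp: Rep_ranked_inject intro: Abs_ranked_inverse[symmetric])

instance ranked :: (finite) finite
proof
  show "finite (UNIV :: 'a ranked set)"
    using bij_betw_finite[OF bij_Rep_ranked] finite[of UNIV] by blast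
qed

instantiation ranked :: (finite) wellorder
begin

definition less_eq_ranked :: "'a ranked \<Rightarrow> 'a ranked \<Rightarrow> bool" where
  "x \<le> y \<longleftrightarrow> to_nat (Rep_ranked x) \<le> to_nat (Rep_ranked y)"

definition less_ranked :: "'a ranked \<Rightarrow> 'a ranked \<Rightarrow> bool" where
  "x < y \<longleftrightarrow> to_nat (Rep_ranked x) < to_nat (Rep_ranked y)"

instance
proof
  fix P :: "'a ranked \<Rightarrow> bool" and a
  assume step: "\<And>x. (\<And>y. y < x \<Longrightarrow> P y) \<Longrightarrow> P x"
  show "P a"
  proof (induction a rule: measure_induct_rule[where f = "\<lambda>x. to_nat (Rep_ranked x)"])
    case (less x)
    show ?case
      by (rule step, rule less) (simp add: less_ranked_def)
  qed
qed (auto simp: less_eq_ranked_def less_ranked_def Rep_ranked_inject)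

end

definition to_ranked :: "real ^ 'n \<Rightarrow> real ^ ('n::finite ranked)" where
  "to_ranked x = (\<chi> i. x $ Rep_ranked i)"

definition of_ranked :: "real ^ ('n::finite ranked) \<Rightarrow> real ^ 'n" where
  "of_ranked y = (\<chi> i. y $ Abs_ranked i)"

lemma of_to_ranked [simp]: "of_ranked (to_ranked x) = x"
  by (simp add: to_ranked_def of_ranked_def Abs_ranked_inverse vec_eq_iff)

lemma to_of_ranked [simp]: "to_ranked (of_ranked y) = y"
  by (simp add: to_ranked_def of_ranked_def Rep_ranked_inverse vec_eq_iff)

lemma linear_to_ranked: "linear to_ranked"
  by (rule linearI) (simp_all add: to_ranked_def vec_eq_iff)

lemma linear_of_ranked: "linear of_ranked"
  by (rule linearI) (simp_all add: of_ranked_def vec_eq_iff)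

lemma bounded_linear_to_ranked: "bounded_linear to_ranked"
  by (rule linear_conv_bounded_linear[THEN iffD1, OF linear_to_ranked])

lemma bounded_linear_of_ranked: "bounded_linear of_ranked"
  by (rule linear_conv_bounded_linear[THEN iffD1, OF linear_of_ranked])

lemma measurable_of_ranked [measurable]: "of_ranked \<in> borel_measurable borel"
  using bounded_linear_of_ranked by (intro borel_measurable_continuous_onI linear_continuous_on)

text \<open>
  Reindexing permutes the factors in the volume of a box.
\<close>

lemma lborel_ranked: "lborel = distr lborel borel (of_ranked :: _ \<Rightarrow> real ^ 'n::finite)"
proof (rule lborel_eqI)
  fix l u :: "real ^ 'n"
  assume lu: "\<And>b. b \<in> Basis \<Longrightarrow> l \<bullet> b \<le> u \<bullet> b"
  have le: "l $ i \<le> u $ i" for i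
    using lu[of "axis i 1"] by (auto simp: inner_axis Basis_vec_def)
  have vim: "of_ranked -` box l u = box (to_ranked l) (to_ranked u)"
  proof -
    have "(\<forall>i. l $ i < y $ Abs_ranked i \<and> y $ Abs_ranked i < u $ i) \<longleftrightarrow>
      (\<forall>j. l $ Rep_ranked j < y $ j \<and> y $ j < u $ Rep_ranked j)" for y :: "real ^ 'n ranked"
      by (metis Abs_ranked_inverse Rep_ranked_inverse UNIV_I)
    then show ?thesis
      by (auto simp: mem_box_cart of_ranked_def to_ranked_def)
  qed
  have "emeasure (distr lborel borel of_ranked) (box l u) = emeasure lborel (box (to_ranked l) (to_ranked u))"
    by (subst emeasure_distr) (auto simp: vim)
  also have "\<dots> = (\<Prod>b\<in>Basis. (to_ranked u - to_ranked l) \<bullet> b)"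
    by (rule emeasure_lborel_box)
      (auto simp: Basis_vec_def inner_axis to_ranked_def le)
  also have "(\<Prod>b\<in>Basis. (to_ranked u - to_ranked l) \<bullet> b) = (\<Prod>j\<in>UNIV. (u - l) $ Rep_ranked j)"
    by (subst prod.reindex_bij_betw[symmetric, where h = "\<lambda>j. axis j 1" and S = UNIV])
      (auto simp: bij_betw_def inj_on_def axis_eq_axis Basis_vec_def inner_axis to_ranked_def)
  also have "\<dots> = (\<Prod>i\<in>UNIV. (u - l) $ i)"
    by (rule prod.reindex_bij_betw[OF bij_Rep_ranked])
  also have "\<dots> = (\<Prod>b\<in>Basis. (u - l) \<bullet> b)"
    by (subst prod.reindex_bij_betw[symmetric, where h = "\<lambda>j. axis j 1" and S = UNIV and T = Basis])
      (auto simp: bij_betw_def inj_on_def axis_eq_axis Basis_vec_def inner_axis)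
  finally show "emeasure (distr lborel borel of_ranked) (box l u) = (\<Prod>b\<in>Basis. (u - l) \<bullet> b)" .
qed simp

lemma nn_integral_ranked:
  fixes F :: "real ^ 'n::finite \<Rightarrow> ennreal"
  assumes "F \<in> borel_measurable borel"
  shows "(\<integral>\<^sup>+x. F x \<partial>lborel) = (\<integral>\<^sup>+y. F (of_ranked y) \<partial>lborel)"
  by (subst lborel_ranked, subst nn_integral_distr) (use assms in auto)

text \<open>
  Conjugation by the bijection matches the permutations of the two index types and keeps their
  signs.
\<close>

lemma det_ranked:
  fixes A :: "real ^ 'n::finite ^ 'n"
  shows "det (\<chi> i j. A $ Rep_ranked i $ Rep_ranked j) = det A"
proof -
  let ?f = "Abs_ranked :: 'n \<Rightarrow> _"
  have bij: "bij ?f"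
    by (metis Abs_ranked_inverse Rep_ranked_inverse UNIV_I bijI')
  have inv: "inv ?f = Rep_ranked"
    by (rule inv_equality) (auto simp: Abs_ranked_inverse Rep_ranked_inverse)
  have bm: "bij_betw (\<lambda>p. map_permutation UNIV ?f p) {p. p permutes UNIV} {p. p permutes UNIV}"
    using bij_betw_permutations[OF bij]
    by (rule bij_betw_cong[THEN iffD1, rotated])
      (auto simp: map_permutation_def fun_eq_iff restrict_id_def bij_is_surj[OF bij])
  have mp: "map_permutation UNIV ?f p i = ?f (p (Rep_ranked i))" for p i
    using bij_is_surj[OF bij] by (simp add: map_permutation_def restrict_id_def inv)
  have "det (\<chi> i j. A $ Rep_ranked i $ Rep_ranked j) =
    (\<Sum>p | p permutes (UNIV :: 'n set). of_int (sign (map_permutation UNIV ?f p)) *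
      (\<Prod>i\<in>UNIV. A $ Rep_ranked i $ Rep_ranked (map_permutation UNIV ?f p i)))"
    unfolding det_def by (subst sum.reindex_bij_betw[OF bm, symmetric]) simp
  also have "\<dots> = (\<Sum>p | p permutes (UNIV :: 'n set). of_int (sign p) * (\<Prod>i\<in>UNIV. A $ i $ p i))"
  proof (rule sum.cong[OF refl])
    fix p assume p: "p \<in> {p. p permutes (UNIV :: 'n set)}"
    have "sign (map_permutation UNIV ?f p) = sign p"
      using p bij by (intro sign_map_permutation) (auto simp: bij_def)
    moreover have "(\<Prod>i\<in>UNIV. A $ Rep_ranked i $ Rep_ranked (map_permutation UNIV ?f p i)) =
        (\<Prod>i\<in>UNIV. A $ Rep_ranked i $ p (Rep_ranked i))"
      by (simp add: mp Abs_ranked_inverse)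
    moreover have "\<dots> = (\<Prod>i\<in>UNIV. A $ i $ p i)"
      by (rule prod.reindex_bij_betw[OF bij_Rep_ranked])
    ultimately show "of_int (sign (map_permutation UNIV ?f p)) *
      (\<Prod>i\<in>UNIV. A $ Rep_ranked i $ Rep_ranked (map_permutation UNIV ?f p i)) =
      of_int (sign p) * (\<Prod>i\<in>UNIV. A $ i $ p i)"
      by simp
  qed
  finally show ?thesis
    by (simp add: det_def)
qed

text \<open>
  The formula for absolutely integrable functions also transports integrability. A nonnegative
  \<open>f\<close> that is not integrable thus has an infinite integral on both sides.
\<close>

lemma nn_integral_change_of_variables_ranked:
  fixes h :: "real ^ 'm::{finite, wellorder} \<Rightarrow> real ^ 'm::_" and f :: "real ^ 'm::_ \<Rightarrow> real"
  assumes S: "S \<in> sets borel"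
    and der: "\<And>x. x \<in> S \<Longrightarrow> (h has_derivative h' x) (at x within S)"
    and inj: "inj_on h S"
    and pos: "\<And>y. y \<in> h ` S \<Longrightarrow> 0 \<le> f y"
    and M1: "(\<lambda>y. indicator (h ` S) y * f y) \<in> borel_measurable borel"
    and M2: "(\<lambda>x. indicator S x * (\<bar>det (matrix (h' x))\<bar> * f (h x))) \<in> borel_measurable borel"
  shows "(\<integral>\<^sup>+y\<in>h ` S. ennreal (f y) \<partial>lborel) =
    (\<integral>\<^sup>+x\<in>S. ennreal (\<bar>det (matrix (h' x))\<bar> * f (h x)) \<partial>lborel)"
proof -
  let ?D = "\<lambda>x. \<bar>det (matrix (h' x))\<bar> * f (h x)"
  have posD: "0 \<le> ?D x" if "x \<in> S" for x
    using pos that by auto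
  have S': "S \<in> sets lebesgue"
    using S by simp
  have cov: "?D absolutely_integrable_on S \<and> integral S ?D = b \<longleftrightarrow>
      f absolutely_integrable_on (h ` S) \<and> integral (h ` S) f = b" for b
    using has_absolute_integral_change_of_variables[OF S' der inj, of "\<lambda>y. vec (f y) :: real ^ 1" "vec b"]
    by (auto simp: absolutely_integrable_on_1_iff integral_on_1_eq vec_eq_iff)
  have val: "(\<integral>\<^sup>+x\<in>T. ennreal (k x) \<partial>lborel) = ennreal (integral T k)"
    if "k absolutely_integrable_on T" "\<And>x. x \<in> T \<Longrightarrow> 0 \<le> k x" for k :: "real ^ 'm::_ \<Rightarrow> real" and T
    using that nn_integral_has_integral_lebesgue'[of T k "integral T k"]
    by (simp add: absolutely_integrable_on_def has_integral_integral)
  have inf: "k absolutely_integrable_on T"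
    if "(\<integral>\<^sup>+x\<in>T. ennreal (k x) \<partial>lborel) \<noteq> \<infinity>" "\<And>x. x \<in> T \<Longrightarrow> 0 \<le> k x"
      "(\<lambda>x. indicator T x * k x) \<in> borel_measurable borel" for k :: "real ^ 'm::_ \<Rightarrow> real" and T
  proof -
    have "integrable lborel (\<lambda>x. indicator T x * k x)"
    proof (rule integrableI_bounded)
      have "(\<integral>\<^sup>+x. ennreal (norm (indicator T x * k x)) \<partial>lborel) = (\<integral>\<^sup>+x\<in>T. ennreal (k x) \<partial>lborel)"
        using that(2) by (intro nn_integral_cong) (auto simp: indicator_def)
      then show "(\<integral>\<^sup>+x. ennreal (norm (indicator T x * k x)) \<partial>lborel) < \<infinity>"
        using that(1) by (simp add: less_top)
    qed (use that(3) in simp)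
    then show ?thesis
      unfolding set_integrable_def by (simp add: integrable_completion that(3))
  qed
  show ?thesis
  proof (cases "f absolutely_integrable_on (h ` S)")
    case True
    then have "?D absolutely_integrable_on S \<and> integral S ?D = integral (h ` S) f"
      using cov by blast
    then show ?thesis
      using True val[where k = f and T = "h ` S"] val[where k = ?D and T = S] pos posD by simp
  next
    case False
    then have "\<not> ?D absolutely_integrable_on S"
      using cov by blast
    then have "(\<integral>\<^sup>+x\<in>S. ennreal (?D x) \<partial>lborel) = \<infinity>"
      using inf[where T = S and k = ?D] posD M2 by blast
    moreover have "(\<integral>\<^sup>+y\<in>h ` S. ennreal (f y) \<partial>lborel) = \<infinity>"
      using False inf[where T = "h ` S" and k = f] pos M1 by blast
    ultimately show ?thesis
      by simp
  qed
qed

theorem nn_integral_change_of_variables: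
  fixes h :: "real ^ 'n::finite \<Rightarrow> real ^ 'n" and f :: "real ^ 'n \<Rightarrow> real"
  assumes S: "S \<in> sets borel"
    and der: "\<And>x. x \<in> S \<Longrightarrow> (h has_derivative h' x) (at x within S)"
    and inj: "inj_on h S"
    and pos: "\<And>y. y \<in> h ` S \<Longrightarrow> 0 \<le> f y"
    and M1: "(\<lambda>y. indicator (h ` S) y * f y) \<in> borel_measurable borel"
    and M2: "(\<lambda>x. indicator S x * (\<bar>det (matrix (h' x))\<bar> * f (h x))) \<in> borel_measurable borel"
  shows "(\<integral>\<^sup>+y\<in>h ` S. ennreal (f y) \<partial>lborel) =
    (\<integral>\<^sup>+x\<in>S. ennreal (\<bar>det (matrix (h' x))\<bar> * f (h x)) \<partial>lborel)"
proof -
  let ?S = "to_ranked ` S" and ?h = "to_ranked \<circ> h \<circ> of_ranked"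
  let ?h' = "\<lambda>y. to_ranked \<circ> h' (of_ranked y) \<circ> of_ranked" and ?f = "f \<circ> of_ranked"
  have img: "?h ` ?S = to_ranked ` h ` S"
    by (force simp: image_iff)
  have mem: "y \<in> to_ranked ` T \<longleftrightarrow> of_ranked y \<in> T" for y and T :: "(real ^ 'n) set"
    using image_eqI[of y to_ranked "of_ranked y" T] by auto
  note memS = mem[of _ S]
  have memhS: "y \<in> ?h ` ?S \<longleftrightarrow> of_ranked y \<in> h ` S" for y
    unfolding img by (rule mem)
  have det: "det (matrix (?h' y)) = det (matrix (h' (of_ranked y)))" for y
  proof -
    have "of_ranked (axis j 1) = axis (Rep_ranked j) 1" for j :: "'n ranked"
      by (auto simp: of_ranked_def axis_def vec_eq_iff Abs_ranked_inverse Rep_ranked_inverse)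
    then have "matrix (?h' y) = (\<chi> i j. matrix (h' (of_ranked y)) $ Rep_ranked i $ Rep_ranked j)"
      by (simp add: matrix_def to_ranked_def)
    then show ?thesis
      by (simp add: det_ranked)
  qed
  have S': "?S \<in> sets borel"
  proof -
    have "?S = of_ranked -` S \<inter> space borel"
      using memS by auto
    then show ?thesis
      using measurable_sets[OF measurable_of_ranked S] by simp
  qed
  have "(\<integral>\<^sup>+y\<in>?h ` ?S. ennreal (?f y) \<partial>lborel) =
    (\<integral>\<^sup>+x\<in>?S. ennreal (\<bar>det (matrix (?h' x))\<bar> * ?f (?h x)) \<partial>lborel)"
  proof (rule nn_integral_change_of_variables_ranked[OF S'])
    fix y assume "y \<in> ?S"
    then have *: "(h has_derivative h' (of_ranked y)) (at (of_ranked y) within of_ranked ` ?S)"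
      using der memS by (simp add: image_image)
    have **: "(of_ranked has_derivative of_ranked) (at y within ?S)" for y :: "real ^ 'n ranked"
      by (rule bounded_linear_imp_has_derivative[OF bounded_linear_of_ranked])
    have "(h \<circ> of_ranked has_derivative h' (of_ranked y) \<circ> of_ranked) (at y within ?S)"
      by (rule diff_chain_within[OF ** *])
    from bounded_linear.has_derivative[OF bounded_linear_to_ranked this]
    show "(?h has_derivative ?h' y) (at y within ?S)"
      by (simp add: o_def)
  next
    show "inj_on ?h ?S"
      using inj by (auto simp: inj_on_def dest!: arg_cong[where f = of_ranked])
  next
    show "0 \<le> ?f y" if "y \<in> ?h ` ?S" for y
      using pos that memhS by simp
  next
    have "(\<lambda>y. indicator (?h ` ?S) y * ?f y) = (\<lambda>y. indicator (h ` S) y * f y) \<circ> of_ranked"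
      unfolding fun_eq_iff indicator_def memhS by simp
    then show "(\<lambda>y. indicator (?h ` ?S) y * ?f y) \<in> borel_measurable borel"
      using measurable_comp[OF measurable_of_ranked M1] by simp
  next
    have "(\<lambda>x. indicator ?S x * (\<bar>det (matrix (?h' x))\<bar> * ?f (?h x))) =
        (\<lambda>x. indicator S x * (\<bar>det (matrix (h' x))\<bar> * f (h x))) \<circ> of_ranked"
      unfolding det unfolding fun_eq_iff indicator_def memS by simp
    then show "(\<lambda>x. indicator ?S x * (\<bar>det (matrix (?h' x))\<bar> * ?f (?h x))) \<in> borel_measurable borel"
      using measurable_comp[OF measurable_of_ranked M2] by simp
  qed
  moreover have "(\<integral>\<^sup>+y\<in>h ` S. ennreal (f y) \<partial>lborel) = (\<integral>\<^sup>+y\<in>?h ` ?S. ennreal (?f y) \<partial>lborel)"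
  proof -
    have "(\<integral>\<^sup>+y\<in>h ` S. ennreal (f y) \<partial>lborel) = (\<integral>\<^sup>+y. ennreal (indicator (h ` S) y * f y) \<partial>lborel)"
      by (intro nn_integral_cong) (auto simp: indicator_def)
    also have "\<dots> = (\<integral>\<^sup>+y. ennreal (indicator (h ` S) (of_ranked y) * f (of_ranked y)) \<partial>lborel)"
      by (rule nn_integral_ranked) (use M1 in measurable)
    also have "\<dots> = (\<integral>\<^sup>+y\<in>?h ` ?S. ennreal (?f y) \<partial>lborel)"
      unfolding indicator_def memhS by (intro nn_integral_cong) auto
    finally show ?thesis .
  qed
  moreover have "(\<integral>\<^sup>+x\<in>S. ennreal (\<bar>det (matrix (h' x))\<bar> * f (h x)) \<partial>lborel) =
      (\<integral>\<^sup>+x\<in>?S. ennreal (\<bar>det (matrix (?h' x))\<bar> * ?f (?h x)) \<partial>lborel)"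
  proof -
    have "(\<integral>\<^sup>+x\<in>S. ennreal (\<bar>det (matrix (h' x))\<bar> * f (h x)) \<partial>lborel) =
      (\<integral>\<^sup>+x. ennreal (indicator S x * (\<bar>det (matrix (h' x))\<bar> * f (h x))) \<partial>lborel)"
      by (intro nn_integral_cong) (auto simp: indicator_def)
    also have "\<dots> = (\<integral>\<^sup>+x. ennreal (indicator S (of_ranked x) *
        (\<bar>det (matrix (h' (of_ranked x)))\<bar> * f (h (of_ranked x)))) \<partial>lborel)"
      by (rule nn_integral_ranked) (use M2 in measurable)
    also have "\<dots> = (\<integral>\<^sup>+x\<in>?S. ennreal (\<bar>det (matrix (?h' x))\<bar> * ?f (?h x)) \<partial>lborel)"
      unfolding det unfolding indicator_def memS by (intro nn_integral_cong) auto
    finally show ?thesis .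
  qed
  ultimately show ?thesis
    by simp
qed

section \<open>Smooth maps, matrices and paths on spheres\<close>

lemma Ck_on_cong:
  assumes "open S" "\<And>x. x \<in> S \<Longrightarrow> f x = g x" "Ck_on k S f"
  shows "Ck_on k S g"
  using assms
proof (induction k arbitrary: f g)
  case 0
  then show ?case
    using continuous_on_cong[of S S f g] by simp
next
  case (Suc k)
  have fd: "(f has_derivative D) (at x) \<longleftrightarrow> (g has_derivative D) (at x)" if "x \<in> S" for x D
    using has_derivative_transform_within_open[of f D x UNIV S g]
      has_derivative_transform_within_open[of g D x UNIV S f] that Suc.prems(1,2) by auto
  have "frechet_derivative f (at x) = frechet_derivative g (at x)" if "x \<in> S" for x
    unfolding frechet_derivative_def fd[OF that] ..
  then show ?case
    using Suc.prems Suc.IH[of "\<lambda>x. frechet_derivative f (at x) v" "\<lambda>x. frechet_derivative g (at x) v" for v]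
    by (auto simp: differentiable_def fd)
qed

lemma Ck_on_add:
  assumes "open S" "Ck_on k S f" "Ck_on k S g"
  shows "Ck_on k S (\<lambda>x. f x + g x)"
  using assms
proof (induction k arbitrary: f g)
  case (Suc k)
  have D: "frechet_derivative (\<lambda>x. f x + g x) (at x) v =
      frechet_derivative f (at x) v + frechet_derivative g (at x) v" if "x \<in> S" for x v
  proof -
    have "((\<lambda>x. f x + g x) has_derivative (\<lambda>v. frechet_derivative f (at x) v + frechet_derivative g (at x) v)) (at x)"
      using Suc.prems that by (intro has_derivative_add) (auto simp: frechet_derivative_works)
    from frechet_derivative_at[OF this] show ?thesis
      by metis
  qed
  show ?case
    using Suc.prems
    by (auto intro!: differentiable_add Suc.IH
      intro: Ck_on_cong[OF Suc.prems(1) D[symmetric]])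
qed (auto intro: continuous_intros)

lemma Ck_on_bounded_linear:
  assumes "open S" "Ck_on k S f" "bounded_linear L"
  shows "Ck_on k S (\<lambda>x. L (f x))"
  using assms
proof (induction k arbitrary: f)
  case 0
  then show ?case
    by (auto intro: bounded_linear.continuous_on)
next
  case (Suc k)
  have der: "((\<lambda>x. L (f x)) has_derivative (\<lambda>v. L (frechet_derivative f (at x) v))) (at x)" if "x \<in> S" for x
    using Suc.prems that
    by (intro bounded_linear.has_derivative[OF Suc.prems(3)]) (auto simp: frechet_derivative_works)
  then have D: "L (frechet_derivative f (at x) v) = frechet_derivative (\<lambda>x. L (f x)) (at x) v" if "x \<in> S" for x v
    using frechet_derivative_at[OF der[OF that]] by metis
  have "Ck_on k S (\<lambda>x. frechet_derivative (\<lambda>x. L (f x)) (at x) v)" for v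
    by (rule Ck_on_cong[OF Suc.prems(1) D]) (use Suc in auto)
  then show ?case
    using der by (auto simp: differentiable_def)
qed

lemma smooth_on_add:
  "open S \<Longrightarrow> smooth_on S f \<Longrightarrow> smooth_on S g \<Longrightarrow> smooth_on S (\<lambda>x. f x + g x)"
  by (simp add: smooth_on_def Ck_on_add)

lemma smooth_on_bounded_linear:
  "open S \<Longrightarrow> smooth_on S f \<Longrightarrow> bounded_linear L \<Longrightarrow> smooth_on S (\<lambda>x. L (f x))"
  by (simp add: smooth_on_def Ck_on_bounded_linear)

lemma smooth_on_zero: "smooth_on S (\<lambda>x. 0)"
proof -
  have "Ck_on k S (\<lambda>x. 0 :: 'b)" for k
    by (induction k) auto
  then show ?thesis
    by (simp add: smooth_on_def)
qed

lemma smooth_on_has_derivative: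
  assumes "smooth_on S f" "x \<in> S"
  shows "(f has_derivative frechet_derivative f (at x)) (at x)"
proof -
  have "Ck_on 1 S f"
    using assms(1) unfolding smooth_on_def by blast
  then show ?thesis
    using assms(2) by (simp add: frechet_derivative_works)
qed

lemma smooth_on_continuous_on: "smooth_on S f \<Longrightarrow> continuous_on S f"
  unfolding smooth_on_def using Ck_on.simps(1) by blast

text \<open>
  Smoothness speaks of one direction at a time. Expanding \<open>v\<close> in the standard basis
  makes the derivative jointly continuous in the point and the direction.
\<close>

lemma continuous_on_frechet_derivative:
  fixes f :: "real ^ 'n::finite \<Rightarrow> 'f::real_normed_vector"
  assumes f: "smooth_on S f" and x: "continuous_on T x" and v: "continuous_on T v"
    and xS: "\<And>t. t \<in> T \<Longrightarrow> x t \<in> S"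
  shows "continuous_on T (\<lambda>t. frechet_derivative f (at (x t)) (v t))"
proof -
  have "Ck_on 1 S f"
    using f unfolding smooth_on_def by blast
  then have "continuous_on S (\<lambda>y. frechet_derivative f (at y) w)" for w
    by simp
  then have c: "continuous_on T (\<lambda>t. frechet_derivative f (at (x t)) w)" for w
    by (rule continuous_on_compose2[OF _ x]) (use xS in auto)
  have "frechet_derivative f (at (x t)) (v t) = (\<Sum>i\<in>UNIV. v t $ i *\<^sub>R frechet_derivative f (at (x t)) (axis i 1))"
    if "t \<in> T" for t
  proof -
    have lin: "linear (frechet_derivative f (at (x t)))"
      using smooth_on_has_derivative[OF f xS[OF that]] has_derivative_linear by blast
    have "v t = (\<Sum>i\<in>UNIV. v t $ i *\<^sub>R axis i 1)"
      using basis_expansion[of "v t"] by (simp add: scalar_mult_eq_scaleR)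
    from arg_cong[OF this, of "frechet_derivative f (at (x t))"] show ?thesis
      by (simp only: linear_sum[OF lin] linear_scale[OF lin])
  qed
  moreover have "continuous_on T (\<lambda>t. \<Sum>i\<in>UNIV. v t $ i *\<^sub>R frechet_derivative f (at (x t)) (axis i 1))"
    by (intro continuous_intros c v)
  ultimately show ?thesis
    by (simp cong: continuous_on_cong)
qed

lemma continuous_on_det:
  fixes A :: "'a::topological_space \<Rightarrow> real ^ 'n::finite ^ 'n"
  assumes "continuous_on S A"
  shows "continuous_on S (\<lambda>x. det (A x))"
  unfolding det_def by (intro continuous_intros assms)

lemma matrix_inv_inverse:
  fixes A :: "real ^ 'n::finite ^ 'n"
  assumes "invertible A"
  shows "A ** matrix_inv A = mat 1" "matrix_inv A ** A = mat 1"
  using someI_ex[OF assms[unfolded invertible_def]] unfolding matrix_inv_def by auto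

text \<open>
  Cramer's rule.
\<close>

lemma continuous_on_matrix_inv:
  fixes A :: "'a::topological_space \<Rightarrow> real ^ 'n::finite ^ 'n"
  assumes A: "continuous_on S A" and inv: "\<And>x. x \<in> S \<Longrightarrow> invertible (A x)"
  shows "continuous_on S (\<lambda>x. matrix_inv (A x) $ i $ j)"
proof -
  have "matrix_inv (A x) $ i $ j =
      det (\<chi> k l. if l = i then axis j 1 $ k else A x $ k $ l) / det (A x)" if "x \<in> S" for x
  proof -
    have d: "det (A x) \<noteq> 0"
      using inv[OF that] by (simp add: invertible_det_nz)
    have "A x *v (matrix_inv (A x) *v axis j 1) = axis j 1"
      using matrix_inv_inverse(1)[OF inv[OF that]] by (simp add: matrix_vector_mul_assoc)
    then have "matrix_inv (A x) *v axis j 1 = (\<chi> i. det (\<chi> k l. if l = i then axis j 1 $ k else A x $ k $ l) / det (A x))"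
      using cramer[OF d] by simp
    then show ?thesis
      by (simp add: vec_eq_iff matrix_vector_mult_basis column_def)
  qed
  moreover have "continuous_on S (\<lambda>x. det (\<chi> k l. if l = i then axis j 1 $ k else A x $ k $ l) / det (A x))"
  proof (intro continuous_on_divide continuous_on_det A continuous_on_vec_lambda)
    show "continuous_on S (\<lambda>x. if l = i then axis j 1 $ k else A x $ k $ l)" for k l
      by (cases "l = i") (auto intro!: continuous_intros A)
  qed (use inv in \<open>auto simp: invertible_det_nz\<close>)
  ultimately show ?thesis
    by (simp cong: continuous_on_cong)
qed

text \<open>
  On the segment from the identity to \<open>A\<close> all matrices are positive definite, so
  the determinant has no zero there and keeps its sign.
\<close>

lemma pos_def_det_pos:
  fixes A :: "real ^ 'n::finite ^ 'n"
  assumes pos: "\<And>v. v \<noteq> 0 \<Longrightarrow> v \<bullet> (A *v v) > 0"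
  shows "det A > 0"
proof (rule ccontr)
  assume neg: "\<not> det A > 0"
  define B where "B t = (1 - t) *\<^sub>R mat 1 + t *\<^sub>R A" for t :: real
  have "continuous_on {0..1} (\<lambda>t. det (B t))"
    unfolding B_def by (intro continuous_on_det continuous_intros)
  moreover have "det (B 0) = 1" "det (B 1) = det A"
    by (auto simp: B_def)
  ultimately obtain t where t: "0 \<le> t" "t \<le> 1" "det (B t) = 0"
    using IVT2'[of "\<lambda>t. det (B t)" 1 0 0] neg by auto
  then obtain v where v: "v \<noteq> 0" "B t *v v = 0"
    by (metis invertible_det_nz invertible_left_inverse matrix_left_invertible_ker)
  have "B t *v v = (1 - t) *\<^sub>R v + t *\<^sub>R (A *v v)"
    by (simp add: B_def matrix_vector_mult_add_rdistrib scaleR_matrix_vector_assoc[symmetric])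
  then have "0 = (1 - t) * (v \<bullet> v) + t * (v \<bullet> (A *v v))"
    using v(2) by (metis inner_add_right inner_scaleR_right inner_zero_right)
  moreover have "v \<bullet> v > 0" "v \<bullet> (A *v v) > 0"
    using v(1) pos by auto
  ultimately show False
    using t by (smt (verit) mult_nonneg_nonneg mult_pos_pos)
qed

lemma pos_def_invertible:
  fixes A :: "real ^ 'n::finite ^ 'n"
  assumes "\<And>v. v \<noteq> 0 \<Longrightarrow> v \<bullet> (A *v v) > 0"
  shows "invertible A"
  using pos_def_det_pos[OF assms] by (simp add: invertible_det_nz)

text \<open>
  The normalised path moves on the unit sphere with speed at most \<open>v\<close>. So the
  cosine \<open>h\<close> of its angle with the starting vector \<open>e\<close> satisfies
  \<open>\<bar>h'\<bar> \<le> v \<surd>(1 - h\<^sup>2)\<close>, which says that the angle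
  \<open>arccos h\<close> grows at rate at most \<open>v\<close>. Since \<open>arccos\<close> is
  not differentiable at the value \<open>1\<close>, where \<open>h\<close> starts, the estimate
  is made for \<open>arccos (r h)\<close> with \<open>r < 1\<close>, whose derivative obeys the
  same bound, and then \<open>r\<close> tends to \<open>1\<close>.
\<close>

lemma sphere_path_inner_ge_cos:
  fixes f f' :: "'i \<Rightarrow> real \<Rightarrow> real" and v :: "real \<Rightarrow> real" and I :: "'i set"
  defines "S \<equiv> \<lambda>t. \<Sum>k\<in>I. (f k t)\<^sup>2"
  assumes I: "finite I" and X: "finite X"
    and cont: "\<And>k. k \<in> I \<Longrightarrow> continuous_on {0..1} (f k)"
    and der: "\<And>k t. k \<in> I \<Longrightarrow> t \<in> {0<..<1} - X \<Longrightarrow> (f k has_real_derivative f' k t) (at t)"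
    and bound: "\<And>t. t \<in> {0<..<1} - X \<Longrightarrow> (\<Sum>k\<in>I. (f' k t)\<^sup>2) \<le> (v t)\<^sup>2 * S t"
    and Spos: "\<And>t. t \<in> {0..1} \<Longrightarrow> 0 < S t"
    and v: "(v has_integral l) {0..1}" "\<And>t. 0 \<le> v t" and l: "l \<le> pi"
  shows "sqrt (S 0) * sqrt (S 1) * cos l \<le> (\<Sum>k\<in>I. f k 0 * f k 1)"
proof -
  define e where "e k = f k 0 / sqrt (S 0)" for k
  define h where "h t = (\<Sum>k\<in>I. e k * f k t) / sqrt (S t)" for t
  \<comment> \<open>The derivative of \<open>h\<close>, written with the component of \<open>e\<close>
    orthogonal to the path; the squared norm of this component is \<open>1 -
    h\<^sup>2\<close>.\<close>
  define h' where "h' t = (\<Sum>k\<in>I. (e k - h t * (f k t / sqrt (S t))) * f' k t) / sqrt (S t)" for t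
  have Sc: "continuous_on {0..1} S"
    unfolding S_def by (intro continuous_intros cont)
  have S0: "S 0 > 0" "S 1 > 0"
    using Spos by auto
  have e1: "(\<Sum>k\<in>I. (e k)\<^sup>2) = 1"
    using S0 by (simp add: e_def power_divide sum_divide_distrib[symmetric]) (simp add: S_def)
  have f1: "(\<Sum>k\<in>I. (f k t / sqrt (S t))\<^sup>2) = 1" if "t \<in> {0..1}" for t
    using Spos[OF that] by (simp add: power_divide sum_divide_distrib[symmetric]) (simp add: S_def)
  have halt: "h t = (\<Sum>k\<in>I. e k * (f k t / sqrt (S t)))" for t
    by (simp add: h_def sum_divide_distrib)
  have hle: "(h t)\<^sup>2 \<le> 1" if "t \<in> {0..1}" for t
    using Cauchy_Schwarz_ineq_sum[of e "\<lambda>k. f k t / sqrt (S t)" I] e1 f1[OF that]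
    by (simp add: halt)
  have h0: "h 0 = 1"
    using e1 by (simp add: halt e_def[symmetric] power2_eq_square)
  have hc: "continuous_on {0..1} h"
    unfolding h_def
  proof (intro continuous_intros cont Sc ballI)
    show "sqrt (S t) \<noteq> 0" if "t \<in> {0..1}" for t
      using Spos[OF that] by simp
  qed
  have hd: "(h has_real_derivative h' t) (at t)" if t: "t \<in> {0<..<1} - X" for t
  proof -
    have St: "S t > 0"
      using Spos t by auto
    have Sd: "(S has_real_derivative (\<Sum>k\<in>I. 2 * f k t * f' k t)) (at t)"
      unfolding S_def by (auto intro!: derivative_eq_intros der[OF _ t] sum.cong)
    have "(h has_real_derivative ((\<Sum>k\<in>I. e k * f' k t) * sqrt (S t) -
        (\<Sum>k\<in>I. e k * f k t) * ((\<Sum>k\<in>I. 2 * f k t * f' k t) * (inverse (sqrt (S t)) / 2))) / (sqrt (S t) * sqrt (S t))) (at t)"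
      unfolding h_def
      by (rule derivative_eq_intros der[OF _ t] Sd refl | use St in \<open>simp add: mult.commute\<close>)+
    moreover have "((\<Sum>k\<in>I. e k * f' k t) * sqrt (S t) -
        (\<Sum>k\<in>I. e k * f k t) * ((\<Sum>k\<in>I. 2 * f k t * f' k t) * (inverse (sqrt (S t)) / 2))) / (sqrt (S t) * sqrt (S t)) = h' t"
    proof -
      have hs: "(\<Sum>k\<in>I. e k * f k t) = h t * sqrt (S t)"
        using St by (simp add: h_def)
      have A: "(\<Sum>k\<in>I. (e k - h t * (f k t / sqrt (S t))) * f' k t) =
          (\<Sum>k\<in>I. e k * f' k t) - h t / sqrt (S t) * (\<Sum>k\<in>I. f k t * f' k t)"
        by (simp add: sum_subtractf[symmetric] sum_distrib_left field_simps)
      have B: "(\<Sum>k\<in>I. 2 * f k t * f' k t) = 2 * (\<Sum>k\<in>I. f k t * f' k t)"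
        by (simp add: sum_distrib_left ac_simps)
      have "sqrt (S t) > 0"
        using St by simp
      then show ?thesis
        unfolding h'_def hs A B by (simp add: field_simps del: real_sqrt_gt_0_iff real_sqrt_mult_self)
    qed
    ultimately show ?thesis
      by simp
  qed
  have expand: "(\<Sum>k\<in>I. (e k - c * q k)\<^sup>2) =
      (\<Sum>k\<in>I. (e k)\<^sup>2) - 2 * c * (\<Sum>k\<in>I. e k * q k) + c\<^sup>2 * (\<Sum>k\<in>I. (q k)\<^sup>2)" for c q
    by (simp add: power2_diff sum.distrib sum_subtractf sum_distrib_left power_mult_distrib ac_simps)
  have h'le: "(h' t)\<^sup>2 \<le> (1 - (h t)\<^sup>2) * (v t)\<^sup>2" if t: "t \<in> {0<..<1} - X" for t
  proof -
    have t': "t \<in> {0..1}" and St: "S t > 0"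
      using Spos t by auto
    have "(h' t)\<^sup>2 = (\<Sum>k\<in>I. (e k - h t * (f k t / sqrt (S t))) * f' k t)\<^sup>2 / S t"
      using St by (simp add: h'_def power_divide)
    also have "\<dots> \<le> (\<Sum>k\<in>I. (e k - h t * (f k t / sqrt (S t)))\<^sup>2) * (\<Sum>k\<in>I. (f' k t)\<^sup>2) / S t"
      using St by (intro divide_right_mono Cauchy_Schwarz_ineq_sum) auto
    also have "\<dots> \<le> (\<Sum>k\<in>I. (e k - h t * (f k t / sqrt (S t)))\<^sup>2) * ((v t)\<^sup>2 * S t) / S t"
      using St bound[OF t] by (intro divide_right_mono mult_left_mono sum_nonneg) auto
    also have "(\<Sum>k\<in>I. (e k - h t * (f k t / sqrt (S t)))\<^sup>2) =
        (\<Sum>k\<in>I. (e k)\<^sup>2) - 2 * h t * (\<Sum>k\<in>I. e k * (f k t / sqrt (S t))) +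
        (h t)\<^sup>2 * (\<Sum>k\<in>I. (f k t / sqrt (S t))\<^sup>2)"
      by (rule expand)
    also have "\<dots> = 1 - (h t)\<^sup>2"
      unfolding e1 f1[OF t'] halt[symmetric] by (simp add: power2_eq_square)
    finally show ?thesis
      using St by simp
  qed
  have est: "arccos (r * h 1) \<le> arccos r + l" if r: "0 < r" "r < 1" for r
  proof -
    let ?G = "\<lambda>t. arccos (r * h t)"
    \<comment> \<open>At the finitely many exceptional parameters the value is free; \<open>v\<close> keeps
      the bound valid there.\<close>
    define G' where "G' t = (if t \<in> {0<..<1} - X then - (r * h' t) / sqrt (1 - (r * h t)\<^sup>2) else v t)" for t
    have rh: "(r * h t)\<^sup>2 < 1" if "t \<in> {0..1}" for t
    proof -
      have "(r * h t)\<^sup>2 \<le> r\<^sup>2"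
        using hle[OF that] by (simp add: power_mult_distrib mult_left_le)
      also have "\<dots> < 1"
        using r by (simp add: power_less_one_iff)
      finally show ?thesis .
    qed
    then have rh': "- 1 < r * h t \<and> r * h t < 1" if "t \<in> {0..1}" for t
      using that by (metis abs_square_less_1 abs_less_iff minus_less_iff)
    have "continuous_on {0..1} ?G"
      using rh' by (intro continuous_intros hc) (auto simp: less_imp_le)
    moreover have "(?G has_vector_derivative G' t) (at t)" if t: "t \<in> {0<..<1} - X" for t
    proof -
      have "(?G has_real_derivative inverse (- sqrt (1 - (r * h t)\<^sup>2)) * (r * h' t)) (at t)"
        using rh'[of t] t by (intro DERIV_chain2[OF DERIV_arccos DERIV_cmult[OF hd[OF t]]]) auto
      then show ?thesis
        using t by (simp add: G'_def has_real_derivative_iff_has_vector_derivative[symmetric] divide_inverse mult.commute)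
    qed
    ultimately have "(G' has_integral ?G 1 - ?G 0) {0..1}"
      by (intro fundamental_theorem_of_calculus_interior_strong[OF X]) auto
    moreover have "G' t \<le> v t" if "t \<in> {0..1}" for t
    proof (cases "t \<in> {0<..<1} - X")
      case True
      have q: "0 < 1 - (r * h t)\<^sup>2"
        using rh[OF that] by simp
      have "(G' t)\<^sup>2 = r\<^sup>2 * (h' t)\<^sup>2 / (1 - (r * h t)\<^sup>2)"
        using True q by (simp add: G'_def power_divide power_mult_distrib)
      also have "\<dots> \<le> r\<^sup>2 * ((1 - (h t)\<^sup>2) * (v t)\<^sup>2) / (1 - (r * h t)\<^sup>2)"
        using q h'le[OF True] by (intro divide_right_mono mult_left_mono) auto
      also have "\<dots> \<le> (v t)\<^sup>2"
      proof -
        have "r\<^sup>2 \<le> 1"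
          using r by (simp add: power_le_one)
        then have "r\<^sup>2 * (1 - (h t)\<^sup>2) \<le> 1 - (r * h t)\<^sup>2"
          by (simp add: power_mult_distrib right_diff_distrib)
        then have "r\<^sup>2 * (1 - (h t)\<^sup>2) * (v t)\<^sup>2 \<le> (1 - (r * h t)\<^sup>2) * (v t)\<^sup>2"
          by (rule mult_right_mono) simp
        then show ?thesis
          using q by (simp add: divide_le_eq ac_simps)
      qed
      finally show ?thesis
        using v(2)[of t] by (simp add: power2_le_iff_abs_le)
    qed (auto simp: G'_def)
    ultimately have "?G 1 - ?G 0 \<le> l"
      using v(1) has_integral_le by blast
    then show ?thesis
      by (simp add: h0)
  qed
  have "arccos (h 1) \<le> l"
  proof -
    let ?r = "\<lambda>n. 1 - inverse (real (Suc (Suc n)))"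
    have lim: "?r \<longlonglongrightarrow> 1"
      using LIMSEQ_Suc[OF LIMSEQ_inverse_real_of_nat_add_minus[of 1]] by simp
    have rb: "0 < ?r n" "?r n < 1" for n
      by (auto simp: field_simps)
    have h1: "\<bar>h 1\<bar> \<le> 1"
      using hle[of 1] by (simp add: abs_square_le_1)
    have "\<bar>?r n * h 1\<bar> \<le> 1 * 1" for n
      unfolding abs_mult using rb[of n] h1 by (intro mult_mono) auto
    then have b: "- 1 \<le> ?r n * h 1" "?r n * h 1 \<le> 1" for n
      by (auto simp: abs_le_iff minus_le_iff)
    have "(\<lambda>n. ?r n * h 1) \<longlonglongrightarrow> 1 * h 1"
      by (intro tendsto_intros lim)
    then have "(\<lambda>n. arccos (?r n * h 1)) \<longlonglongrightarrow> arccos (1 * h 1)"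
      using b h1 by (intro continuous_on_tendsto_compose[OF continuous_on_arccos']) (auto simp: abs_le_iff)
    moreover have "(\<lambda>n. arccos (?r n) + l) \<longlonglongrightarrow> arccos 1 + l"
    proof (intro tendsto_add tendsto_const continuous_on_tendsto_compose[OF continuous_on_arccos' lim])
      have "?r n \<in> {-1..1}" for n
        using rb[of n] unfolding atLeastAtMost_iff by linarith
      then show "\<forall>\<^sub>F n in sequentially. ?r n \<in> {-1..1}"
        by (rule always_eventually[OF allI])
    qed simp
    ultimately have "arccos (1 * h 1) \<le> arccos 1 + l"
      by (rule LIMSEQ_le) (use est rb in blast)
    then show ?thesis
      by simp
  qed
  moreover have h1: "- 1 \<le> h 1" "h 1 \<le> 1"
    using hle[of 1] by (auto simp: abs_square_le_1 abs_le_iff)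
  ultimately have "cos l \<le> cos (arccos (h 1))"
    using l by (intro cos_monotone_0_pi_le) (auto simp: arccos_lbound)
  then have "cos l \<le> h 1"
    using h1 by simp
  also have "h 1 = (\<Sum>k\<in>I. f k 0 * f k 1) / (sqrt (S 0) * sqrt (S 1))"
    by (simp add: h_def e_def sum_divide_distrib)
  finally show ?thesis
    using S0 by (simp add: pos_le_divide_eq mult.commute)
qed

section \<open>Charts, isometries and the speed of curves\<close>

lemma continuous_on_locallyI:
  assumes "\<And>x. x \<in> S \<Longrightarrow> \<exists>U. open U \<and> x \<in> U \<and> continuous_on (S \<inter> U) f"
  shows "continuous_on S f"
  unfolding continuous_on_def
proof
  fix x assume x: "x \<in> S"
  then obtain U where U: "open U" "x \<in> U" "continuous_on (S \<inter> U) f"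
    using assms by blast
  then have "(f \<longlongrightarrow> f x) (at x within S \<inter> U)"
    using x by (simp add: continuous_on_def)
  moreover have "at x within S \<inter> U = at x within S"
    using U by (intro at_within_nhd[of x U]) auto
  ultimately show "(f \<longlongrightarrow> f x) (at x within S)"
    by simp
qed

lemma open_preimage_within:
  assumes "continuous_on T \<gamma>" "open V"
  obtains U where "open U" "\<And>t. t \<in> T \<Longrightarrow> t \<in> U \<longleftrightarrow> \<gamma> t \<in> V"
proof -
  obtain U where "open U" "U \<inter> T = \<gamma> -` V \<inter> T"
    using assms unfolding continuous_on_open_invariant by blast
  then show ?thesis
    by (intro that[of U]) auto
qed

lemma curve_partition_mono:
  fixes t :: "nat \<Rightarrow> real"
  assumes "\<And>i. i < k \<Longrightarrow> t i < t (Suc i)" "i \<le> j" "j \<le> k"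
  shows "t i \<le> t j"
  using assms(2,3)
proof (induction j)
  case (Suc j)
  then show ?case
    using assms(1)[of j] by (cases "i = Suc j") force+
qed simp

context riemannian_manifold
begin

lemma chart_facts:
  assumes "c \<in> \<A>"
  shows open_chart: "open (fst c)"
    and open_chart_image: "open (snd c ` fst c)"
    and chart_inv_left: "\<And>p. p \<in> fst c \<Longrightarrow> chart_inv c (snd c p) = p"
    and chart_inv_right: "\<And>x. x \<in> snd c ` fst c \<Longrightarrow> snd c (chart_inv c x) = x"
    and chart_inv_in: "\<And>x. x \<in> snd c ` fst c \<Longrightarrow> chart_inv c x \<in> fst c"
    and continuous_on_chart: "continuous_on (fst c) (snd c)"
    and continuous_on_chart_inv: "continuous_on (snd c ` fst c) (chart_inv c)"
    and inj_on_chart: "inj_on (snd c) (fst c)"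
proof -
  have "is_chart c"
    using charts assms by blast
  then show o: "open (fst c)" "open (snd c ` fst c)" and l: "\<And>p. p \<in> fst c \<Longrightarrow> chart_inv c (snd c p) = p"
    and "\<And>x. x \<in> snd c ` fst c \<Longrightarrow> snd c (chart_inv c x) = x"
    and "continuous_on (fst c) (snd c)" "continuous_on (snd c ` fst c) (chart_inv c)"
    unfolding is_chart_def homeomorphism_def by auto
  show "\<And>x. x \<in> snd c ` fst c \<Longrightarrow> chart_inv c x \<in> fst c"
    using l by auto
  show "inj_on (snd c) (fst c)"
    using l by (metis inj_on_inverseI)
qed

lemma chart_at_in: "chart_at p \<in> \<A>" "p \<in> fst (chart_at p)"
proof -
  have "\<exists>c. c \<in> \<A> \<and> p \<in> fst c"
    using cover by blast
  from someI_ex[OF this] show "chart_at p \<in> \<A>" "p \<in> fst (chart_at p)"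
    unfolding chart_at_def by auto
qed

lemma continuous_on_metric:
  assumes "c \<in> \<A>"
  shows "continuous_on (fst c) (g c)"
proof -
  have "continuous_on (fst c) (\<lambda>p. g c (chart_inv c (snd c p)))"
    by (rule continuous_on_compose2[OF smooth_on_continuous_on[OF metric_smooth[OF assms]] continuous_on_chart[OF assms]])
      auto
  then show ?thesis
    using chart_inv_left[OF assms] by (simp cong: continuous_on_cong)
qed

text \<open>
  By this lemma every statement about isometries in a pair of charts contains the independence
  of the choice of the chart.
\<close>

lemma isometry_id: "isometry id"
proof -
  have "smooth_map id"
    unfolding smooth_map_def using compatible continuous_on_id[of UNIV] by (auto simp: id_def)
  moreover have "\<forall>c\<in>\<A>. \<forall>c'\<in>\<A>. \<forall>p. p \<in> fst c \<and> id p \<in> fst c' \<longrightarrow>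
      (let D = frechet_derivative (coord_map c c' id) (at (snd c p))
       in \<forall>v w. v \<bullet> (g c p *v w) = D v \<bullet> (g c' (id p) *v D w))"
    using metric_trans unfolding Let_def id_apply by blast
  ultimately show ?thesis
    unfolding isometry_def by simp
qed

lemma isometry_continuous: "isometry \<iota> \<Longrightarrow> continuous_on UNIV \<iota>"
  by (simp add: isometry_def smooth_map_def)

lemma isometry_smooth:
  assumes "isometry \<iota>" "c \<in> \<A>" "c' \<in> \<A>"
  shows "smooth_on (coord_dom c c' \<iota>) (coord_map c c' \<iota>)"
  using assms by (simp add: isometry_def smooth_map_def)

lemma isometry_coord_derivative:
  assumes "isometry \<iota>" "c \<in> \<A>" "c' \<in> \<A>" "p \<in> fst c" "\<iota> p \<in> fst c'"
  shows "(coord_map c c' \<iota> has_derivative frechet_derivative (coord_map c c' \<iota>) (at (snd c p))) (at (snd c p))"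
  by (rule smooth_on_has_derivative[OF isometry_smooth[OF assms(1-3)]])
    (use assms in \<open>auto simp: coord_dom_def\<close>)

lemma isometry_metric:
  assumes "isometry \<iota>" "c \<in> \<A>" "c' \<in> \<A>" "p \<in> fst c" "\<iota> p \<in> fst c'"
  shows "v \<bullet> (g c p *v w) = frechet_derivative (coord_map c c' \<iota>) (at (snd c p)) v \<bullet>
    (g c' (\<iota> p) *v frechet_derivative (coord_map c c' \<iota>) (at (snd c p)) w)"
  using assms unfolding isometry_def Let_def by blast

text \<open>
  One-sided at the end points, so that the speed of a C1 piece is continuous up to its ends.
\<close>

definition velocity :: "('a, 'n) chart \<Rightarrow> (real \<Rightarrow> 'a) \<Rightarrow> real \<Rightarrow> real \<Rightarrow> real \<Rightarrow> real ^ 'n" where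
  "velocity c \<gamma> a b t = vector_derivative (snd c \<circ> \<gamma>) (at t within {a..b})"

definition chart_speed :: "('a, 'n) chart \<Rightarrow> (real \<Rightarrow> 'a) \<Rightarrow> real \<Rightarrow> real \<Rightarrow> real \<Rightarrow> real" where
  "chart_speed c \<gamma> a b t = sqrt (velocity c \<gamma> a b t \<bullet> (g c (\<gamma> t) *v velocity c \<gamma> a b t))"

lemma C1_curve_continuous: "C1_curve \<gamma> a b \<Longrightarrow> continuous_on {a..b} \<gamma>"
  by (simp add: C1_curve_def)

lemma C1_curve_velocity:
  assumes C: "C1_curve \<gamma> a b" and ab: "a < b" and c: "c \<in> \<A>"
  shows has_velocity: "\<And>t. t \<in> {a..b} \<Longrightarrow> \<gamma> t \<in> fst c \<Longrightarrow>
      ((snd c \<circ> \<gamma>) has_vector_derivative velocity c \<gamma> a b t) (at t within {a..b})"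
    and continuous_on_velocity: "continuous_on ({a..b} \<inter> \<gamma> -` fst c) (velocity c \<gamma> a b)"
proof -
  obtain D where D: "continuous_on ({a..b} \<inter> \<gamma> -` fst c) D"
    "\<And>t. t \<in> {a..b} \<inter> \<gamma> -` fst c \<Longrightarrow> ((snd c \<circ> \<gamma>) has_vector_derivative D t) (at t within {a..b})"
    using C c unfolding C1_curve_def by blast
  have eq: "velocity c \<gamma> a b t = D t" if "t \<in> {a..b} \<inter> \<gamma> -` fst c" for t
    unfolding velocity_def using vector_derivative_within_closed_interval[of a b t "snd c \<circ> \<gamma>" "D t"] ab D(2)[OF that] that
    by simp
  show "((snd c \<circ> \<gamma>) has_vector_derivative velocity c \<gamma> a b t) (at t within {a..b})"
    if "t \<in> {a..b}" "\<gamma> t \<in> fst c" for t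
    using D(2)[of t] eq[of t] that by simp
  show "continuous_on ({a..b} \<inter> \<gamma> -` fst c) (velocity c \<gamma> a b)"
    by (rule continuous_on_eq[OF D(1) eq[symmetric]])
qed

lemma velocity_unique:
  assumes "((snd c \<circ> \<gamma>) has_vector_derivative D) (at t within {a..b})" "a < b" "t \<in> {a..b}"
  shows "velocity c \<gamma> a b t = D"
  unfolding velocity_def using vector_derivative_within_closed_interval[of a b t "snd c \<circ> \<gamma>" D] assms by simp

lemma velocity_isometry:
  assumes iso: "isometry \<iota>" and c: "c \<in> \<A>" "c' \<in> \<A>" and ab: "a < b" and t: "t \<in> {a..b}"
    and cont: "continuous_on {a..b} \<gamma>"
    and der: "((snd c \<circ> \<gamma>) has_vector_derivative w) (at t within {a..b})"
    and p: "\<gamma> t \<in> fst c" "\<iota> (\<gamma> t) \<in> fst c'"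
  shows "((snd c' \<circ> (\<iota> \<circ> \<gamma>)) has_vector_derivative
      frechet_derivative (coord_map c c' \<iota>) (at (snd c (\<gamma> t))) w) (at t within {a..b})"
proof -
  let ?J = "frechet_derivative (coord_map c c' \<iota>) (at (snd c (\<gamma> t)))"
  have J: "(coord_map c c' \<iota> has_derivative ?J) (at (snd c (\<gamma> t)))"
    using isometry_coord_derivative[OF iso c p] .
  then have "(coord_map c c' \<iota> has_derivative ?J) (at ((snd c \<circ> \<gamma>) t) within (snd c \<circ> \<gamma>) ` {a..b})"
    by (simp add: has_derivative_at_withinI)
  from vector_derivative_diff_chain_within[OF der this]
  have "((coord_map c c' \<iota> \<circ> (snd c \<circ> \<gamma>)) has_vector_derivative ?J w) (at t within {a..b})" .
  moreover obtain U where U: "open U" "\<And>s. s \<in> {a..b} \<Longrightarrow> s \<in> U \<longleftrightarrow> \<gamma> s \<in> fst c"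
    using open_preimage_within[OF cont open_chart[OF c(1)]] by blast
  then obtain d where d: "d > 0" "ball t d \<subseteq> U"
    using t p(1) open_contains_ball by blast
  show ?thesis
  proof (rule has_vector_derivative_transform_within[OF _ d(1) t])
    show "((coord_map c c' \<iota> \<circ> (snd c \<circ> \<gamma>)) has_vector_derivative ?J w) (at t within {a..b})"
      by fact
    show "(coord_map c c' \<iota> \<circ> (snd c \<circ> \<gamma>)) s = (snd c' \<circ> (\<iota> \<circ> \<gamma>)) s" if "s \<in> {a..b}" "dist s t < d" for s
      using that d(2) U(2)[of s] chart_inv_left[OF c(1), of "\<gamma> s"]
      by (auto simp: coord_map_def dist_commute subset_iff)
  qed
qed

lemma velocity_isometry_eq:
  assumes "isometry \<iota>" "c \<in> \<A>" "c' \<in> \<A>" "C1_curve \<gamma> a b" "a < b" "t \<in> {a..b}"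
    "\<gamma> t \<in> fst c" "\<iota> (\<gamma> t) \<in> fst c'"
  shows "velocity c' (\<iota> \<circ> \<gamma>) a b t =
    frechet_derivative (coord_map c c' \<iota>) (at (snd c (\<gamma> t))) (velocity c \<gamma> a b t)"
  using assms by (intro velocity_unique velocity_isometry has_velocity C1_curve_continuous) auto

lemma chart_speed_isometry:
  assumes "isometry \<iota>" "c \<in> \<A>" "c' \<in> \<A>" "C1_curve \<gamma> a b" "a < b" "t \<in> {a..b}"
    "\<gamma> t \<in> fst c" "\<iota> (\<gamma> t) \<in> fst c'"
  shows "chart_speed c' (\<iota> \<circ> \<gamma>) a b t = chart_speed c \<gamma> a b t"
  unfolding chart_speed_def velocity_isometry_eq[OF assms] o_apply
  using isometry_metric[OF assms(1-3,7,8)] by metis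

text \<open>
  Near each parameter the velocity in the target chart is the image of the velocity in a fixed
  source chart under the Jacobian, and both depend continuously on the parameter.
\<close>

lemma C1_curve_isometry:
  assumes iso: "isometry \<iota>" and C: "C1_curve \<gamma> a b" and ab: "a < b"
  shows "C1_curve (\<iota> \<circ> \<gamma>) a b"
  unfolding C1_curve_def
proof (intro conjI ballI)
  have \<gamma>c: "continuous_on {a..b} \<gamma>"
    using C by (rule C1_curve_continuous)
  show cont: "continuous_on {a..b} (\<iota> \<circ> \<gamma>)"
    by (rule continuous_on_compose[OF \<gamma>c]) (rule continuous_on_subset[OF isometry_continuous[OF iso]], simp)
  fix c' assume c': "c' \<in> \<A>"
  let ?T = "{a..b} \<inter> (\<iota> \<circ> \<gamma>) -` fst c'"
  have der: "((snd c' \<circ> (\<iota> \<circ> \<gamma>)) has_vector_derivative velocity c' (\<iota> \<circ> \<gamma>) a b t) (at t within {a..b})"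
    if t: "t \<in> ?T" for t
  proof -
    obtain c where c: "c \<in> \<A>" "\<gamma> t \<in> fst c"
      using cover by blast
    have t': "t \<in> {a..b}" "\<iota> (\<gamma> t) \<in> fst c'"
      using t by auto
    show ?thesis
      unfolding velocity_isometry_eq[OF iso c(1) c' C ab t'(1) c(2) t'(2)]
      by (rule velocity_isometry[OF iso c(1) c' ab t'(1) \<gamma>c has_velocity[OF C ab c(1) t'(1) c(2)] c(2) t'(2)])
  qed
  have "continuous_on ?T (velocity c' (\<iota> \<circ> \<gamma>) a b)"
  proof (rule continuous_on_locallyI)
    fix t assume t: "t \<in> ?T"
    obtain c where c: "c \<in> \<A>" "\<gamma> t \<in> fst c"
      using cover by blast
    obtain U where U: "open U" "\<And>s. s \<in> {a..b} \<Longrightarrow> s \<in> U \<longleftrightarrow> \<gamma> s \<in> fst c"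
      using open_preimage_within[OF \<gamma>c open_chart[OF c(1)]] by blast
    have "continuous_on (?T \<inter> U) (\<lambda>s. frechet_derivative (coord_map c c' \<iota>) (at (snd c (\<gamma> s))) (velocity c \<gamma> a b s))"
    proof (rule continuous_on_frechet_derivative[OF isometry_smooth[OF iso c(1) c']])
      show "continuous_on (?T \<inter> U) (\<lambda>s. snd c (\<gamma> s))"
        by (rule continuous_on_compose2[OF continuous_on_chart[OF c(1)] continuous_on_subset[OF \<gamma>c]])
          (use U in auto)
      show "continuous_on (?T \<inter> U) (velocity c \<gamma> a b)"
        by (rule continuous_on_subset[OF continuous_on_velocity[OF C ab c(1)]]) (use U in auto)
      show "snd c (\<gamma> s) \<in> coord_dom c c' \<iota>" if "s \<in> ?T \<inter> U" for s
        using that U by (auto simp: coord_dom_def)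
    qed
    moreover have "velocity c' (\<iota> \<circ> \<gamma>) a b s =
        frechet_derivative (coord_map c c' \<iota>) (at (snd c (\<gamma> s))) (velocity c \<gamma> a b s)" if "s \<in> ?T \<inter> U" for s
      using that U by (intro velocity_isometry_eq[OF iso c(1) c' C ab]) auto
    ultimately have "continuous_on (?T \<inter> U) (velocity c' (\<iota> \<circ> \<gamma>) a b)"
      by (rule continuous_on_eq[OF _ sym])
    then show "\<exists>U. open U \<and> t \<in> U \<and> continuous_on (?T \<inter> U) (velocity c' (\<iota> \<circ> \<gamma>) a b)"
      using U c t by auto
  qed
  then show "\<exists>D. continuous_on ?T D \<and> (\<forall>t\<in>?T. ((snd c' \<circ> (\<iota> \<circ> \<gamma>)) has_vector_derivative D t) (at t within {a..b}))"
    using der by blast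
qed

lemma chart_speed_indep:
  assumes "c \<in> \<A>" "c' \<in> \<A>" "C1_curve \<gamma> a b" "a < b" "t \<in> {a..b}" "\<gamma> t \<in> fst c" "\<gamma> t \<in> fst c'"
  shows "chart_speed c' \<gamma> a b t = chart_speed c \<gamma> a b t"
  using chart_speed_isometry[OF isometry_id, of c c' \<gamma> a b t] assms by simp

lemma speed_eq_chart_speed:
  assumes "C1_curve \<gamma> a b" "a < t" "t < b" "c \<in> \<A>" "\<gamma> t \<in> fst c"
  shows "speed \<gamma> t = chart_speed c \<gamma> a b t"
proof -
  have "at t within {a..b} = at t"
    using assms by (intro at_within_Icc_at) auto
  then have "speed \<gamma> t = chart_speed (chart_at (\<gamma> t)) \<gamma> a b t"
    by (simp add: speed_def chart_speed_def velocity_def Let_def)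
  also have "\<dots> = chart_speed c \<gamma> a b t"
    using assms chart_at_in by (intro chart_speed_indep) auto
  finally show ?thesis .
qed

lemma speed_isometry:
  assumes "isometry \<iota>" "C1_curve \<gamma> a b" "a < t" "t < b"
  shows "speed (\<iota> \<circ> \<gamma>) t = speed \<gamma> t"
proof -
  have "speed (\<iota> \<circ> \<gamma>) t = chart_speed (chart_at (\<iota> (\<gamma> t))) (\<iota> \<circ> \<gamma>) a b t"
    using assms chart_at_in by (intro speed_eq_chart_speed C1_curve_isometry) auto
  also have "\<dots> = chart_speed (chart_at (\<gamma> t)) \<gamma> a b t"
    using assms chart_at_in by (intro chart_speed_isometry) auto
  also have "\<dots> = speed \<gamma> t"
    using assms chart_at_in by (intro speed_eq_chart_speed[symmetric]) auto
  finally show ?thesis .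
qed

lemma metric_nonneg: "c \<in> \<A> \<Longrightarrow> p \<in> fst c \<Longrightarrow> 0 \<le> v \<bullet> (g c p *v v)"
  using metric_pos[of c p v] by (cases "v = 0") (auto simp: less_imp_le)

lemma speed_nonneg: "0 \<le> speed \<gamma> t"
  unfolding speed_def Let_def by (intro real_sqrt_ge_zero metric_nonneg chart_at_in)

lemma continuous_on_chart_speed:
  assumes C: "C1_curve \<gamma> a b" and ab: "a < b"
  shows "continuous_on {a..b} (\<lambda>t. chart_speed (chart_at (\<gamma> t)) \<gamma> a b t)"
proof (rule continuous_on_locallyI)
  fix t assume t: "t \<in> {a..b}"
  obtain c where c: "c \<in> \<A>" "\<gamma> t \<in> fst c"
    using cover by blast
  have \<gamma>c: "continuous_on {a..b} \<gamma>"
    using C by (rule C1_curve_continuous)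
  obtain U where U: "open U" "\<And>s. s \<in> {a..b} \<Longrightarrow> s \<in> U \<longleftrightarrow> \<gamma> s \<in> fst c"
    using open_preimage_within[OF \<gamma>c open_chart[OF c(1)]] by blast
  have v: "continuous_on ({a..b} \<inter> U) (velocity c \<gamma> a b)"
    by (rule continuous_on_subset[OF continuous_on_velocity[OF C ab c(1)]]) (use U in auto)
  have G: "continuous_on ({a..b} \<inter> U) (\<lambda>s. g c (\<gamma> s))"
    by (rule continuous_on_compose2[OF continuous_on_metric[OF c(1)] continuous_on_subset[OF \<gamma>c]]) (use U in auto)
  have "continuous_on ({a..b} \<inter> U) (\<lambda>s. g c (\<gamma> s) *v velocity c \<gamma> a b s)"
    unfolding matrix_vector_mult_def by (intro continuous_intros G v)
  then have "continuous_on ({a..b} \<inter> U) (chart_speed c \<gamma> a b)"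
    unfolding chart_speed_def by (intro continuous_intros v)
  moreover have "chart_speed (chart_at (\<gamma> s)) \<gamma> a b s = chart_speed c \<gamma> a b s" if "s \<in> {a..b} \<inter> U" for s
    using that U chart_at_in by (intro chart_speed_indep c C ab) auto
  ultimately have "continuous_on ({a..b} \<inter> U) (\<lambda>t. chart_speed (chart_at (\<gamma> t)) \<gamma> a b t)"
    by (rule continuous_on_eq[OF _ sym])
  then show "\<exists>U. open U \<and> t \<in> U \<and> continuous_on ({a..b} \<inter> U) (\<lambda>t. chart_speed (chart_at (\<gamma> t)) \<gamma> a b t)"
    using U t c by auto
qed

lemma C1_curve_speed_integrable:
  assumes C: "C1_curve \<gamma> a b" and ab: "a < b"
  shows "speed \<gamma> integrable_on {a..b}"
proof (rule integrable_spike[of "\<lambda>t. chart_speed (chart_at (\<gamma> t)) \<gamma> a b t" _ "{a, b}"])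
  show "(\<lambda>t. chart_speed (chart_at (\<gamma> t)) \<gamma> a b t) integrable_on {a..b}"
    by (rule integrable_continuous_real[OF continuous_on_chart_speed[OF C ab]])
  show "speed \<gamma> t = chart_speed (chart_at (\<gamma> t)) \<gamma> a b t" if "t \<in> {a..b} - {a, b}" for t
    using that chart_at_in by (intro speed_eq_chart_speed[OF C]) auto
qed auto

text \<open>
  Induction over the pieces. The set \<open>X\<close> consists of the break points; off
  \<open>X\<close> the two-sided derivative in the definition of the speed exists.
\<close>

lemma piecewise_C1_curve_facts:
  assumes "piecewise_C1_curve \<gamma>"
  shows piecewise_C1_continuous: "continuous_on {0..1} \<gamma>"
    and piecewise_C1_integrable: "speed \<gamma> integrable_on {0..1}"
    and piecewise_C1_pieces: "\<exists>X. finite X \<and> (\<forall>t\<in>{0..1} - X. \<exists>a b. a < t \<and> t < b \<and> C1_curve \<gamma> a b)"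
proof -
  obtain k t where t: "t (0::nat) = 0" "t k = 1"
    and C: "\<And>i. i < k \<Longrightarrow> t i < t (Suc i) \<and> C1_curve \<gamma> (t i) (t (Suc i))"
    using assms unfolding piecewise_C1_curve_def by blast
  have mono: "t i \<le> t j" if "i \<le> j" "j \<le> k" for i j
    using curve_partition_mono[of k t] C that by blast
  have ind: "j \<le> k \<Longrightarrow> continuous_on {0..t j} \<gamma> \<and> speed \<gamma> integrable_on {0..t j} \<and>
      (\<forall>s\<in>{0..t j} - t ` {..j}. \<exists>i<j. t i < s \<and> s < t (Suc i))" for j
  proof (induction j)
    case 0
    then show ?case
      using integrable_on_refl[of "speed \<gamma>" 0] by (simp add: t)
  next
    case (Suc j)
    have un: "{0..t (Suc j)} = {0..t j} \<union> {t j..t (Suc j)}"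
      using mono[of 0 j] C[of j] Suc.prems t by auto
    have "continuous_on ({0..t j} \<union> {t j..t (Suc j)}) \<gamma>"
      using Suc C[of j] C1_curve_continuous by (intro continuous_on_closed_Un) auto
    moreover have "speed \<gamma> integrable_on {0..t (Suc j)}"
    proof (rule Henstock_Kurzweil_Integration.integrable_combine[of 0 "t j"])
      show "speed \<gamma> integrable_on {t j..t (Suc j)}"
        using Suc.prems C[of j] by (intro C1_curve_speed_integrable) auto
    qed (use Suc C[of j] mono[of 0 j] t in auto)
    moreover have "\<exists>i<Suc j. t i < s \<and> s < t (Suc i)" if "s \<in> {0..t (Suc j)} - t ` {..Suc j}" for s
    proof (cases "s < t j")
      case True
      then have "s \<in> {0..t j} - t ` {..j}"
        using that by auto
      then obtain i where "i < j" "t i < s \<and> s < t (Suc i)"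
        using Suc.IH Suc.prems by (meson Suc_leD)
      then show ?thesis
        using less_SucI by blast
    next
      case False
      then have "s \<noteq> t j" "s \<noteq> t (Suc j)" "t j \<le> s" "s \<le> t (Suc j)"
        using that by auto
      then show ?thesis
        by (intro exI[of _ j]) auto
    qed
    ultimately show ?case
      unfolding un by blast
  qed
  from ind[of k] show "continuous_on {0..1} \<gamma>" "speed \<gamma> integrable_on {0..1}"
    by (auto simp: t)
  have "\<exists>a b. a < s \<and> s < b \<and> C1_curve \<gamma> a b" if s: "s \<in> {0..1} - t ` {..k}" for s
  proof -
    have "\<forall>s\<in>{0..1} - t ` {..k}. \<exists>i<k. t i < s \<and> s < t (Suc i)"
      using ind[of k] t by simp
    then obtain i where i: "i < k" "t i < s" "s < t (Suc i)"
      using s by blast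
    then show ?thesis
      using C[of i] by (intro exI[of _ "t i"] exI[of _ "t (Suc i)"]) auto
  qed
  then show "\<exists>X. finite X \<and> (\<forall>t\<in>{0..1} - X. \<exists>a b. a < t \<and> t < b \<and> C1_curve \<gamma> a b)"
    by (intro exI[of _ "t ` {..k}"]) auto
qed

lemma piecewise_C1_curve_isometry:
  assumes "isometry \<iota>" "piecewise_C1_curve \<gamma>"
  shows "piecewise_C1_curve (\<iota> \<circ> \<gamma>)"
  using assms C1_curve_isometry unfolding piecewise_C1_curve_def by blast

lemma curve_length_isometry:
  assumes iso: "isometry \<iota>" and "piecewise_C1_curve \<gamma>"
  shows "curve_length (\<iota> \<circ> \<gamma>) = curve_length \<gamma>"
proof -
  obtain X where X: "finite X"
    "\<forall>t\<in>{0..1} - X. \<exists>a b. a < t \<and> t < b \<and> C1_curve \<gamma> a b"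
    using piecewise_C1_pieces[OF assms(2)] by (elim exE conjE)
  show ?thesis
    unfolding curve_length_def
  proof (rule integral_spike[of X])
    show "speed \<gamma> t = speed (\<iota> \<circ> \<gamma>) t" if "t \<in> {0..1} - X" for t
    proof -
      from bspec[OF X(2) that] obtain a b where "C1_curve \<gamma> a b" "a < t" "t < b"
        by (elim exE conjE)
      then show ?thesis
        by (rule speed_isometry[OF iso, symmetric])
    qed
  qed (use X in auto)
qed

lemma rdist_le:
  "piecewise_C1_curve \<gamma> \<Longrightarrow> \<gamma> 0 = x \<Longrightarrow> \<gamma> 1 = y \<Longrightarrow> rdist x y \<le> ennreal (curve_length \<gamma>)"
  unfolding rdist_def by (rule INF_lower) auto

lemma rdist_less_iff:
  "rdist x y < ennreal r \<longleftrightarrow> (\<exists>\<gamma>. piecewise_C1_curve \<gamma> \<and> \<gamma> 0 = x \<and> \<gamma> 1 = y \<and> curve_length \<gamma> < r)"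
proof -
  have nonneg: "0 \<le> curve_length \<gamma>" for \<gamma>
    unfolding curve_length_def by (cases "speed \<gamma> integrable_on {0..1}")
      (auto intro: integral_nonneg simp: speed_nonneg not_integrable_integral)
  show ?thesis
    unfolding rdist_def INF_less_iff Bex_def mem_Collect_eq ennreal_less_iff[OF nonneg] by blast
qed

lemma rdist_isometry_le:
  assumes "isometry \<iota>"
  shows "rdist (\<iota> x) (\<iota> y) \<le> rdist x y"
  unfolding rdist_def[of x y]
proof (rule INF_greatest)
  fix \<gamma> assume "\<gamma> \<in> {\<gamma>. piecewise_C1_curve \<gamma> \<and> \<gamma> 0 = x \<and> \<gamma> 1 = y}"
  then show "rdist (\<iota> x) (\<iota> y) \<le> ennreal (curve_length \<gamma>)"
    using rdist_le[OF piecewise_C1_curve_isometry[OF assms], of \<gamma>] curve_length_isometry[OF assms, of \<gamma>] by auto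
qed

section \<open>The topology of the Riemannian distance\<close>

text \<open>
  The quadratic form is homogeneous in \<open>v\<close>, and positive and continuous on the
  compact product of \<open>K\<close> with the unit sphere.
\<close>

lemma metric_bounds:
  assumes c: "c \<in> \<A>" and K: "compact K" "K \<subseteq> fst c"
  obtains m M where "0 < m" "0 < M"
    "\<And>p v. p \<in> K \<Longrightarrow> m * (norm v)\<^sup>2 \<le> v \<bullet> (g c p *v v)"
    "\<And>p v. p \<in> K \<Longrightarrow> v \<bullet> (g c p *v v) \<le> M * (norm v)\<^sup>2"
proof (cases "K = {}")
  case True
  then show ?thesis
    using that[of 1 1] by simp
next
  case False
  let ?S = "K \<times> sphere (0 :: real ^ 'n) 1" and ?Q = "\<lambda>(p, v). v \<bullet> (g c p *v v)"
  have G: "continuous_on ?S (\<lambda>z. g c (fst z))"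
    by (rule continuous_on_compose2[OF continuous_on_metric[OF c] continuous_on_fst[OF continuous_on_id]]) (use K in auto)
  have "continuous_on ?S (\<lambda>z. g c (fst z) *v snd z)"
    unfolding matrix_vector_mult_def by (intro continuous_intros G)
  then have Q: "continuous_on ?S ?Q"
    unfolding case_prod_beta by (intro continuous_intros)
  have S: "compact ?S"
    using K by (intro compact_Times) auto
  have "axis undefined 1 \<in> sphere (0 :: real ^ 'n) 1"
    by simp
  then have ne: "?S \<noteq> {}"
    using False by blast
  obtain p0 v0 where z0: "p0 \<in> K" "norm v0 = 1" "\<And>z. z \<in> ?S \<Longrightarrow> v0 \<bullet> (g c p0 *v v0) \<le> ?Q z"
    using continuous_attains_inf[OF S ne Q] by auto
  obtain p1 v1 where z1: "p1 \<in> K" "norm v1 = 1" "\<And>z. z \<in> ?S \<Longrightarrow> ?Q z \<le> v1 \<bullet> (g c p1 *v v1)"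
    using continuous_attains_sup[OF S ne Q] by auto
  have scale: "v \<bullet> (g c p *v v) = (norm v)\<^sup>2 * ?Q (p, v /\<^sub>R norm v)" if "v \<noteq> 0" for p v
    using that by (simp add: matrix_vector_mult_scaleR power2_eq_square field_simps)
  show ?thesis
  proof (rule that)
    show "0 < v0 \<bullet> (g c p0 *v v0)" "0 < v1 \<bullet> (g c p1 *v v1)"
      using z0 z1 K metric_pos[OF c] by (metis norm_zero subsetD zero_neq_one)+
    fix p v assume p: "p \<in> K"
    show "(v0 \<bullet> (g c p0 *v v0)) * (norm v)\<^sup>2 \<le> v \<bullet> (g c p *v v)"
    proof (cases "v = 0")
      case False
      then have "v0 \<bullet> (g c p0 *v v0) \<le> ?Q (p, v /\<^sub>R norm v)"
        using p by (intro z0(3)) simp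
      then show ?thesis
        unfolding scale[OF False] by (subst mult.commute) (rule mult_left_mono, auto)
    qed simp
    show "v \<bullet> (g c p *v v) \<le> (v1 \<bullet> (g c p1 *v v1)) * (norm v)\<^sup>2"
    proof (cases "v = 0")
      case False
      then have "?Q (p, v /\<^sub>R norm v) \<le> v1 \<bullet> (g c p1 *v v1)"
        using p by (intro z1(3)) simp
      then show ?thesis
        unfolding scale[OF False] by (subst (2) mult.commute) (rule mult_left_mono, auto)
    qed simp
  qed
qed

lemma rdist_chart_segment:
  assumes c: "c \<in> \<A>" and seg: "closed_segment x y \<subseteq> snd c ` fst c"
    and M: "\<And>z v. z \<in> closed_segment x y \<Longrightarrow> v \<bullet> (g c (chart_inv c z) *v v) \<le> M * (norm v)\<^sup>2"
  shows "rdist (chart_inv c x) (chart_inv c y) \<le> ennreal (sqrt M * norm (y - x))"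
proof -
  define l where "l t = x + t *\<^sub>R (y - x)" for t
  define \<gamma> where "\<gamma> = (\<lambda>t. chart_inv c (l t))"
  have l: "l t \<in> closed_segment x y" if "t \<in> {0..1}" for t
    using that by (auto simp: l_def in_segment algebra_simps intro!: exI[of _ t])
  have lc: "continuous_on {0..1} l"
    unfolding l_def by (intro continuous_intros)
  have \<gamma>in: "\<gamma> t \<in> fst c" "snd c (\<gamma> t) = l t" if "t \<in> {0..1}" for t
    using l[OF that] seg chart_inv_in[OF c] chart_inv_right[OF c] by (auto simp: \<gamma>_def)
  have \<gamma>c: "continuous_on {0..1} \<gamma>"
    unfolding \<gamma>_def
    by (rule continuous_on_compose2[OF continuous_on_chart_inv[OF c] lc]) (use l seg in auto)
  have ld: "(l has_vector_derivative (y - x)) (at t within {0..1})" for t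
    unfolding l_def by (auto intro!: derivative_eq_intros)
  have der: "((snd c \<circ> \<gamma>) has_vector_derivative (y - x)) (at t within {0..1})" if "t \<in> {0..1}" for t
    by (rule has_vector_derivative_transform[OF that _ ld]) (use \<gamma>in in auto)
  have C: "C1_curve \<gamma> 0 1"
    unfolding C1_curve_def
  proof (intro conjI ballI \<gamma>c)
    fix c' assume c': "c' \<in> \<A>"
    let ?T = "{0..1} \<inter> \<gamma> -` fst c'"
    let ?D = "\<lambda>t. frechet_derivative (coord_map c c' id) (at (snd c (\<gamma> t))) (y - x)"
    have "continuous_on ?T ?D"
    proof (rule continuous_on_frechet_derivative[OF isometry_smooth[OF isometry_id c c']])
      show "continuous_on ?T (\<lambda>t. snd c (\<gamma> t))"
        by (rule continuous_on_compose2[OF continuous_on_chart[OF c] continuous_on_subset[OF \<gamma>c]])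
          (use \<gamma>in in auto)
      show "snd c (\<gamma> t) \<in> coord_dom c c' id" if "t \<in> ?T" for t
        using that \<gamma>in(1)[of t] unfolding coord_dom_def by (intro imageI) auto
    qed (intro continuous_intros)
    moreover have "((snd c' \<circ> \<gamma>) has_vector_derivative ?D t) (at t within {0..1})" if "t \<in> ?T" for t
      using velocity_isometry[OF isometry_id c c' _ _ \<gamma>c der, of t] that \<gamma>in[of t] by simp
    ultimately show "\<exists>D. continuous_on ?T D \<and>
        (\<forall>t\<in>?T. ((snd c' \<circ> \<gamma>) has_vector_derivative D t) (at t within {0..1}))"
      by blast
  qed
  have vel: "velocity c \<gamma> 0 1 t = y - x" if "t \<in> {0..1}" for t
    by (rule velocity_unique[OF der[OF that]]) (use that in auto)
  have sp: "speed \<gamma> t \<le> sqrt M * norm (y - x)" if "t \<in> {0<..<1}" for t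
  proof -
    have "speed \<gamma> t = chart_speed c \<gamma> 0 1 t"
      using that \<gamma>in by (intro speed_eq_chart_speed[OF C _ _ c]) auto
    also have "\<dots> = sqrt ((y - x) \<bullet> (g c (chart_inv c (l t)) *v (y - x)))"
      using that vel[of t] by (simp add: chart_speed_def \<gamma>_def)
    also have "\<dots> \<le> sqrt (M * (norm (y - x))\<^sup>2)"
      using M[OF l] that by simp
    finally show ?thesis
      by (simp add: real_sqrt_mult)
  qed
  have int: "speed \<gamma> integrable_on {0..1}"
    by (rule C1_curve_speed_integrable[OF C]) simp
  have "curve_length \<gamma> \<le> integral {0..1} (\<lambda>t::real. sqrt M * norm (y - x))"
  proof -
    let ?h = "\<lambda>t. if t \<in> {0<..<1} then speed \<gamma> t else sqrt M * norm (y - x)"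
    have "(?h has_integral curve_length \<gamma>) {0..1}"
      unfolding curve_length_def
      by (rule has_integral_spike_finite[of "{0, 1}", OF _ _ integrable_integral[OF int]]) auto
    moreover have "((\<lambda>t::real. sqrt M * norm (y - x)) has_integral integral {0..1} (\<lambda>t::real. sqrt M * norm (y - x))) {0..1}"
      by (rule integrable_integral) (rule integrable_const_ivl)
    ultimately show ?thesis
      by (rule has_integral_le) (use sp in auto)
  qed
  moreover have "piecewise_C1_curve \<gamma>"
    unfolding piecewise_C1_curve_def using C
    by (intro exI[of _ 1] exI[of _ real]) auto
  ultimately show ?thesis
    using rdist_le[of \<gamma> "chart_inv c x" "chart_inv c y"]
    by (auto simp: \<gamma>_def l_def intro: order_trans[OF _ ennreal_leI])
qed

lemma chart_cball:
  assumes c: "c \<in> \<A>" and U: "open U" "p \<in> fst c" "p \<in> U"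
  obtains \<rho> where "0 < \<rho>" "cball (snd c p) \<rho> \<subseteq> snd c ` (fst c \<inter> U)"
proof -
  have "snd c ` (fst c \<inter> U) = snd c ` fst c \<inter> chart_inv c -` U"
    using chart_inv_left[OF c] chart_inv_right[OF c] chart_inv_in[OF c] by force
  then have "open (snd c ` (fst c \<inter> U))"
    using continuous_open_preimage[OF continuous_on_chart_inv[OF c] open_chart_image[OF c] U(1)] by simp
  then show ?thesis
    using open_contains_cball U that by (metis IntI imageI)
qed

lemma open_chart_preimage:
  assumes c: "c \<in> \<A>" and V: "open V"
  shows "open (fst c \<inter> snd c -` V)"
  by (rule continuous_open_preimage[OF continuous_on_chart[OF c] open_chart[OF c] V])

lemma compact_chart_inv:
  assumes c: "c \<in> \<A>" and K: "compact K" "K \<subseteq> snd c ` fst c"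
  shows "compact (chart_inv c ` K)"
  by (rule compact_continuous_image[OF continuous_on_subset[OF continuous_on_chart_inv[OF c] K(2)] K(1)])

lemma rdist_small_nbhd:
  assumes r: "0 < r"
  obtains W where "open W" "x \<in> W" "\<And>y. y \<in> W \<Longrightarrow> rdist x y < ennreal r"
proof -
  obtain c where c: "c \<in> \<A>" "x \<in> fst c"
    using cover by blast
  obtain \<rho> where \<rho>: "0 < \<rho>" "cball (snd c x) \<rho> \<subseteq> snd c ` fst c"
    using chart_cball[OF c(1) open_UNIV c(2)] by auto
  have K: "compact (chart_inv c ` cball (snd c x) \<rho>)" "chart_inv c ` cball (snd c x) \<rho> \<subseteq> fst c"
    using compact_chart_inv[OF c(1) _ \<rho>(2)] \<rho>(2) chart_inv_in[OF c(1)] by auto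
  obtain M where M: "0 < M" "\<And>p v. p \<in> chart_inv c ` cball (snd c x) \<rho> \<Longrightarrow> v \<bullet> (g c p *v v) \<le> M * (norm v)\<^sup>2"
    using metric_bounds[OF c(1) K] by metis
  define \<delta> where "\<delta> = min \<rho> (r / (2 * sqrt M))"
  have \<delta>: "0 < \<delta>" "\<delta> \<le> \<rho>" "sqrt M * \<delta> < r"
  proof -
    show "0 < \<delta>" "\<delta> \<le> \<rho>"
      using \<rho> r M by (auto simp: \<delta>_def)
    have "sqrt M * \<delta> \<le> sqrt M * (r / (2 * sqrt M))"
      using M by (intro mult_left_mono) (auto simp: \<delta>_def)
    also have "\<dots> < r"
      using M r by simp
    finally show "sqrt M * \<delta> < r" .
  qed
  show ?thesis
  proof (rule that[of "fst c \<inter> snd c -` ball (snd c x) \<delta>"])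
    show "open (fst c \<inter> snd c -` ball (snd c x) \<delta>)"
      by (rule open_chart_preimage[OF c(1)]) simp
    show "x \<in> fst c \<inter> snd c -` ball (snd c x) \<delta>"
      using c \<delta> by simp
    fix y assume y: "y \<in> fst c \<inter> snd c -` ball (snd c x) \<delta>"
    have seg: "closed_segment (snd c x) (snd c y) \<subseteq> cball (snd c x) \<rho>"
      using y \<delta> \<rho> by (intro closed_segment_subset) auto
    have "rdist (chart_inv c (snd c x)) (chart_inv c (snd c y)) \<le> ennreal (sqrt M * norm (snd c y - snd c x))"
      by (rule rdist_chart_segment[OF c(1)]) (use seg \<rho> M in auto)
    also have "\<dots> < ennreal r"
    proof (rule ennreal_lessI[OF r])
      have "sqrt M * norm (snd c y - snd c x) \<le> sqrt M * \<delta>"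
        using y M by (intro mult_left_mono) (auto simp: dist_norm norm_minus_commute)
      then show "sqrt M * norm (snd c y - snd c x) < r"
        using \<delta> by simp
    qed
    finally show "rdist x y < ennreal r"
      using y c chart_inv_left[OF c(1)] by simp
  qed
qed

text \<open>
  A curve that leaves a coordinate ball around \<open>x\<close> has Euclidean length at least
  the radius \<open>\<rho>\<close> before its first exit, and there the metric is bounded below
  by a multiple of the Euclidean one.
\<close>

lemma rball_base:
  assumes U: "open U" "x \<in> U"
  obtains r where "0 < r" "rball x r \<subseteq> U"
proof -
  obtain c where c: "c \<in> \<A>" "x \<in> fst c"
    using cover by blast
  obtain \<rho> where \<rho>: "0 < \<rho>" "cball (snd c x) \<rho> \<subseteq> snd c ` (fst c \<inter> U)"
    using chart_cball[OF c(1) U(1) c(2) U(2)] by auto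
  let ?K = "chart_inv c ` cball (snd c x) \<rho>"
  have sub: "cball (snd c x) \<rho> \<subseteq> snd c ` fst c"
    using \<rho> by auto
  have KU: "?K \<subseteq> fst c \<inter> U"
    using \<rho>(2) chart_inv_left[OF c(1)] by fastforce
  have K: "compact ?K"
    by (rule compact_chart_inv[OF c(1) _ sub]) simp
  obtain m where m: "0 < m" "\<And>p v. p \<in> ?K \<Longrightarrow> m * (norm v)\<^sup>2 \<le> v \<bullet> (g c p *v v)"
    using metric_bounds[OF c(1) K] KU by (metis le_inf_iff)
  let ?B = "fst c \<inter> snd c -` ball (snd c x) \<rho>"
  have oB: "open ?B"
    by (rule open_chart_preimage[OF c(1)]) simp
  have BK: "?B \<subseteq> ?K"
  proof
    fix z assume z: "z \<in> ?B"
    then have "chart_inv c (snd c z) \<in> ?K"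
      by (intro imageI) auto
    then show "z \<in> ?K"
      using z chart_inv_left[OF c(1)] by simp
  qed
  have "y \<in> U" if y: "rdist x y < ennreal (sqrt m * \<rho>)" for y
  proof (rule ccontr)
    assume yU: "y \<notin> U"
    obtain \<gamma> where \<gamma>: "piecewise_C1_curve \<gamma>" "\<gamma> 0 = x" "\<gamma> 1 = y" "curve_length \<gamma> < sqrt m * \<rho>"
      using y unfolding rdist_less_iff by blast
    have \<gamma>c: "continuous_on {0..1} \<gamma>"
      by (rule piecewise_C1_continuous[OF \<gamma>(1)])
    let ?T = "{0..1} \<inter> \<gamma> -` (- ?B)"
    have clT: "closed ?T"
      by (rule continuous_closed_preimage[OF \<gamma>c closed_atLeastAtMost]) (rule closed_Compl[OF oB])
    have "y \<notin> ?B"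
      using yU BK KU by blast
    then have neT: "1 \<in> ?T"
      using \<gamma>(3) by auto
    have bdd: "bdd_below ?T"
      by (rule bdd_belowI[of _ 0]) simp
    \<comment> \<open>The first exit time.\<close>
    define s where "s = Inf ?T"
    have s: "s \<in> ?T"
      unfolding s_def by (rule closed_contains_Inf[OF _ bdd clT]) (use neT in blast)
    have before: "\<gamma> t \<in> ?B" if "0 \<le> t" "t < s" for t
    proof (rule ccontr)
      assume "\<gamma> t \<notin> ?B"
      then have "t \<in> ?T"
        using that s by auto
      then have "s \<le> t"
        unfolding s_def by (rule cInf_lower[OF _ bdd])
      then show False
        using that by simp
    qed
    have s01: "0 < s" "s \<le> 1"
      using s \<gamma>(2) c \<rho> by (auto simp: less_le)
    have sK: "\<gamma> s \<in> ?K"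
    proof -
      have "((\<lambda>t. \<gamma> t) \<longlongrightarrow> \<gamma> s) (at_left s)"
      proof -
        have "continuous_on {0..s} \<gamma>"
          using \<gamma>c s01 by (rule_tac continuous_on_subset) auto
        then have "(\<gamma> \<longlongrightarrow> \<gamma> s) (at s within {0..s})"
          using s01 by (simp add: continuous_on_def)
        then show ?thesis
          using s01 by (simp add: at_within_Icc_at_left)
      qed
      moreover have "eventually (\<lambda>t. \<gamma> t \<in> ?K) (at_left s)"
        unfolding eventually_at_left[OF s01(1)] using before BK s01 by (intro exI[of _ 0]) auto
      ultimately show ?thesis
        by (rule Lim_in_closed_set[OF compact_imp_closed[OF K], rotated 2]) simp
    qed
    have inK: "\<gamma> t \<in> ?K" if "t \<in> {0..s}" for t
      using before[of t] sK BK that by (cases "t = s") auto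
    have inc: "\<gamma> t \<in> fst c" if "t \<in> {0..s}" for t
      using inK[OF that] KU by auto
    define f where "f t = snd c (\<gamma> t)" for t
    have fc: "continuous_on {0..s} f"
      unfolding f_def
      by (rule continuous_on_compose2[OF continuous_on_chart[OF c(1)] continuous_on_subset[OF \<gamma>c]])
        (use inc s01 in auto)
    obtain X where X: "finite X" "\<forall>t\<in>{0..1} - X. \<exists>a b. a < t \<and> t < b \<and> C1_curve \<gamma> a b"
      using piecewise_C1_pieces[OF \<gamma>(1)] by (elim exE conjE)
    define f' where "f' t = (if t \<in> {0<..<s} - X then vector_derivative f (at t) else 0)" for t
    have der: "(f has_vector_derivative f' t) (at t) \<and> norm (f' t) \<le> speed \<gamma> t / sqrt m" if t: "t \<in> {0<..<s} - X" for t
    proof -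
      have "t \<in> {0..1} - X"
        using t s01 by auto
      from bspec[OF X(2) this] obtain a b where ab: "a < t" "t < b" "C1_curve \<gamma> a b"
        by (elim exE conjE)
      have tc: "\<gamma> t \<in> fst c" "\<gamma> t \<in> ?K"
        using inc[of t] inK[of t] t by auto
      have "(f has_vector_derivative velocity c \<gamma> a b t) (at t within {a..b})"
        using has_velocity[OF ab(3) _ c(1) _ tc(1)] ab unfolding f_def by (simp add: o_def)
      then have fd: "(f has_vector_derivative velocity c \<gamma> a b t) (at t)"
        using ab by (simp add: at_within_Icc_at)
      then have f': "f' t = velocity c \<gamma> a b t"
        using t by (simp add: f'_def vector_derivative_at)
      have "sqrt m * norm (f' t) = sqrt (m * (norm (f' t))\<^sup>2)"
        by (simp add: real_sqrt_mult)
      also have "\<dots> \<le> chart_speed c \<gamma> a b t"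
        unfolding chart_speed_def f' using m(2)[OF tc(2)] by simp
      also have "\<dots> = speed \<gamma> t"
        using speed_eq_chart_speed[OF ab(3,1,2) c(1) tc(1)] by simp
      finally show ?thesis
        using fd f' m(1) by (simp add: pos_le_divide_eq mult.commute)
    qed
    have "(f' has_integral f s - f 0) {0..s}"
      by (rule fundamental_theorem_of_calculus_interior_strong[OF X(1)]) (use s01 fc der in auto)
    then have f'int: "norm (f s - f 0) = norm (integral {0..s} f')" "f' integrable_on {0..s}"
      by (auto simp: integral_unique)
    have isp: "speed \<gamma> integrable_on {0..s}"
      by (rule integrable_on_subinterval[OF piecewise_C1_integrable[OF \<gamma>(1)]]) (use s01 in auto)
    then have isp': "(\<lambda>t. speed \<gamma> t / sqrt m) integrable_on {0..s}"
      by (rule integrable_on_divide)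
    have "norm (f' t) \<le> speed \<gamma> t / sqrt m" for t
      using der[of t] speed_nonneg[of \<gamma> t] m(1) by (cases "t \<in> {0<..<s} - X") (auto simp: f'_def)
    then have "norm (f s - f 0) \<le> integral {0..s} (\<lambda>t. speed \<gamma> t / sqrt m)"
      unfolding f'int(1) by (intro integral_norm_bound_integral f'int(2) isp')
    also have "\<dots> = integral {0..s} (speed \<gamma>) / sqrt m"
      by simp
    also have "\<dots> \<le> curve_length \<gamma> / sqrt m"
      unfolding curve_length_def
      using m(1) s01 speed_nonneg isp piecewise_C1_integrable[OF \<gamma>(1)]
      by (intro divide_right_mono integral_subset_le) auto
    also have "\<dots> < \<rho>"
      using \<gamma>(4) m(1) by (simp add: pos_divide_less_eq mult.commute)
    finally have "dist (snd c x) (snd c (\<gamma> s)) < \<rho>"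
      using \<gamma>(2) by (simp add: f_def dist_norm norm_minus_commute)
    then have "\<gamma> s \<in> ?B"
      using inc[of s] s01 by simp
    then show False
      using s by simp
  qed
  then show ?thesis
    using m(1) \<rho>(1) by (intro that[of "sqrt m * \<rho>"]) (auto simp: rball_def)
qed

lemma C1_curve_cong:
  assumes "C1_curve \<gamma> a b" "\<And>t. t \<in> {a..b} \<Longrightarrow> \<gamma>' t = \<gamma> t"
  shows "C1_curve \<gamma>' a b"
  unfolding C1_curve_def
proof (intro conjI ballI)
  show "continuous_on {a..b} \<gamma>'"
    by (rule continuous_on_eq[OF C1_curve_continuous[OF assms(1)] assms(2)[symmetric]])
  fix c assume c: "c \<in> \<A>"
  have eq: "{a..b} \<inter> \<gamma>' -` fst c = {a..b} \<inter> \<gamma> -` fst c"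
    using assms(2) by auto
  obtain D where D: "continuous_on ({a..b} \<inter> \<gamma> -` fst c) D"
    "\<forall>t\<in>{a..b} \<inter> \<gamma> -` fst c. ((snd c \<circ> \<gamma>) has_vector_derivative D t) (at t within {a..b})"
    using assms(1) c unfolding C1_curve_def by blast
  have "((snd c \<circ> \<gamma>') has_vector_derivative D t) (at t within {a..b})" if "t \<in> {a..b} \<inter> \<gamma> -` fst c" for t
    by (rule has_vector_derivative_transform[OF _ _ D(2)[rule_format, OF that]]) (use that assms(2) in auto)
  then show "\<exists>D. continuous_on ({a..b} \<inter> \<gamma>' -` fst c) D \<and>
      (\<forall>t\<in>{a..b} \<inter> \<gamma>' -` fst c. ((snd c \<circ> \<gamma>') has_vector_derivative D t) (at t within {a..b}))"
    unfolding eq using D(1) by blast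
qed

lemma C1_curve_affine:
  fixes m k :: real
  assumes C: "C1_curve \<gamma> (m * a + k) (m * b + k)" and m: "0 < m"
  shows "C1_curve (\<lambda>t. \<gamma> (m * t + k)) a b"
  unfolding C1_curve_def
proof (intro conjI ballI)
  let ?I = "{m * a + k..m * b + k}" and ?l = "\<lambda>t. m * t + k"
  have l: "?l t \<in> ?I" if "t \<in> {a..b}" for t
    using that m by simp
  have lc: "continuous_on T ?l" for T
    by (intro continuous_intros)
  show "continuous_on {a..b} (\<lambda>t. \<gamma> (m * t + k))"
    by (rule continuous_on_compose2[OF C1_curve_continuous[OF C] lc]) (use l in auto)
  fix c assume c: "c \<in> \<A>"
  let ?\<gamma> = "\<lambda>t. \<gamma> (m * t + k)"
  obtain D where D: "continuous_on (?I \<inter> \<gamma> -` fst c) D"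
    "\<forall>t\<in>?I \<inter> \<gamma> -` fst c. ((snd c \<circ> \<gamma>) has_vector_derivative D t) (at t within ?I)"
    using C c unfolding C1_curve_def by blast
  have "((snd c \<circ> ?\<gamma>) has_vector_derivative m *\<^sub>R D (?l t)) (at t within {a..b})" if "t \<in> {a..b} \<inter> ?\<gamma> -` fst c" for t
  proof -
    have "(?l has_vector_derivative m) (at t within {a..b})"
      by (auto intro!: derivative_eq_intros)
    moreover have "((snd c \<circ> \<gamma>) has_vector_derivative D (?l t)) (at (?l t) within ?l ` {a..b})"
      by (rule has_vector_derivative_within_subset[OF D(2)[rule_format]]) (use that l in auto)
    ultimately have "((snd c \<circ> \<gamma>) \<circ> ?l has_vector_derivative m *\<^sub>R D (?l t)) (at t within {a..b})"
      by (rule vector_diff_chain_within)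
    then show ?thesis
      by (simp add: o_def)
  qed
  moreover have "continuous_on ({a..b} \<inter> ?\<gamma> -` fst c) (\<lambda>t. m *\<^sub>R D (?l t))"
    by (intro continuous_intros continuous_on_compose2[OF D(1) lc]) (use l in auto)
  ultimately show "\<exists>D. continuous_on ({a..b} \<inter> ?\<gamma> -` fst c) D \<and>
      (\<forall>t\<in>{a..b} \<inter> ?\<gamma> -` fst c. ((snd c \<circ> ?\<gamma>) has_vector_derivative D t) (at t within {a..b}))"
    by (intro exI[of _ "\<lambda>t. m *\<^sub>R D (?l t)"]) blast
qed

lemma speed_affine:
  fixes m k :: real
  assumes C: "C1_curve \<gamma> a b" and m: "0 < m" and t: "a < m * t + k" "m * t + k < b"
    and U: "open U" "t \<in> U" "\<And>s. s \<in> U \<Longrightarrow> \<gamma>' s = \<gamma> (m * s + k)"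
  shows "speed \<gamma>' t = m * speed \<gamma> (m * t + k)"
proof -
  define c where "c = chart_at (\<gamma> (m * t + k))"
  have c: "c \<in> \<A>" "\<gamma> (m * t + k) \<in> fst c"
    by (auto simp: c_def chart_at_in)
  have "((snd c \<circ> \<gamma>) has_vector_derivative velocity c \<gamma> a b (m * t + k)) (at (m * t + k) within {a..b})"
    using t by (intro has_velocity[OF C _ c(1) _ c(2)]) auto
  then have D: "((snd c \<circ> \<gamma>) has_vector_derivative velocity c \<gamma> a b (m * t + k)) (at (m * t + k))"
    using t by (simp add: at_within_Icc_at)
  have "((\<lambda>t. m * t + k) has_vector_derivative m) (at t)"
    by (auto intro!: derivative_eq_intros)
  from vector_diff_chain_at[OF this D]
  have "((snd c \<circ> \<gamma>) \<circ> (\<lambda>t. m * t + k) has_vector_derivative m *\<^sub>R velocity c \<gamma> a b (m * t + k)) (at t)" .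
  then have "((snd c \<circ> \<gamma>') has_vector_derivative m *\<^sub>R velocity c \<gamma> a b (m * t + k)) (at t)"
    by (rule has_vector_derivative_transform_within_open[OF _ U(1,2)]) (use U(3) in auto)
  then have "vector_derivative (snd c \<circ> \<gamma>') (at t) = m *\<^sub>R vector_derivative (snd c \<circ> \<gamma>) (at (m * t + k))"
    using vector_derivative_at[OF D] by (simp add: vector_derivative_at)
  then show ?thesis
    using U(3)[OF U(2)] m
    by (simp add: speed_def Let_def c_def[symmetric] matrix_vector_mult_scaleR real_sqrt_mult mult.assoc[symmetric])
qed

text \<open>
  Each curve is run through at double speed on an interval of half the length.
\<close>

lemma piecewise_C1_join:
  assumes \<gamma>1: "piecewise_C1_curve \<gamma>1" and \<gamma>2: "piecewise_C1_curve \<gamma>2" and join: "\<gamma>1 1 = \<gamma>2 0"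
  defines "\<gamma> \<equiv> \<lambda>t. if t \<le> 1 / 2 then \<gamma>1 (2 * t) else \<gamma>2 (2 * t - 1)"
  shows "piecewise_C1_curve \<gamma>" and "curve_length \<gamma> = curve_length \<gamma>1 + curve_length \<gamma>2"
proof -
  obtain k1 t1 where t1: "t1 (0::nat) = 0" "t1 k1 = 1"
    "\<And>i. i < k1 \<Longrightarrow> t1 i < t1 (Suc i) \<and> C1_curve \<gamma>1 (t1 i) (t1 (Suc i))"
    using \<gamma>1 unfolding piecewise_C1_curve_def by blast
  obtain k2 t2 where t2: "t2 (0::nat) = 0" "t2 k2 = 1"
    "\<And>i. i < k2 \<Longrightarrow> t2 i < t2 (Suc i) \<and> C1_curve \<gamma>2 (t2 i) (t2 (Suc i))"
    using \<gamma>2 unfolding piecewise_C1_curve_def by blast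
  define t where "t i = (if i \<le> k1 then t1 i / 2 else (1 + t2 (i - k1)) / 2)" for i
  have right: "\<gamma> s = \<gamma>2 (2 * s + (- 1))" if "1 / 2 \<le> s" for s
  proof (cases "s = 1 / 2")
    case True
    then show ?thesis
      unfolding True using join by (simp add: \<gamma>_def)
  qed (use that in \<open>auto simp: \<gamma>_def\<close>)
  show pw: "piecewise_C1_curve \<gamma>"
    unfolding piecewise_C1_curve_def
  proof (intro exI[of _ "k1 + k2"] exI[of _ t] conjI allI impI)
    show "t 0 = 0"
      by (simp add: t_def t1)
    show "t (k1 + k2) = 1"
      using t1 t2 by (cases "k2 = 0") (auto simp: t_def)
    fix i assume i: "i < k1 + k2"
    consider "i < k1" | "k1 \<le> i"
      by linarith
    then have "t i < t (Suc i) \<and> C1_curve \<gamma> (t i) (t (Suc i))"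
    proof cases
      case 1
      have "C1_curve \<gamma>1 (2 * t i + 0) (2 * t (Suc i) + 0)"
        using t1(3)[OF 1] 1 by (simp add: t_def)
      from C1_curve_affine[OF this] have "C1_curve (\<lambda>s. \<gamma>1 (2 * s + 0)) (t i) (t (Suc i))"
        by simp
      moreover have "t (Suc i) \<le> 1 / 2"
        using curve_partition_mono[of k1 t1 "Suc i" k1] t1 1 by (simp add: t_def)
      ultimately have "C1_curve \<gamma> (t i) (t (Suc i))"
        by (rule_tac C1_curve_cong) (auto simp: \<gamma>_def)
      then show ?thesis
        using t1(3)[OF 1] 1 by (simp add: t_def)
    next
      case 2
      define j where "j = i - k1"
      have j: "j < k2" "i = k1 + j"
        using 2 i by (auto simp: j_def)
      have ti: "t i = (1 + t2 j) / 2" "t (Suc i) = (1 + t2 (Suc j)) / 2"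
        using t1 t2 by (cases "j = 0"; simp add: t_def j)+
      have "C1_curve \<gamma>2 (2 * t i + (- 1)) (2 * t (Suc i) + (- 1))"
        using t2(3)[OF j(1)] by (simp add: ti add_divide_distrib)
      from C1_curve_affine[OF this] have A: "C1_curve (\<lambda>s. \<gamma>2 (2 * s + (- 1))) (t i) (t (Suc i))"
        by simp
      have "1 / 2 \<le> t i"
        unfolding ti(1) using curve_partition_mono[of k2 t2 0 j] t2 j(1) by simp
      then have "C1_curve \<gamma> (t i) (t (Suc i))"
        by (intro C1_curve_cong[OF A right]) auto
      then show ?thesis
        using t2(3)[OF j(1)] by (simp add: ti)
    qed
    then show "t i < t (Suc i)" "C1_curve \<gamma> (t i) (t (Suc i))"
      by auto
  qed
  have half: "(speed \<gamma> has_integral curve_length \<delta>) {a..a + 1 / 2}"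
    if \<delta>: "piecewise_C1_curve \<delta>" and eq: "\<And>s. s \<in> {a<..<a + 1 / 2} \<Longrightarrow> \<gamma> s = \<delta> (2 * s + (- 2 * a))"
    for \<delta> and a :: real
  proof -
    obtain X where X: "finite X" "\<forall>t\<in>{0..1} - X. \<exists>a b. a < t \<and> t < b \<and> C1_curve \<delta> a b"
      using piecewise_C1_pieces[OF \<delta>] by (elim exE conjE)
    have "(speed \<delta> has_integral curve_length \<delta>) (cbox 0 1)"
      unfolding curve_length_def using piecewise_C1_integrable[OF \<delta>] by (simp add: integrable_integral)
    from has_integral_affinity[OF this, of 2 "- 2 * a"]
    have "((\<lambda>s. speed \<delta> (2 * s + (- 2 * a))) has_integral curve_length \<delta> / 2) {a..a + 1 / 2}"
      using image_affinity_atLeastAtMost[of "1 / 2" a 0 1] by (simp add: add.commute)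
    from has_integral_mult_right[OF this, of 2]
    have I: "((\<lambda>s. 2 * speed \<delta> (2 * s + (- 2 * a))) has_integral curve_length \<delta>) {a..a + 1 / 2}"
      by simp
    let ?Y = "{a, a + 1 / 2} \<union> (\<lambda>x. a + x / 2) ` X"
    have fin: "finite ?Y"
      using X(1) by simp
    have sp: "speed \<gamma> s = 2 * speed \<delta> (2 * s + (- 2 * a))" if s: "s \<in> {a..a + 1 / 2} - ?Y" for s
    proof -
      have "2 * s + (- 2 * a) \<notin> X"
      proof
        assume "2 * s + (- 2 * a) \<in> X"
        then have "a + (2 * s + (- 2 * a)) / 2 \<in> ?Y"
          by blast
        moreover have "a + (2 * s + (- 2 * a)) / 2 = s"
          by (simp add: field_simps)
        ultimately show False
          using s by simp
      qed
      then have "2 * s + (- 2 * a) \<in> {0..1} - X"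
        using s by auto
      from bspec[OF X(2) this] obtain u v where "u < 2 * s + (- 2 * a)" "2 * s + (- 2 * a) < v" "C1_curve \<delta> u v"
        by (elim exE conjE)
      then show ?thesis
        using s eq speed_affine[of \<delta> u v 2 s "- 2 * a" "{a<..<a + 1 / 2}" \<gamma>] by simp
    qed
    show ?thesis
      by (rule has_integral_spike_finite[OF fin sp I])
  qed
  have "(speed \<gamma> has_integral curve_length \<gamma>1) {0..0 + 1 / 2}"
    by (rule half[OF \<gamma>1]) (auto simp: \<gamma>_def)
  moreover have "(speed \<gamma> has_integral curve_length \<gamma>2) {1 / 2..1 / 2 + 1 / 2}"
    by (rule half[OF \<gamma>2]) (auto simp: right)
  ultimately have "(speed \<gamma> has_integral curve_length \<gamma>1 + curve_length \<gamma>2) {0..1}"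
    by (intro has_integral_combine[of 0 "1 / 2" 1]) auto
  then show "curve_length \<gamma> = curve_length \<gamma>1 + curve_length \<gamma>2"
    unfolding curve_length_def[of \<gamma>] by (rule integral_unique)
qed

lemma rdist_triangle_less:
  assumes "rdist x y < ennreal a" "rdist y z < ennreal b"
  shows "rdist x z < ennreal (a + b)"
proof -
  obtain \<gamma>1 where 1: "piecewise_C1_curve \<gamma>1" "\<gamma>1 0 = x" "\<gamma>1 1 = y" "curve_length \<gamma>1 < a"
    using assms(1) unfolding rdist_less_iff by blast
  obtain \<gamma>2 where 2: "piecewise_C1_curve \<gamma>2" "\<gamma>2 0 = y" "\<gamma>2 1 = z" "curve_length \<gamma>2 < b"
    using assms(2) unfolding rdist_less_iff by blast
  have "\<gamma>1 1 = \<gamma>2 0"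
    using 1 2 by simp
  from piecewise_C1_join[OF 1(1) 2(1) this] show ?thesis
    unfolding rdist_less_iff using 1 2
    by (intro exI[of _ "\<lambda>t. if t \<le> 1 / 2 then \<gamma>1 (2 * t) else \<gamma>2 (2 * t - 1)"]) auto
qed

lemma open_rball: "open (rball x r)"
proof (subst open_subopen, intro ballI)
  fix y assume "y \<in> rball x r"
  then obtain \<gamma> where \<gamma>: "piecewise_C1_curve \<gamma>" "\<gamma> 0 = x" "\<gamma> 1 = y" "curve_length \<gamma> < r"
    unfolding rball_def mem_Collect_eq rdist_less_iff by blast
  define s where "s = (curve_length \<gamma> + r) / 2"
  have s: "curve_length \<gamma> < s" "s < r"
    using \<gamma>(4) by (auto simp: s_def)
  then have xy: "rdist x y < ennreal s"
    unfolding rdist_less_iff using \<gamma> by blast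
  obtain W where W: "open W" "y \<in> W" "\<And>z. z \<in> W \<Longrightarrow> rdist y z < ennreal (r - s)"
    using rdist_small_nbhd[of "r - s" y] s(2) by (metis diff_gt_0_iff_gt)
  have "W \<subseteq> rball x r"
  proof
    fix z assume "z \<in> W"
    from rdist_triangle_less[OF xy W(3)[OF this]] show "z \<in> rball x r"
      by (simp add: rball_def)
  qed
  then show "\<exists>T. open T \<and> y \<in> T \<and> T \<subseteq> rball x r"
    using W by blast
qed

lemma center_in_rball:
  assumes "0 < r"
  shows "x \<in> rball x r"
proof -
  obtain W where "open W" "x \<in> W" "\<And>y. y \<in> W \<Longrightarrow> rdist x y < ennreal r"
    using rdist_small_nbhd[OF assms, of x] by metis
  then show ?thesis
    by (simp add: rball_def)
qed

text \<open>
  A Lebesgue number argument: if \<open>x\<close> lies in one of the finitely many covering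
  balls and \<open>y\<close> is near \<open>x\<close>, then both lie in the ball of twice the
  radius, on which \<open>f\<close> varies little.
\<close>

lemma uniformly_continuous_rdist:
  fixes f :: "'a \<Rightarrow> real"
  assumes M: "compact (UNIV :: 'a set)" and f: "continuous_on UNIV f" and e: "0 < e"
  obtains r where "0 < r" "\<And>x y. rdist x y < ennreal r \<Longrightarrow> \<bar>f x - f y\<bar> < e"
proof -
  have "\<exists>r>0. \<forall>y\<in>rball x r. \<bar>f y - f x\<bar> < e / 2" for x
  proof -
    have "open {y. \<bar>f y - f x\<bar> < e / 2}"
      by (intro open_Collect_less continuous_intros f)
    then obtain r where "0 < r" "rball x r \<subseteq> {y. \<bar>f y - f x\<bar> < e / 2}"
      using rball_base[of "{y. \<bar>f y - f x\<bar> < e / 2}" x] e by auto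
    then show ?thesis
      by blast
  qed
  then obtain r where r: "\<And>x. 0 < r x" "\<And>x y. y \<in> rball x (r x) \<Longrightarrow> \<bar>f y - f x\<bar> < e / 2"
    by metis
  have cover: "UNIV \<subseteq> (\<Union>x\<in>UNIV. rball x (r x / 2))"
  proof
    fix x
    have "x \<in> rball x (r x / 2)"
      using center_in_rball[of "r x / 2" x] r(1)[of x] by simp
    then show "x \<in> (\<Union>x\<in>UNIV. rball x (r x / 2))"
      by blast
  qed
  obtain C where C: "finite C" "UNIV \<subseteq> (\<Union>x\<in>C. rball x (r x / 2))"
    by (rule compactE_image[OF M open_rball cover])
  have Cne: "C \<noteq> {}"
    using C(2) by auto
  define d where "d = Min ((\<lambda>x. r x / 2) ` C)"
  have d: "0 < d" "\<And>x. x \<in> C \<Longrightarrow> d \<le> r x / 2"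
  proof -
    show "0 < d"
      unfolding d_def using C(1) Cne r(1) by (subst Min_gr_iff) auto
    show "d \<le> r x / 2" if "x \<in> C" for x
      unfolding d_def using C(1) that by (intro Min_le) auto
  qed
  show ?thesis
  proof (rule that[OF d(1)])
    fix y z assume yz: "rdist y z < ennreal d"
    obtain x where x: "x \<in> C" "rdist x y < ennreal (r x / 2)"
      using C(2) by (auto simp: rball_def)
    have "rdist x z < ennreal (r x / 2 + d)"
      by (rule rdist_triangle_less[OF x(2) yz])
    also have "\<dots> \<le> ennreal (r x)"
      using d(2)[OF x(1)] by (intro ennreal_leI) linarith
    finally have "\<bar>f z - f x\<bar> < e / 2"
      by (intro r(2)) (simp add: rball_def)
    moreover have "rdist x y < ennreal (r x)"
      using x(2) r(1)[of x] by (elim less_le_trans) (intro ennreal_leI, simp)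
    then have "\<bar>f y - f x\<bar> < e / 2"
      by (intro r(2)) (simp add: rball_def)
    ultimately show "\<bar>f y - f z\<bar> < e"
      by linarith
  qed
qed

end

section \<open>The Riemannian volume\<close>

lemma finite_disjointed_partition:
  fixes F :: "'i \<Rightarrow> 'a set"
  assumes "finite I" "(\<Union>i\<in>I. F i) = UNIV" "\<And>i. i \<in> I \<Longrightarrow> F i \<in> sets M" "space M = UNIV"
  obtains E where "\<And>i. i \<in> I \<Longrightarrow> E i \<in> sets M" "\<And>i. i \<in> I \<Longrightarrow> E i \<subseteq> F i"
    "disjoint_family_on E I" "(\<Union>i\<in>I. E i) = UNIV"
proof -
  obtain f :: "'i \<Rightarrow> nat" where f: "inj_on f I"
    using finite_imp_inj_to_nat_seg[OF assms(1)] by (elim exE conjE)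
  define E where "E i = F i - (\<Union>j\<in>{j \<in> I. f j < f i}. F j)" for i
  show ?thesis
  proof (rule that[of E])
    show "E i \<in> sets M" if "i \<in> I" for i
      unfolding E_def using assms(1,3) that by (intro sets.Diff sets.finite_UN) auto
    show "E i \<subseteq> F i" for i
      by (auto simp: E_def)
    show "disjoint_family_on E I"
      unfolding disjoint_family_on_def
    proof (intro ballI impI)
      fix i j assume ij: "i \<in> I" "j \<in> I" "i \<noteq> j"
      then have "f i < f j \<or> f j < f i"
        using f by (meson inj_onD nat_neq_iff)
      then show "E i \<inter> E j = {}"
        using ij by (auto simp: E_def)
    qed
    show "(\<Union>i\<in>I. E i) = UNIV"
    proof (intro set_eqI iffI UNIV_I)
      fix x
      let ?P = "\<lambda>i. i \<in> I \<and> x \<in> F i"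
      have "\<exists>i. ?P i"
        using assms(2) by blast
      then obtain i where i: "?P i" "\<And>j. ?P j \<Longrightarrow> f i \<le> f j"
        using ex_has_least_nat[of ?P _ f] by blast
      then have "x \<in> E i"
        by (fastforce simp: E_def)
      then show "x \<in> (\<Union>i\<in>I. E i)"
        using i by blast
    qed
  qed
qed

context riemannian_manifold
begin

lemma isometry_bij: "isometry \<iota> \<Longrightarrow> bij \<iota>"
  by (simp add: isometry_def)

lemma isometry_image_borel:
  assumes "isometry \<iota>" "B \<in> sets borel"
  shows "\<iota> ` B \<in> sets borel"
proof -
  have "continuous_on UNIV (inv \<iota>)"
    using assms(1) by (simp add: isometry_def smooth_map_def)
  then have "inv \<iota> \<in> borel_measurable borel"
    by (rule borel_measurable_continuous_onI)
  from measurable_sets[OF this assms(2)] show ?thesis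
    using bij_vimage_eq_inv_image[OF bij_imp_bij_inv[OF isometry_bij[OF assms(1)]], of B]
      isometry_bij[OF assms(1)] by (simp add: inv_inv_eq)
qed

text \<open>The Jacobian of an isometry in coordinates intertwines the two coefficient matrices.\<close>

lemma isometry_metric_matrix:
  assumes "isometry \<iota>" "c \<in> \<A>" "c' \<in> \<A>" "p \<in> fst c" "\<iota> p \<in> fst c'"
  defines "J \<equiv> matrix (frechet_derivative (coord_map c c' \<iota>) (at (snd c p)))"
  shows "g c p = transpose J ** g c' (\<iota> p) ** J"
proof -
  have D: "frechet_derivative (coord_map c c' \<iota>) (at (snd c p)) v = J *v v" for v
    unfolding J_def
    by (rule fun_cong[OF matrix_vector_mul(2)[OF has_derivative_linear[OF isometry_coord_derivative[OF assms(1-5)]]], symmetric])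
  have "g c p *v w = (transpose J ** g c' (\<iota> p) ** J) *v w" for w
  proof -
    have "v \<bullet> (g c p *v w) = v \<bullet> ((transpose J ** g c' (\<iota> p) ** J) *v w)" for v
    proof -
      have "v \<bullet> (g c p *v w) = (g c' (\<iota> p) *v (J *v w)) \<bullet> (J *v v)"
        using isometry_metric[OF assms(1-5), of v w] by (simp add: D inner_commute)
      also have "\<dots> = (transpose J *v (g c' (\<iota> p) *v (J *v w))) \<bullet> v"
        by (simp add: dot_lmul_matrix)
      finally show ?thesis
        by (subst inner_commute) (simp only: matrix_vector_mul_assoc matrix_mul_assoc)
    qed
    then show ?thesis
      using vector_eq_ldot[of "g c p *v w" "(transpose J ** g c' (\<iota> p) ** J) *v w"] by blast
  qed
  then show ?thesis
    by (simp add: matrix_eq)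
qed

lemma metric_det_pos: "c \<in> \<A> \<Longrightarrow> p \<in> fst c \<Longrightarrow> 0 < det (g c p)"
  using pos_def_det_pos metric_pos by blast

lemma isometry_sqrt_det:
  assumes "isometry \<iota>" "c \<in> \<A>" "c' \<in> \<A>" "p \<in> fst c" "\<iota> p \<in> fst c'"
  shows "sqrt (det (g c p)) =
    \<bar>det (matrix (frechet_derivative (coord_map c c' \<iota>) (at (snd c p))))\<bar> * sqrt (det (g c' (\<iota> p)))"
  unfolding isometry_metric_matrix[OF assms]
  by (simp add: det_mul det_transpose real_sqrt_mult)

text \<open>
  Set to \<open>0\<close> outside the range of the chart, to obtain a Borel function on the
  whole space.
\<close>

definition vol_density :: "('a, 'n) chart \<Rightarrow> real ^ 'n \<Rightarrow> real" where
  "vol_density c x = indicator (snd c ` fst c) x * sqrt (det (g c (chart_inv c x)))"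

definition chart_vol :: "('a, 'n) chart \<Rightarrow> 'a set \<Rightarrow> ennreal" where
  "chart_vol c B = (\<integral>\<^sup>+x\<in>snd c ` B. ennreal (sqrt (det (g c (chart_inv c x)))) \<partial>lborel)"

lemma continuous_on_chart_density:
  assumes c: "c \<in> \<A>"
  shows "continuous_on (snd c ` fst c) (\<lambda>x. sqrt (det (g c (chart_inv c x))))"
  by (intro continuous_intros continuous_on_det smooth_on_continuous_on metric_smooth c)

lemma measurable_vol_density:
  assumes c: "c \<in> \<A>"
  shows "vol_density c \<in> borel_measurable borel"
  unfolding vol_density_def[abs_def]
  using borel_measurable_continuous_on_indicator[OF _ continuous_on_chart_density[OF c]] open_chart_image[OF c]
  by simp

lemma chart_image_borel:
  assumes c: "c \<in> \<A>" and B: "B \<in> sets borel" "B \<subseteq> fst c"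
  shows "snd c ` B \<in> sets borel"
proof -
  have "chart_inv c \<in> borel_measurable (restrict_space borel (snd c ` fst c))"
    by (rule borel_measurable_continuous_on_restrict[OF continuous_on_chart_inv[OF c]])
  from measurable_sets[OF this B(1)]
  have "chart_inv c -` B \<inter> snd c ` fst c \<in> sets borel"
    using open_chart_image[OF c] by (simp add: sets_restrict_space_iff space_restrict_space)
  moreover have "chart_inv c -` B \<inter> snd c ` fst c = snd c ` B"
    using B(2) chart_inv_left[OF c] by force
  ultimately show ?thesis
    by simp
qed

lemma chart_vol_eq:
  assumes c: "c \<in> \<A>" and B: "B \<in> sets borel" "B \<subseteq> fst c"
  shows "chart_vol c B = emeasure (density lborel (vol_density c)) (snd c ` B)"
proof -
  have "emeasure (density lborel (vol_density c)) (snd c ` B) =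
      (\<integral>\<^sup>+x\<in>snd c ` B. ennreal (vol_density c x) \<partial>lborel)"
    using measurable_vol_density[OF c] chart_image_borel[OF assms] by (intro emeasure_density) auto
  also have "\<dots> = chart_vol c B"
    unfolding chart_vol_def using B(2) by (intro nn_integral_cong) (auto simp: vol_density_def indicator_def)
  finally show ?thesis ..
qed

lemma chart_vol_suminf:
  fixes F :: "nat \<Rightarrow> 'a set"
  assumes c: "c \<in> \<A>" and F: "\<And>k. F k \<in> sets borel" "\<And>k. F k \<subseteq> fst c" "disjoint_family F"
  shows "(\<Sum>k. chart_vol c (F k)) = chart_vol c (\<Union>k. F k)"
proof -
  have disj: "disjoint_family (\<lambda>k. snd c ` F k)"
    unfolding disjoint_family_on_def
  proof (intro ballI impI)
    fix i j :: nat assume "i \<noteq> j"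
    then have "F i \<inter> F j = {}"
      using F(3) by (auto simp: disjoint_family_on_def)
    then show "snd c ` F i \<inter> snd c ` F j = {}"
      using inj_on_image_Int[OF inj_on_chart[OF c], of "F i" "F j"] F(2) by simp
  qed
  have "(\<Sum>k. chart_vol c (F k)) = (\<Sum>k. emeasure (density lborel (vol_density c)) (snd c ` F k))"
    using chart_vol_eq[OF c F(1,2)] by simp
  also have "\<dots> = emeasure (density lborel (vol_density c)) (\<Union>k. snd c ` F k)"
    using disj chart_image_borel[OF c F(1,2)] by (intro suminf_emeasure) auto
  also have "\<dots> = chart_vol c (\<Union>k. F k)"
    using F by (subst chart_vol_eq[OF c]) (auto simp: image_UN)
  finally show ?thesis .
qed

lemma chart_vol_empty: "chart_vol c {} = 0"
  by (simp add: chart_vol_def)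

text \<open>
  In coordinates an isometry is a diffeomorphism whose Jacobian determinant is the quotient of the
  two densities, so the change of variables formula applies. The identity is an isometry: this
  case says that the volumes computed in two charts agree.
\<close>

lemma chart_vol_isometry:
  assumes iso: "isometry \<iota>" and c: "c \<in> \<A>" "c' \<in> \<A>" and B: "B \<in> sets borel" "B \<subseteq> fst c" "\<iota> ` B \<subseteq> fst c'"
  shows "chart_vol c' (\<iota> ` B) = chart_vol c B"
proof -
  let ?S = "snd c ` B" and ?h = "coord_map c c' \<iota>" and ?f = "\<lambda>y. sqrt (det (g c' (chart_inv c' y)))"
  let ?h' = "\<lambda>x. frechet_derivative ?h (at x)" and ?d = "\<lambda>x. sqrt (det (g c (chart_inv c x)))"
  have h: "?h (snd c p) = snd c' (\<iota> p)" if "p \<in> B" for p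
    using that B(2) chart_inv_left[OF c(1)] by (auto simp: coord_map_def)
  have img: "?h ` ?S = snd c' ` (\<iota> ` B)"
    using h by (force simp: image_image)
  have S: "?S \<in> sets borel" "?h ` ?S \<in> sets borel"
    unfolding img using B iso c by (auto intro!: chart_image_borel isometry_image_borel)
  have jac: "\<bar>det (matrix (?h' x))\<bar> * ?f (?h x) = ?d x" if x: "x \<in> ?S" for x
  proof -
    obtain p where p: "x = snd c p" "p \<in> B"
      using x by blast
    then have "p \<in> fst c" "\<iota> p \<in> fst c'"
      using B by auto
    then show ?thesis
      using isometry_sqrt_det[OF iso c, of p] h[OF p(2)] p chart_inv_left c by simp
  qed
  have "(\<integral>\<^sup>+y\<in>?h ` ?S. ennreal (?f y) \<partial>lborel) =
      (\<integral>\<^sup>+x\<in>?S. ennreal (\<bar>det (matrix (?h' x))\<bar> * ?f (?h x)) \<partial>lborel)"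
  proof (rule nn_integral_change_of_variables[OF S(1)])
    fix x assume "x \<in> ?S"
    then obtain p where p: "x = snd c p" "p \<in> B"
      by auto
    then show "(?h has_derivative ?h' x) (at x within ?S)"
      using B isometry_coord_derivative[OF iso c, of p] by (auto intro: has_derivative_at_withinI)
  next
    show "inj_on ?h ?S"
    proof (rule inj_onI)
      fix x y assume "x \<in> ?S" "y \<in> ?S" "?h x = ?h y"
      then obtain p q where pq: "x = snd c p" "y = snd c q" "p \<in> B" "q \<in> B" "snd c' (\<iota> p) = snd c' (\<iota> q)"
        using h by force
      then have "\<iota> p = \<iota> q"
        using B(3) inj_on_chart[OF c(2)] by (meson image_subset_iff inj_onD)
      then show "x = y"
        using pq isometry_bij[OF iso] by (metis bij_pointE)
    qed
  next
    fix y assume "y \<in> ?h ` ?S"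
    then obtain q where "y = snd c' q" "q \<in> fst c'"
      unfolding img using B(3) by auto
    then show "0 \<le> ?f y"
      using metric_det_pos[OF c(2), of q] chart_inv_left[OF c(2)] by (simp add: less_imp_le)
  next
    show "(\<lambda>y. indicator (?h ` ?S) y * ?f y) \<in> borel_measurable borel"
      using borel_measurable_continuous_on_indicator[OF S(2) continuous_on_subset[OF continuous_on_chart_density[OF c(2)]]]
        B(3) unfolding img by (simp add: image_mono)
    have "(\<lambda>x. indicator ?S x * (\<bar>det (matrix (?h' x))\<bar> * ?f (?h x))) = (\<lambda>x. indicator ?S x * ?d x)"
      using jac by (auto simp: indicator_def fun_eq_iff)
    then show "(\<lambda>x. indicator ?S x * (\<bar>det (matrix (?h' x))\<bar> * ?f (?h x))) \<in> borel_measurable borel"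
      using borel_measurable_continuous_on_indicator[OF S(1) continuous_on_subset[OF continuous_on_chart_density[OF c(1)]]]
        B(2) by (simp add: image_mono)
  qed
  also have "\<dots> = chart_vol c B"
    unfolding chart_vol_def using jac by (intro nn_integral_cong) (simp add: indicator_def)
  finally show ?thesis
    unfolding chart_vol_def img .
qed

lemma chart_vol_indep:
  assumes "c \<in> \<A>" "c' \<in> \<A>" "B \<in> sets borel" "B \<subseteq> fst c" "B \<subseteq> fst c'"
  shows "chart_vol c' B = chart_vol c B"
  using chart_vol_isometry[OF isometry_id assms(1,2,3,4)] assms(5) by simp

end

locale compact_riemannian_manifold = riemannian_manifold \<A> g
  for \<A> :: "('a::{t2_space, second_countable_topology}, 'n::finite) chart set" and g +
  assumes compact_UNIV: "compact (UNIV :: 'a set)"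
begin

lemma finite_chart_partition:
  obtains I E where "finite I" "I \<subseteq> \<A>" "\<And>c. c \<in> I \<Longrightarrow> E c \<in> sets borel" "\<And>c. c \<in> I \<Longrightarrow> E c \<subseteq> fst c"
    "disjoint_family_on E I" "(\<Union>c\<in>I. E c) = UNIV"
proof -
  note main = that
  have UN: "UNIV \<subseteq> (\<Union>c\<in>\<A>. fst c)"
    using cover by blast
  obtain I where I: "I \<subseteq> \<A>" "finite I" "UNIV \<subseteq> (\<Union>c\<in>I. fst c)"
    by (rule compactE_image[of UNIV \<A> fst, OF compact_UNIV open_chart UN])
  have "fst c \<in> sets borel" if "c \<in> I" for c
    using I(1) that by (intro borel_open open_chart) auto
  then have F: "\<And>c. c \<in> I \<Longrightarrow> fst c \<in> sets borel" .
  show ?thesis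
  proof (rule finite_disjointed_partition[of I fst borel])
    show "(\<Union>c\<in>I. fst c) = UNIV"
      using I(3) by blast
    show "thesis" if "\<And>c. c \<in> I \<Longrightarrow> E c \<in> sets borel" "\<And>c. c \<in> I \<Longrightarrow> E c \<subseteq> fst c"
      "disjoint_family_on E I" "(\<Union>c\<in>I. E c) = UNIV" for E
      using I(2,1) that by (rule main)
  qed (use F I(2) in auto)
qed

text \<open>
  A measure is determined on each piece of a finite Borel partition subordinate to the charts.
\<close>

lemma volume_unique:
  assumes "sets \<mu> = sets borel" "\<And>c B. c \<in> \<A> \<Longrightarrow> B \<in> sets borel \<Longrightarrow> B \<subseteq> fst c \<Longrightarrow> emeasure \<mu> B = chart_vol c B"
    and "sets \<nu> = sets borel" "\<And>c B. c \<in> \<A> \<Longrightarrow> B \<in> sets borel \<Longrightarrow> B \<subseteq> fst c \<Longrightarrow> emeasure \<nu> B = chart_vol c B"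
  shows "\<mu> = \<nu>"
proof (rule measure_eqI)
  show "sets \<mu> = sets \<nu>"
    using assms by simp
  obtain I E where E: "finite I" "I \<subseteq> \<A>" "\<And>c. c \<in> I \<Longrightarrow> E c \<in> sets borel" "\<And>c. c \<in> I \<Longrightarrow> E c \<subseteq> fst c"
    "disjoint_family_on E I" "(\<Union>c\<in>I. E c) = UNIV"
    by (rule finite_chart_partition) auto
  fix B assume "B \<in> sets \<mu>"
  then have B: "B \<in> sets borel"
    using assms by simp
  have dec: "emeasure N B = (\<Sum>c\<in>I. chart_vol c (B \<inter> E c))"
    if "sets N = sets borel" "\<And>c B. c \<in> \<A> \<Longrightarrow> B \<in> sets borel \<Longrightarrow> B \<subseteq> fst c \<Longrightarrow> emeasure N B = chart_vol c B" for N
  proof -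
    have "emeasure N B = (\<Sum>c\<in>I. emeasure N (B \<inter> E c))"
      using E B that(1) by (intro sum_emeasure_cover) auto
    also have "\<dots> = (\<Sum>c\<in>I. chart_vol c (B \<inter> E c))"
    proof (rule sum.cong[OF refl])
      fix c assume "c \<in> I"
      then have "c \<in> \<A>" "B \<inter> E c \<in> sets borel" "B \<inter> E c \<subseteq> fst c"
        using E(2) E(3)[of c] E(4)[of c] B by blast+
      then show "emeasure N (B \<inter> E c) = chart_vol c (B \<inter> E c)"
        by (rule that(2))
    qed
    finally show ?thesis .
  qed
  show "emeasure \<mu> B = emeasure \<nu> B"
    using dec[of \<mu>] dec[of \<nu>] assms by simp
qed

text \<open>
  Each piece of a partition is measured in its own chart; by \<open>chart_vol_indep\<close> any
  other chart gives the same value.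
\<close>

lemma volume_exists:
  "\<exists>\<mu>. sets \<mu> = sets (borel :: 'a measure) \<and> (\<forall>c\<in>\<A>. \<forall>B\<in>sets borel. B \<subseteq> fst c \<longrightarrow> emeasure \<mu> B = chart_vol c B)"
proof -
  obtain I E where E: "finite I" "I \<subseteq> \<A>" "\<And>c. c \<in> I \<Longrightarrow> E c \<in> sets borel" "\<And>c. c \<in> I \<Longrightarrow> E c \<subseteq> fst c"
    "disjoint_family_on E I" "(\<Union>c\<in>I. E c) = UNIV"
    by (rule finite_chart_partition) auto
  define m where "m B = (\<Sum>c\<in>I. chart_vol c (B \<inter> E c))" for B
  define \<mu> where "\<mu> = measure_of UNIV (sets (borel :: 'a measure)) m"
  have sets: "sets \<mu> = sets borel"
    unfolding \<mu>_def using sets.sigma_sets_eq[of "borel :: 'a measure"] by (simp add: sets_measure_of)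
  have em: "emeasure \<mu> B = m B" if "B \<in> sets borel" for B
  proof (rule emeasure_measure_of[OF \<mu>_def])
    show "positive (sets \<mu>) m"
      by (simp add: positive_def m_def chart_vol_empty)
    show "countably_additive (sets \<mu>) m"
      unfolding countably_additive_def sets
    proof (intro allI impI)
      fix F :: "nat \<Rightarrow> 'a set" assume F: "range F \<subseteq> sets borel" "disjoint_family F"
      have "(\<Sum>k. m (F k)) = (\<Sum>c\<in>I. \<Sum>k. chart_vol c (F k \<inter> E c))"
        unfolding m_def by (rule suminf_sum) simp
      also have "\<dots> = (\<Sum>c\<in>I. chart_vol c (\<Union>k. F k \<inter> E c))"
      proof (rule sum.cong[OF refl])
        fix c assume c: "c \<in> I"
        have "c \<in> \<A>" "\<And>k. F k \<inter> E c \<in> sets borel" "\<And>k. F k \<inter> E c \<subseteq> fst c"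
          using E(2) E(3)[OF c] E(4)[OF c] F(1) c by blast+
        moreover have "disjoint_family (\<lambda>k. F k \<inter> E c)"
          using F(2) unfolding disjoint_family_on_def by blast
        ultimately show "(\<Sum>k. chart_vol c (F k \<inter> E c)) = chart_vol c (\<Union>k. F k \<inter> E c)"
          by (rule chart_vol_suminf)
      qed
      finally show "(\<Sum>k. m (F k)) = m (\<Union>k. F k)"
        by (simp add: m_def)
    qed
  qed (use that sets in auto)
  have "emeasure \<mu> B = chart_vol c B" if c: "c \<in> \<A>" and B: "B \<in> sets borel" "B \<subseteq> fst c" for c B
  proof -
    have "emeasure \<mu> B = (\<Sum>d\<in>I. chart_vol d (B \<inter> E d))"
      using em[OF B(1)] by (simp add: m_def)
    also have "\<dots> = (\<Sum>d\<in>I. emeasure (density lborel (vol_density c)) (snd c ` (B \<inter> E d)))"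
    proof (rule sum.cong[OF refl])
      fix d assume d: "d \<in> I"
      then have "chart_vol d (B \<inter> E d) = chart_vol c (B \<inter> E d)"
        using E(2) E(3)[OF d] E(4)[OF d] d B c by (intro chart_vol_indep) blast+
      also have "\<dots> = emeasure (density lborel (vol_density c)) (snd c ` (B \<inter> E d))"
        using E(3)[OF d] B c by (intro chart_vol_eq) blast+
      finally show "chart_vol d (B \<inter> E d) = emeasure (density lborel (vol_density c)) (snd c ` (B \<inter> E d))" .
    qed
    also have "\<dots> = emeasure (density lborel (vol_density c)) (\<Union>d\<in>I. snd c ` (B \<inter> E d))"
    proof (rule sum_emeasure)
      show "(\<lambda>d. snd c ` (B \<inter> E d)) ` I \<subseteq> sets (density lborel (vol_density c))"
      proof (intro image_subsetI)
        fix d assume d: "d \<in> I"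
        have "B \<inter> E d \<in> sets borel" "B \<inter> E d \<subseteq> fst c"
          using B E(3)[OF d] by blast+
        from chart_image_borel[OF c this] show "snd c ` (B \<inter> E d) \<in> sets (density lborel (vol_density c))"
          by simp
      qed
      show "disjoint_family_on (\<lambda>d. snd c ` (B \<inter> E d)) I"
        unfolding disjoint_family_on_def
      proof (intro ballI impI)
        fix d e assume "d \<in> I" "e \<in> I" "d \<noteq> e"
        then have "(B \<inter> E d) \<inter> (B \<inter> E e) = {}"
          using E(5) by (auto simp: disjoint_family_on_def)
        then show "snd c ` (B \<inter> E d) \<inter> snd c ` (B \<inter> E e) = {}"
          using inj_on_image_Int[OF inj_on_chart[OF c], of "B \<inter> E d" "B \<inter> E e"] B(2) by (metis image_empty inf.coboundedI1)
      qed
    qed (rule E)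
    also have "(\<Union>d\<in>I. snd c ` (B \<inter> E d)) = snd c ` B"
      using E(6) by blast
    also have "emeasure (density lborel (vol_density c)) (snd c ` B) = chart_vol c B"
      using chart_vol_eq[OF c B] by simp
    finally show ?thesis .
  qed
  then show ?thesis
    using sets by blast
qed

lemma vol_facts:
  shows sets_vol [simp, measurable_cong]: "sets vol = sets (borel :: 'a measure)"
    and emeasure_vol_chart: "\<And>c B. c \<in> \<A> \<Longrightarrow> B \<in> sets borel \<Longrightarrow> B \<subseteq> fst c \<Longrightarrow> emeasure vol B = chart_vol c B"
proof -
  let ?P = "\<lambda>\<mu>. sets \<mu> = sets (borel :: 'a measure) \<and> (\<forall>c\<in>\<A>. \<forall>B\<in>sets borel. B \<subseteq> fst c \<longrightarrow> emeasure \<mu> B = chart_vol c B)"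
  have vol: "vol = (THE \<mu>. ?P \<mu>)"
    unfolding vol_def chart_vol_def ..
  obtain \<mu> where \<mu>: "?P \<mu>"
    using volume_exists by blast
  have "?P vol"
    unfolding vol
  proof (rule theI[of ?P, OF \<mu>])
    show "\<nu> = \<mu>" if "?P \<nu>" for \<nu>
      using \<mu> that by (intro volume_unique) auto
  qed
  then show "sets vol = sets (borel :: 'a measure)"
    "\<And>c B. c \<in> \<A> \<Longrightarrow> B \<in> sets borel \<Longrightarrow> B \<subseteq> fst c \<Longrightarrow> emeasure vol B = chart_vol c B"
    by blast+
qed

lemma space_vol [simp]: "space vol = UNIV"
  using sets_eq_imp_space_eq[OF sets_vol] by simp

text \<open>
  On small coordinate balls the density is bounded; finitely many of them cover the manifold.
\<close>

lemma finite_measure_vol: "finite_measure vol"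
proof
  have "\<exists>W. open W \<and> p \<in> W \<and> emeasure vol W < \<infinity>" for p
  proof -
    obtain c where c: "c \<in> \<A>" "p \<in> fst c"
      using cover by blast
    obtain \<rho> where \<rho>: "0 < \<rho>" "cball (snd c p) \<rho> \<subseteq> snd c ` fst c"
      using chart_cball[OF c(1) open_UNIV c(2)] by auto
    let ?W = "fst c \<inter> snd c -` ball (snd c p) \<rho>" and ?d = "\<lambda>x. sqrt (det (g c (chart_inv c x)))"
    have W: "open ?W"
      by (rule open_chart_preimage[OF c(1)]) simp
    have "continuous_on (cball (snd c p) \<rho>) ?d"
      by (rule continuous_on_subset[OF continuous_on_chart_density[OF c(1)] \<rho>(2)])
    then have "bounded (?d ` cball (snd c p) \<rho>)"
      by (intro compact_imp_bounded compact_continuous_image) auto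
    then obtain C where "\<forall>x\<in>cball (snd c p) \<rho>. \<bar>?d x\<bar> \<le> C"
      unfolding bounded_iff by auto
    then have C: "\<bar>?d x\<bar> \<le> C" if "x \<in> cball (snd c p) \<rho>" for x
      using that by blast
    have "emeasure vol ?W = chart_vol c ?W"
      using W by (intro emeasure_vol_chart c) auto
    also have "\<dots> \<le> (\<integral>\<^sup>+x. ennreal C * indicator (cball (snd c p) \<rho>) x \<partial>lborel)"
      unfolding chart_vol_def
    proof (rule nn_integral_mono)
      fix x
      show "ennreal (?d x) * indicator (snd c ` ?W) x \<le> ennreal C * indicator (cball (snd c p) \<rho>) x"
        using C[of x] by (auto simp: indicator_def intro!: ennreal_leI)
    qed
    also have "\<dots> = ennreal C * emeasure lborel (cball (snd c p) \<rho>)"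
      by (rule nn_integral_cmult_indicator) simp
    also have "\<dots> < \<infinity>"
      using emeasure_bounded_finite[OF bounded_cball[of "snd c p" \<rho>]]
      by (simp add: ennreal_mult_less_top)
    finally show ?thesis
      using W c \<rho>(1) by (intro exI[of _ ?W]) auto
  qed
  then obtain W where W: "\<And>p. open (W p)" "\<And>p. p \<in> W p" "\<And>p. emeasure vol (W p) < \<infinity>"
    by metis
  have UN: "UNIV \<subseteq> (\<Union>p\<in>UNIV. W p)"
    using W(2) by blast
  obtain C where C: "finite C" "UNIV \<subseteq> (\<Union>p\<in>C. W p)"
    by (rule compactE_image[OF compact_UNIV W(1) UN])
  have "emeasure vol (space vol) \<le> emeasure vol (\<Union>p\<in>C. W p)"
    using C W by (intro emeasure_mono) auto
  also have "\<dots> \<le> (\<Sum>p\<in>C. emeasure vol (W p))"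
    using C W by (intro emeasure_subadditive_finite) auto
  also have "\<dots> < \<infinity>"
    using C(1) W(3) by (simp add: ennreal_sum_less_top)
  finally show "emeasure vol (space vol) \<noteq> \<infinity>"
    by simp
qed

lemma emeasure_vol_open_pos:
  assumes U: "open U" "U \<noteq> {}"
  shows "0 < emeasure vol U"
proof -
  obtain p where p: "p \<in> U"
    using U by blast
  obtain c where c: "c \<in> \<A>" "p \<in> fst c"
    using cover by blast
  obtain \<rho> where \<rho>: "0 < \<rho>" "cball (snd c p) \<rho> \<subseteq> snd c ` (fst c \<inter> U)"
    using chart_cball[OF c(1) U(1) c(2) p] by auto
  let ?W = "fst c \<inter> U"
  have W: "?W \<in> sets borel"
    using U(1) open_chart[OF c(1)] by auto
  have "chart_vol c ?W \<noteq> 0"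
  proof
    assume "chart_vol c ?W = 0"
    then have "emeasure (density lborel (vol_density c)) (snd c ` ?W) = 0"
      using chart_vol_eq[OF c(1) W] by simp
    moreover have "snd c ` ?W \<in> sets borel"
      by (rule chart_image_borel[OF c(1) W]) simp
    ultimately have "AE x in lborel. x \<in> snd c ` ?W \<longrightarrow> ennreal (vol_density c x) \<le> 0"
      using null_sets_density_iff[of "\<lambda>x. ennreal (vol_density c x)" lborel "snd c ` ?W"]
        measurable_vol_density[OF c(1)] by (simp add: null_sets_def)
    moreover have "0 < vol_density c x" if "x \<in> snd c ` ?W" for x
      using that metric_det_pos[OF c(1)] chart_inv_in[OF c(1)] by (auto simp: vol_density_def)
    moreover have "ball (snd c p) \<rho> \<subseteq> snd c ` ?W"
      using \<rho>(2) ball_subset_cball by blast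
    ultimately have "AE x in lborel. x \<notin> ball (snd c p) \<rho>"
      by (elim eventually_mono) (force simp: ennreal_eq_0_iff)
    then have "ball (snd c p) \<rho> \<in> null_sets lborel"
      by (subst (asm) AE_iff_null_sets[symmetric]) auto
    then have "negligible (ball (snd c p) \<rho>)"
      unfolding negligible_iff_null_sets by (rule null_sets_completionI)
    then show False
      using open_not_negligible[of "ball (snd c p) \<rho>"] \<rho>(1) by simp
  qed
  moreover have "chart_vol c ?W = emeasure vol ?W"
    using emeasure_vol_chart[OF c(1) W] by simp
  moreover have "emeasure vol ?W \<le> emeasure vol U"
    using U(1) by (intro emeasure_mono) auto
  ultimately show ?thesis
    by (metis dual_order.strict_trans1 not_gr_zero)
qed

text \<open>
  The image measure satisfies the chart formulas that determine the volume.
\<close>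

lemma distr_vol_isometry:
  assumes iso: "isometry \<iota>"
  shows "distr vol vol \<iota> = vol"
proof (rule volume_unique)
  show "sets (distr vol vol \<iota>) = sets borel" "sets vol = sets borel"
    by auto
  show "emeasure vol B = chart_vol c B" if "c \<in> \<A>" "B \<in> sets borel" "B \<subseteq> fst c" for c B
    by (rule emeasure_vol_chart[OF that])
  have meas: "\<iota> \<in> borel_measurable borel"
    by (rule borel_measurable_continuous_onI[OF isometry_continuous[OF iso]])
  have inj: "inj \<iota>" and surj: "surj \<iota>"
    using isometry_bij[OF iso] by (auto simp: bij_def)
  fix c' and B :: "'a set" assume c': "c' \<in> \<A>" and B: "B \<in> sets borel" "B \<subseteq> fst c'"
  obtain I E where E: "finite I" "I \<subseteq> \<A>" "\<And>c. c \<in> I \<Longrightarrow> E c \<in> sets borel" "\<And>c. c \<in> I \<Longrightarrow> E c \<subseteq> fst c"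
    "disjoint_family_on E I" "(\<Union>c\<in>I. E c) = UNIV"
    by (rule finite_chart_partition) auto
  let ?A = "\<iota> -` B"
  have A: "?A \<in> sets borel"
    using measurable_sets[OF meas B(1)] by simp
  have "emeasure (distr vol vol \<iota>) B = emeasure vol ?A"
    using meas B(1) by (subst emeasure_distr) (auto simp: measurable_cong_sets[OF sets_vol sets_vol])
  also have "\<dots> = (\<Sum>c\<in>I. emeasure vol (?A \<inter> E c))"
    using E A by (intro sum_emeasure_cover) auto
  also have "\<dots> = (\<Sum>c\<in>I. emeasure vol (\<iota> ` (?A \<inter> E c)))"
  proof (rule sum.cong[OF refl])
    fix c assume c: "c \<in> I"
    have AE: "?A \<inter> E c \<in> sets borel" "?A \<inter> E c \<subseteq> fst c" "\<iota> ` (?A \<inter> E c) \<subseteq> fst c'" "c \<in> \<A>"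
      using A E(2) E(3)[OF c] E(4)[OF c] c B by blast+
    have "emeasure vol (?A \<inter> E c) = chart_vol c (?A \<inter> E c)"
      by (rule emeasure_vol_chart) (use AE in auto)
    also have "\<dots> = chart_vol c' (\<iota> ` (?A \<inter> E c))"
      by (rule chart_vol_isometry[OF iso AE(4) c' AE(1-3), symmetric])
    also have "\<dots> = emeasure vol (\<iota> ` (?A \<inter> E c))"
      by (rule emeasure_vol_chart[OF c' isometry_image_borel[OF iso AE(1)] AE(3), symmetric])
    finally show "emeasure vol (?A \<inter> E c) = emeasure vol (\<iota> ` (?A \<inter> E c))" .
  qed
  also have "\<dots> = emeasure vol (\<Union>c\<in>I. \<iota> ` (?A \<inter> E c))"
  proof (rule sum_emeasure)
    show "(\<lambda>c. \<iota> ` (?A \<inter> E c)) ` I \<subseteq> sets vol"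
      using isometry_image_borel[OF iso] A E by auto
    show "disjoint_family_on (\<lambda>c. \<iota> ` (?A \<inter> E c)) I"
      unfolding disjoint_family_on_def
    proof (intro ballI impI)
      fix d e assume "d \<in> I" "e \<in> I" "d \<noteq> e"
      then have "(?A \<inter> E d) \<inter> (?A \<inter> E e) = {}"
        using E(5) by (auto simp: disjoint_family_on_def)
      then show "\<iota> ` (?A \<inter> E d) \<inter> \<iota> ` (?A \<inter> E e) = {}"
        using image_Int[OF inj, of "?A \<inter> E d" "?A \<inter> E e"] by simp
    qed
  qed (rule E)
  also have "(\<Union>c\<in>I. \<iota> ` (?A \<inter> E c)) = \<iota> ` ?A"
    using E(6) by blast
  also have "\<iota> ` ?A = B"
    by (rule surj_image_vimage_eq[OF surj])
  also have "emeasure vol B = chart_vol c' B"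
    by (rule emeasure_vol_chart[OF c' B])
  finally show "emeasure (distr vol vol \<iota>) B = chart_vol c' B" .
qed

end

section \<open>Averaging over isometries\<close>

text \<open>
  Lists keep multiplicities, so that averages of averages are averages over the list of all
  composites.
\<close>

definition list_avg :: "('a \<Rightarrow> 'a) list \<Rightarrow> ('a \<Rightarrow> real) \<Rightarrow> 'a \<Rightarrow> real" where
  "list_avg L f x = (\<Sum>\<tau>\<leftarrow>L. f (\<tau> x)) / length L"

definition list_comp :: "('a \<Rightarrow> 'a) list \<Rightarrow> ('a \<Rightarrow> 'a) list \<Rightarrow> ('a \<Rightarrow> 'a) list" where
  "list_comp L R = concat (map (\<lambda>\<rho>. map (\<lambda>\<tau>. \<tau> \<circ> \<rho>) L) R)"

lemma set_list_comp: "set (list_comp L R) = {\<tau> \<circ> \<rho> | \<tau> \<rho>. \<tau> \<in> set L \<and> \<rho> \<in> set R}"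
  by (auto simp: list_comp_def)

lemma list_comp_ne: "L \<noteq> [] \<Longrightarrow> R \<noteq> [] \<Longrightarrow> list_comp L R \<noteq> []"
  by (cases L; cases R) (auto simp: list_comp_def)

lemma list_avg_comp:
  assumes "L \<noteq> []"
  shows "list_avg (list_comp L R) f x = list_avg R (list_avg L f) x"
proof -
  have len: "length (list_comp L R) = length L * length R"
    by (induction R) (auto simp: list_comp_def)
  have "(\<Sum>\<tau>\<leftarrow>list_comp L R. f (\<tau> x)) = length L * (\<Sum>\<rho>\<leftarrow>R. list_avg L f (\<rho> x))"
    using assms by (induction R) (auto simp: list_comp_def list_avg_def o_def distrib_left)
  then show ?thesis
    unfolding list_avg_def[of "list_comp L R"] list_avg_def[of R] len using assms by simp
qed

lemma sum_list_le_length: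
  fixes h :: "'b \<Rightarrow> real"
  assumes "\<And>x. x \<in> set xs \<Longrightarrow> h x \<le> c"
  shows "(\<Sum>x\<leftarrow>xs. h x) \<le> real (length xs) * c"
  using assms by (induction xs) (fastforce simp: algebra_simps)+

lemma list_avg_le:
  assumes "L \<noteq> []" "\<And>x. f x \<le> c"
  shows "list_avg L f x \<le> c"
  using sum_list_le_length[of L "\<lambda>\<tau>. f (\<tau> x)" c] assms
  by (simp add: list_avg_def divide_le_eq mult.commute)

lemma list_avg_uminus: "list_avg L (\<lambda>y. - f y) x = - list_avg L f x"
proof -
  have "(\<Sum>\<tau>\<leftarrow>L. - f (\<tau> x)) = - (\<Sum>\<tau>\<leftarrow>L. f (\<tau> x))"
    by (induction L) auto
  then show ?thesis
    by (simp add: list_avg_def)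
qed

lemma list_avg_ge:
  assumes "L \<noteq> []" "\<And>x. c \<le> f x"
  shows "c \<le> list_avg L f x"
  using list_avg_le[OF assms(1), of "\<lambda>y. - f y" "- c" x] assms(2) by (simp add: list_avg_uminus)

lemma list_avg_diff_le:
  assumes "\<And>\<tau>. \<tau> \<in> set L \<Longrightarrow> f (\<tau> x) - f (\<tau> y) \<le> e" "L \<noteq> []"
  shows "list_avg L f x - list_avg L f y \<le> e"
proof -
  have "(\<Sum>\<tau>\<leftarrow>L. f (\<tau> x)) - (\<Sum>\<tau>\<leftarrow>L. f (\<tau> y)) = (\<Sum>\<tau>\<leftarrow>L. f (\<tau> x) - f (\<tau> y))"
    by (simp add: sum_list_subtractf)
  also have "\<dots> \<le> real (length L) * e"
    by (rule sum_list_le_length[OF assms(1)])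
  finally show ?thesis
    using assms(2) by (simp add: list_avg_def diff_divide_distrib[symmetric] divide_le_eq mult.commute)
qed

context riemannian_manifold
begin

text \<open>
  The properties of isometries that pass to composites directly from the definitions and that
  the averaging argument uses.
\<close>

definition motion :: "('a \<Rightarrow> 'a) \<Rightarrow> bool" where
  "motion \<tau> \<longleftrightarrow> continuous_on UNIV \<tau> \<and> distr vol vol \<tau> = vol \<and>
     (\<forall>x y. rdist (\<tau> x) (\<tau> y) \<le> rdist x y) \<and>
     (\<forall>\<gamma> a b. a < b \<and> C1_curve \<gamma> a b \<longrightarrow>
       C1_curve (\<tau> \<circ> \<gamma>) a b \<and> (\<forall>t. a < t \<and> t < b \<longrightarrow> speed (\<tau> \<circ> \<gamma>) t = speed \<gamma> t))"

lemma motion_continuous: "motion \<tau> \<Longrightarrow> continuous_on UNIV \<tau>"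
  by (simp add: motion_def)

lemma motion_rdist: "motion \<tau> \<Longrightarrow> rdist (\<tau> x) (\<tau> y) \<le> rdist x y"
  by (simp add: motion_def)

lemma motion_curve:
  assumes "motion \<tau>" "a < b" "C1_curve \<gamma> a b"
  shows "C1_curve (\<tau> \<circ> \<gamma>) a b" "\<And>t. a < t \<Longrightarrow> t < b \<Longrightarrow> speed (\<tau> \<circ> \<gamma>) t = speed \<gamma> t"
  using assms unfolding motion_def by blast+

end

context compact_riemannian_manifold
begin

lemma measurable_vol_iff: "f \<in> measurable vol M \<longleftrightarrow> f \<in> measurable borel M"
  by (rule arg_cong[OF measurable_cong_sets[OF sets_vol refl]])

lemma continuous_measurable_vol:
  fixes f :: "'a \<Rightarrow> 'b::topological_space"
  shows "continuous_on UNIV f \<Longrightarrow> f \<in> borel_measurable vol"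
  unfolding measurable_vol_iff by (rule borel_measurable_continuous_onI)

lemma motion_measurable: "motion \<tau> \<Longrightarrow> \<tau> \<in> measurable vol vol"
  using continuous_measurable_vol[OF motion_continuous]
  by (simp add: measurable_cong_sets[OF refl sets_vol])

lemma motion_isometry: "isometry \<iota> \<Longrightarrow> motion \<iota>"
  unfolding motion_def
  using isometry_continuous distr_vol_isometry rdist_isometry_le C1_curve_isometry speed_isometry
  by (intro conjI allI impI) auto

lemma motion_comp:
  assumes "motion \<sigma>" "motion \<tau>"
  shows "motion (\<sigma> \<circ> \<tau>)"
  unfolding motion_def
proof (intro conjI allI impI)
  show "continuous_on UNIV (\<sigma> \<circ> \<tau>)"
    using assms by (intro continuous_on_compose continuous_on_subset[OF motion_continuous]) auto
  have "distr vol vol (\<sigma> \<circ> \<tau>) = distr (distr vol vol \<tau>) vol \<sigma>"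
    using assms by (intro distr_distr[symmetric] motion_measurable)
  then show "distr vol vol (\<sigma> \<circ> \<tau>) = vol"
    using assms by (simp add: motion_def)
  show "rdist ((\<sigma> \<circ> \<tau>) x) ((\<sigma> \<circ> \<tau>) y) \<le> rdist x y" for x y
    using motion_rdist[OF assms(1)] motion_rdist[OF assms(2)] by (metis comp_apply order_trans)
  fix \<gamma> a b assume "a < b \<and> C1_curve \<gamma> a b"
  then have C: "a < b" "C1_curve \<gamma> a b"
    by auto
  note 1 = motion_curve[OF assms(2) C]
  note 2 = motion_curve[OF assms(1) C(1) 1(1)]
  show "C1_curve (\<sigma> \<circ> \<tau> \<circ> \<gamma>) a b"
    using 2(1) by (simp add: o_assoc)
  show "speed (\<sigma> \<circ> \<tau> \<circ> \<gamma>) t = speed \<gamma> t" if "a < t \<and> t < b" for t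
    using 1(2) 2(2) that by (simp add: o_assoc)
qed

lemma integrable_continuous_vol:
  fixes f :: "'a \<Rightarrow> 'b::{banach, second_countable_topology}"
  assumes f: "continuous_on UNIV f"
  shows "integrable vol f"
proof -
  interpret finite_measure vol
    by (rule finite_measure_vol)
  have "bounded (range f)"
    by (rule compact_imp_bounded[OF compact_continuous_image[OF f compact_UNIV]])
  then obtain B where "\<And>x. norm (f x) \<le> B"
    unfolding bounded_iff by auto
  then show ?thesis
    by (intro integrable_const_bound[of _ B] continuous_measurable_vol f) auto
qed

lemma integral_motion:
  fixes f :: "'a \<Rightarrow> 'b::{banach, second_countable_topology}"
  assumes "motion \<tau>" "continuous_on UNIV f"
  shows "(LINT x|vol. f (\<tau> x)) = (LINT x|vol. f x)"
proof -
  have "(LINT x|vol. f x) = (LINT x|distr vol vol \<tau>. f x)"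
    using assms(1) by (simp add: motion_def)
  also have "\<dots> = (LINT x|vol. f (\<tau> x))"
    using assms by (intro integral_distr motion_measurable continuous_measurable_vol)
  finally show ?thesis ..
qed

definition total_volume :: real where
  "total_volume = measure vol UNIV"

lemma total_volume_pos: "0 < total_volume"
proof -
  interpret finite_measure vol
    by (rule finite_measure_vol)
  have "0 < emeasure vol UNIV"
    by (rule emeasure_vol_open_pos) auto
  then show ?thesis
    unfolding total_volume_def emeasure_eq_measure by simp
qed

lemma continuous_on_list_avg:
  assumes "set L \<subseteq> Collect motion" "continuous_on UNIV f"
  shows "continuous_on UNIV (list_avg L f)"
proof -
  have "continuous_on UNIV (\<lambda>x. \<Sum>\<tau>\<leftarrow>L. f (\<tau> x))"
    using assms(1)
  proof (induction L)
    case (Cons \<tau> L)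
    have "continuous_on UNIV (\<lambda>x. f (\<tau> x))"
      by (rule continuous_on_compose2[OF assms(2) motion_continuous]) (use Cons in auto)
    then show ?case
      using Cons by (auto intro!: continuous_intros)
  qed simp
  then show ?thesis
    unfolding list_avg_def[abs_def] by (cases L) (auto intro!: continuous_intros)
qed

lemma integral_list_avg:
  assumes "set L \<subseteq> Collect motion" "L \<noteq> []" "continuous_on UNIV f"
  shows "(LINT x|vol. list_avg L f x) = (LINT x|vol. f x)"
proof -
  have "(LINT x|vol. (\<Sum>\<tau>\<leftarrow>L. f (\<tau> x))) = length L * (LINT x|vol. f x) \<and>
      integrable vol (\<lambda>x. \<Sum>\<tau>\<leftarrow>L. f (\<tau> x))"
    using assms(1)
  proof (induction L)
    case (Cons \<tau> L)
    have "integrable vol (\<lambda>x. f (\<tau> x))"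
      by (rule integrable_continuous_vol, rule continuous_on_compose2[OF assms(3) motion_continuous])
        (use Cons in auto)
    then show ?case
      using Cons integral_motion[OF _ assms(3), of \<tau>] by (auto simp: algebra_simps)
  qed simp
  then show ?thesis
    using assms(2) by (simp add: list_avg_def)
qed

end

locale compact_homogeneous_manifold = compact_riemannian_manifold \<A> g
  for \<A> :: "('a::{t2_space, second_countable_topology}, 'n::finite) chart set" and g +
  assumes homogeneous: homogeneous
begin

text \<open>
  Each point is mapped to \<open>p\<close> by some isometry, which also maps a neighbourhood of
  the point into the ball.
\<close>

lemma finitely_many_isometries_into_ball:
  assumes r: "0 < r"
  obtains R where "R \<noteq> []" "set R \<subseteq> Collect isometry" "\<And>z. \<exists>\<tau>\<in>set R. \<tau> z \<in> rball p r"
proof -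
  have "\<forall>z. \<exists>\<tau>. isometry \<tau> \<and> \<tau> z = p"
    using homogeneous by (simp add: homogeneous_def)
  then obtain \<tau> where \<tau>: "\<And>z. isometry (\<tau> z)" "\<And>z. \<tau> z z = p"
    by metis
  have op: "open (\<tau> z -` rball p r)" for z
    by (rule open_vimage[OF open_rball isometry_continuous[OF \<tau>(1)]])
  have UN: "UNIV \<subseteq> (\<Union>z\<in>UNIV. \<tau> z -` rball p r)"
    using \<tau>(2) center_in_rball[OF r] by force
  obtain C where C: "finite C" "UNIV \<subseteq> (\<Union>z\<in>C. \<tau> z -` rball p r)"
    by (rule compactE_image[OF compact_UNIV op UN])
  obtain cs where cs: "set cs = C"
    using finite_list[OF C(1)] by blast
  show ?thesis
  proof (rule that[of "map \<tau> cs"])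
    show "map \<tau> cs \<noteq> []"
      using C(2) cs by auto
    show "set (map \<tau> cs) \<subseteq> Collect isometry"
      using \<tau>(1) by auto
    show "\<exists>\<tau>'\<in>set (map \<tau> cs). \<tau>' z \<in> rball p r" for z
      using C(2) cs by auto
  qed
qed

text \<open>
  Let \<open>F\<close> be an average of \<open>f\<close> of oscillation at most
  \<open>w\<close>, and \<open>y\<close> a minimum point of \<open>F\<close>. As motions do not
  increase distances, \<open>F\<close> has the same modulus of continuity as \<open>f\<close>
  and exceeds its minimum by at most \<open>h\<close> on a ball around \<open>y\<close> whose
  radius does not depend on \<open>F\<close>. There are \<open>k\<close> isometries, with
  \<open>k\<close> independent of \<open>F\<close>, such that each point is mapped into this
  ball by one of them. Averaging \<open>F\<close> over them therefore lowers the maximum and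
  yields oscillation at most \<open>(1 - 1/k) w + h/k\<close>. The fixed point of this recursion
  is \<open>h\<close>.
\<close>

theorem list_avg_small_oscillation:
  fixes f :: "'a \<Rightarrow> real"
  assumes f: "continuous_on UNIV f" and e: "0 < e"
  obtains L where "L \<noteq> []" "set L \<subseteq> Collect motion" "\<And>x y. list_avg L f x - list_avg L f y \<le> e"
proof -
  define h where "h = e / 2"
  have h: "0 < h"
    using e by (simp add: h_def)
  define P where "P L w \<longleftrightarrow> L \<noteq> [] \<and> set L \<subseteq> Collect motion \<and> (\<forall>x y. list_avg L f x - list_avg L f y \<le> w)" for L w
  obtain r where r: "0 < r" "\<And>x y. rdist x y < ennreal r \<Longrightarrow> \<bar>f x - f y\<bar> < h"
    using uniformly_continuous_rdist[OF compact_UNIV f h] by metis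
  obtain p :: 'a where True
    by simp
  obtain R where R: "R \<noteq> []" "set R \<subseteq> Collect isometry" "\<And>z. \<exists>\<tau>\<in>set R. \<tau> z \<in> rball p r"
    using finitely_many_isometries_into_ball[OF r(1), of p] by metis
  define k where "k = real (length R)"
  have k: "1 \<le> k"
    using R(1) by (cases R) (auto simp: k_def)
  have step: "\<exists>L'. P L' ((1 - 1 / k) * w + h / k)" if PL: "P L w" for L w
  proof -
    let ?F = "list_avg L f"
    have L: "L \<noteq> []" "set L \<subseteq> Collect motion" "\<And>x y. ?F x - ?F y \<le> w"
      using PL by (auto simp: P_def)
    have Fc: "continuous_on UNIV ?F"
      by (rule continuous_on_list_avg[OF L(2) f])
    obtain y where y: "\<And>x. ?F y \<le> ?F x"
      using continuous_attains_inf[OF compact_UNIV _ Fc] by auto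
    obtain \<sigma> where \<sigma>: "isometry \<sigma>" "\<sigma> p = y"
      using homogeneous by (auto simp: homogeneous_def)
    \<comment> \<open>The isometries in \<open>R\<close> map into the ball around \<open>p\<close>; following
      them by \<open>\<sigma>\<close> moves this ball to \<open>y\<close>, so their number
      does not depend on \<open>y\<close>.\<close>
    define R' where "R' = map ((\<circ>) \<sigma>) R"
    have R': "R' \<noteq> []" "set R' \<subseteq> Collect motion" "length R' = length R"
      using R motion_comp[OF motion_isometry[OF \<sigma>(1)] motion_isometry] by (auto simp: R'_def)
    have upper: "list_avg R' ?F z \<le> ?F y + ((1 - 1 / k) * w + h / k)" for z
    proof -
      obtain \<tau> where \<tau>: "\<tau> \<in> set R" "\<tau> z \<in> rball p r"
        using R(3) by blast
      have "rdist y (\<sigma> (\<tau> z)) < ennreal r"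
        using rdist_isometry_le[OF \<sigma>(1), of p "\<tau> z"] \<tau>(2) \<sigma>(2) by (auto simp: rball_def)
      then have "f (\<rho> (\<sigma> (\<tau> z))) - f (\<rho> y) \<le> h" if "\<rho> \<in> set L" for \<rho>
        using r(2)[of "\<rho> y" "\<rho> (\<sigma> (\<tau> z))"] motion_rdist[of \<rho> y "\<sigma> (\<tau> z)"] L(2) that
        by (fastforce simp: abs_less_iff)
      then have near: "?F (\<sigma> (\<tau> z)) \<le> ?F y + h"
        using list_avg_diff_le[of L f "\<sigma> (\<tau> z)" y h] L(1) by auto
      have far: "?F x \<le> ?F y + w" for x
        using L(3)[of x y] by simp
      obtain A B where AB: "R = A @ \<tau> # B"
        using \<tau>(1) split_list by metis
      have "(\<Sum>\<rho>\<leftarrow>R'. ?F (\<rho> z)) = (\<Sum>\<rho>\<leftarrow>A. ?F (\<sigma> (\<rho> z))) + ?F (\<sigma> (\<tau> z)) + (\<Sum>\<rho>\<leftarrow>B. ?F (\<sigma> (\<rho> z)))"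
        by (simp add: R'_def AB o_def)
      also have "\<dots> \<le> length A * (?F y + w) + (?F y + h) + length B * (?F y + w)"
        by (intro add_mono near sum_list_le_length far)
      also have "\<dots> = k * ?F y + ((k - 1) * w + h)"
        by (simp add: k_def AB algebra_simps)
      finally have "list_avg R' ?F z \<le> (k * ?F y + ((k - 1) * w + h)) / k"
        using k unfolding list_avg_def[of R'] R'(3) k_def[symmetric] by (intro divide_right_mono) auto
      also have "\<dots> = ?F y + ((1 - 1 / k) * w + h / k)"
        using k by (simp add: field_simps)
      finally show ?thesis .
    qed
    have lower: "?F y \<le> list_avg R' ?F z" for z
      by (rule list_avg_ge[OF R'(1) y])
    have "P (list_comp L R') ((1 - 1 / k) * w + h / k)"
      unfolding P_def
    proof (intro conjI allI)
      show "list_comp L R' \<noteq> []"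
        using L(1) R'(1) by (rule list_comp_ne)
      show "set (list_comp L R') \<subseteq> Collect motion"
        using L(2) R'(2) motion_comp by (auto simp: set_list_comp)
      show "list_avg (list_comp L R') f x - list_avg (list_comp L R') f z \<le> (1 - 1 / k) * w + h / k" for x z
        unfolding list_avg_comp[OF L(1)] using upper[of x] lower[of z] by linarith
    qed
    then show ?thesis
      by blast
  qed
  have "bounded (range f)"
    by (rule compact_imp_bounded[OF compact_continuous_image[OF f compact_UNIV]])
  then obtain B where B: "\<And>x. \<bar>f x\<bar> \<le> B"
    unfolding bounded_iff by auto
  have B0: "0 \<le> B"
    using B[of p] by linarith
  have iter: "\<exists>L. P L ((1 - 1 / k) ^ n * (2 * B) + h)" for n
  proof (induction n)
    case 0
    have "f x - f y \<le> 2 * B + h" for x y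
      using B[of x] B[of y] h by linarith
    then have "P [id] (2 * B + h)"
      using motion_isometry[OF isometry_id] by (simp add: P_def list_avg_def)
    then show ?case
      by auto
  next
    case (Suc n)
    then obtain L where "P L ((1 - 1 / k) ^ n * (2 * B) + h)"
      by blast
    from step[OF this] obtain L' where L': "P L' ((1 - 1 / k) * ((1 - 1 / k) ^ n * (2 * B) + h) + h / k)"
      by blast
    have "(1 - 1 / k) * ((1 - 1 / k) ^ n * (2 * B) + h) + h / k = (1 - 1 / k) ^ Suc n * (2 * B) + h"
      using k by (simp add: field_simps)
    then show ?case
      using L' by metis
  qed
  have q: "0 \<le> 1 - 1 / k" "1 - 1 / k < 1"
    using k by auto
  have "(\<lambda>n. (1 - 1 / k) ^ n * (2 * B)) \<longlonglongrightarrow> 0 * (2 * B)"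
    by (intro tendsto_intros LIMSEQ_realpow_zero q)
  then have "eventually (\<lambda>n. (1 - 1 / k) ^ n * (2 * B) < h) sequentially"
    using h by (intro order_tendstoD(2)[of _ 0]) auto
  then obtain n where n: "(1 - 1 / k) ^ n * (2 * B) < h"
    by (auto simp: eventually_sequentially)
  obtain L where L: "P L ((1 - 1 / k) ^ n * (2 * B) + h)"
    using iter by blast
  have "list_avg L f x - list_avg L f y \<le> e" for x y
  proof -
    have "list_avg L f x - list_avg L f y \<le> (1 - 1 / k) ^ n * (2 * B) + h"
      using L by (simp add: P_def)
    then show ?thesis
      using n by (simp add: h_def)
  qed
  then show ?thesis
    using L that by (auto simp: P_def)
qed

definition vol_mean :: "('a \<Rightarrow> real) \<Rightarrow> real" where
  "vol_mean f = (LINT x|vol. f x) / total_volume"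

text \<open>
  Averaging over motions keeps the mean value, which lies between the minimum and the maximum.
\<close>

lemma list_avg_near_mean:
  fixes f :: "'a \<Rightarrow> real"
  assumes f: "continuous_on UNIV f" and e: "0 < e"
  obtains L where "L \<noteq> []" "set L \<subseteq> Collect motion" "\<And>x. \<bar>list_avg L f x - vol_mean f\<bar> \<le> e"
proof -
  interpret finite_measure vol
    by (rule finite_measure_vol)
  obtain L where L: "L \<noteq> []" "set L \<subseteq> Collect motion" "\<And>x y. list_avg L f x - list_avg L f y \<le> e"
    using list_avg_small_oscillation[OF f e] by metis
  have int: "integrable vol (list_avg L f)"
    by (rule integrable_continuous_vol[OF continuous_on_list_avg[OF L(2) f]])
  have tot: "(LINT y|vol. list_avg L f y) = total_volume * vol_mean f"
    using total_volume_pos by (simp add: integral_list_avg[OF L(2,1) f] vol_mean_def)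
  have const: "(LINT y|vol. c) = total_volume * c" for c :: real
    by (simp add: total_volume_def)
  have "\<bar>list_avg L f x - vol_mean f\<bar> \<le> e" for x
  proof -
    have "(LINT y|vol. list_avg L f x - e) \<le> (LINT y|vol. list_avg L f y)"
      using L(3)[of x] int by (intro integral_mono) (auto simp: algebra_simps)
    then have "total_volume * (list_avg L f x - e) \<le> total_volume * vol_mean f"
      by (simp only: tot const)
    moreover have "(LINT y|vol. list_avg L f y) \<le> (LINT y|vol. list_avg L f x + e)"
      using L(3)[of _ x] int by (intro integral_mono) (auto simp: algebra_simps)
    then have "total_volume * vol_mean f \<le> total_volume * (list_avg L f x + e)"
      by (simp only: tot const)
    ultimately show ?thesis
      using total_volume_pos by simp
  qed
  then show ?thesis
    using L that by blast
qed

text \<open>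
  A second averaging keeps upper and lower bounds, so the two functions can be treated one after
  the other.
\<close>

lemma list_avg_near_means:
  fixes D K :: "'a \<Rightarrow> real"
  assumes D: "continuous_on UNIV D" and K: "continuous_on UNIV K" and e: "0 < e"
  obtains L where "L \<noteq> []" "set L \<subseteq> Collect motion"
    "\<And>x. list_avg L D x \<le> vol_mean D + e" "\<And>x. vol_mean K - e \<le> list_avg L K x"
proof -
  obtain L where L: "L \<noteq> []" "set L \<subseteq> Collect motion" "\<And>x. \<bar>list_avg L D x - vol_mean D\<bar> \<le> e"
    using list_avg_near_mean[OF D e] by metis
  have "continuous_on UNIV (list_avg L K)"
    by (rule continuous_on_list_avg[OF L(2) K])
  then obtain R where R: "R \<noteq> []" "set R \<subseteq> Collect motion"
    "\<And>x. \<bar>list_avg R (list_avg L K) x - vol_mean (list_avg L K)\<bar> \<le> e"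
    using list_avg_near_mean[OF _ e] by metis
  show ?thesis
  proof (rule that[of "list_comp L R"])
    show "list_comp L R \<noteq> []"
      using L(1) R(1) by (rule list_comp_ne)
    show "set (list_comp L R) \<subseteq> Collect motion"
      using L(2) R(2) motion_comp by (auto simp: set_list_comp)
    have "list_avg L D y \<le> vol_mean D + e" for y
      using L(3)[of y] by linarith
    then show "list_avg (list_comp L R) D x \<le> vol_mean D + e" for x
      unfolding list_avg_comp[OF L(1)] by (rule list_avg_le[OF R(1)])
    have "vol_mean (list_avg L K) = vol_mean K"
      by (simp add: vol_mean_def integral_list_avg[OF L(2,1) K])
    then show "vol_mean K - e \<le> list_avg (list_comp L R) K x" for x
      unfolding list_avg_comp[OF L(1)] using R(3)[of x] by linarith
  qed
qed

end

section \<open>Orthonormal families and gradients\<close>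

text \<open>
  Gram-Schmidt: fewer than \<open>card B\<close> vectors cannot span \<open>B\<close>, so some
  element of \<open>B\<close> has a nonzero component orthogonal to those already found.
\<close>

lemma orthonormal_family_exists:
  fixes ip :: "('a \<Rightarrow> complex) \<Rightarrow> ('a \<Rightarrow> complex) \<Rightarrow> complex"
  assumes V: "cfun.subspace V"
    and add: "\<And>u v w. u \<in> V \<Longrightarrow> v \<in> V \<Longrightarrow> w \<in> V \<Longrightarrow> ip (u + v) w = ip u w + ip v w"
    and scale: "\<And>a u w. u \<in> V \<Longrightarrow> w \<in> V \<Longrightarrow> ip (\<lambda>x. a * u x) w = a * ip u w"
    and herm: "\<And>u v. u \<in> V \<Longrightarrow> v \<in> V \<Longrightarrow> ip v u = cnj (ip u v)"
    and pos: "\<And>u. u \<in> V \<Longrightarrow> u \<noteq> 0 \<Longrightarrow> 0 < Re (ip u u)"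
    and B: "finite B" "B \<subseteq> V" "cfun.independent B"
  shows "\<exists>e::nat \<Rightarrow> 'a \<Rightarrow> complex. (\<forall>i<card B. e i \<in> V) \<and>
    (\<forall>i<card B. \<forall>j<card B. ip (e i) (e j) = (if i = j then 1 else 0))"
proof -
  have V0: "0 \<in> V" and Vadd: "\<And>u v. u \<in> V \<Longrightarrow> v \<in> V \<Longrightarrow> u + v \<in> V"
    and Vsc: "\<And>a u. u \<in> V \<Longrightarrow> (\<lambda>x. a * u x) \<in> V"
    using V by (auto simp: cfun.subspace_def)
  have ip0: "ip 0 w = 0" if "w \<in> V" for w
    using scale[OF V0 that, of 0] by (simp add: zero_fun_def)
  have Vsum: "(\<Sum>i\<in>I. f i) \<in> V" if "\<And>i. i \<in> I \<Longrightarrow> f i \<in> V" for f and I :: "nat set"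
    by (rule cfun.subspace_sum[OF V that])
  have ipsum: "ip (\<Sum>i\<in>I. f i) w = (\<Sum>i\<in>I. ip (f i) w)"
    if "finite I" "\<And>i. i \<in> I \<Longrightarrow> f i \<in> V" "w \<in> V" for f w and I :: "nat set"
    using that
  proof (induction I rule: finite_induct)
    case (insert i I)
    have fV: "f i \<in> V" "(\<Sum>i\<in>I. f i) \<in> V" and IH: "ip (\<Sum>i\<in>I. f i) w = (\<Sum>i\<in>I. ip (f i) w)"
      using insert Vsum[of I f] by auto
    show ?case
      unfolding sum.insert[OF insert.hyps] add[OF fV \<open>w \<in> V\<close>] IH ..
  qed (simp add: ip0)
  have "n \<le> card B \<Longrightarrow> \<exists>e::nat \<Rightarrow> 'a \<Rightarrow> complex. (\<forall>i<n. e i \<in> V) \<and>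
    (\<forall>i<n. \<forall>j<n. ip (e i) (e j) = (if i = j then 1 else 0))" for n
  proof (induction n)
    case (Suc n)
    then obtain e :: "nat \<Rightarrow> 'a \<Rightarrow> complex" where e: "\<And>i. i < n \<Longrightarrow> e i \<in> V"
      "\<And>i j. i < n \<Longrightarrow> j < n \<Longrightarrow> ip (e i) (e j) = (if i = j then 1 else 0)"
      by auto
    have "\<not> B \<subseteq> cfun.span (e ` {..<n})"
    proof
      assume "B \<subseteq> cfun.span (e ` {..<n})"
      from cfun.independent_span_bound[OF _ B(3) this] have "card B \<le> card (e ` {..<n})"
        by simp
      also have "\<dots> \<le> n"
        using card_image_le[of "{..<n}" e] by simp
      finally show False
        using Suc.prems by simp
    qed
    then obtain b where b: "b \<in> B" "b \<notin> cfun.span (e ` {..<n})"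
      by blast
    have bV: "b \<in> V"
      using b B by blast
    define s where "s = (\<Sum>i<n. (\<lambda>x. ip b (e i) * e i x))"
    define w where "w = b + (\<lambda>x. (- 1) * s x)"
    have eV: "(\<lambda>x. a * e i x) \<in> V" if "i < n" for i a
      using e(1)[OF that] by (rule Vsc)
    have sV: "s \<in> V"
      unfolding s_def using eV by (intro Vsum) auto
    have wV: "w \<in> V"
      unfolding w_def by (intro Vadd bV Vsc sV)
    have "s \<in> cfun.span (e ` {..<n})"
      unfolding s_def by (intro cfun.span_sum cfun.span_scale cfun.span_base) auto
    then have "b \<noteq> s"
      using b(2) by blast
    then have w0: "w \<noteq> 0"
      by (auto simp: w_def fun_eq_iff)
    have orth: "ip w (e j) = 0" if j: "j < n" for j
    proof -
      have "ip s (e j) = (\<Sum>i<n. ip b (e i) * ip (e i) (e j))"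
        unfolding s_def using eV e(1) j by (subst ipsum) (auto simp: scale)
      also have "\<dots> = (\<Sum>i<n. if i = j then ip b (e j) else 0)"
        using e(2) j by (intro sum.cong) auto
      also have "\<dots> = ip b (e j)"
        using j by simp
      finally show ?thesis
        unfolding w_def add[OF bV Vsc[OF sV] e(1)[OF j]] scale[OF sV e(1)[OF j]] by simp
    qed
    define r where "r = Re (ip w w)"
    have r: "0 < r"
      unfolding r_def by (rule pos[OF wV w0])
    have ww: "ip w w = of_real r"
      using herm[OF wV wV] by (simp add: complex_eq_iff r_def)
    define e' where "e' = (\<lambda>x. of_real (1 / sqrt r) * w x)"
    have e'V: "e' \<in> V"
      unfolding e'_def by (rule Vsc[OF wV])
    have e'l: "ip e' x = of_real (1 / sqrt r) * ip w x" if "x \<in> V" for x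
      unfolding e'_def by (rule scale[OF wV that])
    have ee: "ip e' (e j) = 0" if "j < n" for j
      using e'l[OF e(1)[OF that]] orth[OF that] by simp
    have "ip e' w = of_real (1 / sqrt r) * of_real r"
      using e'l[OF wV] ww by simp
    then have we: "ip w e' = of_real (1 / sqrt r * r)"
      using herm[OF e'V wV] by simp
    have "ip e' e' = of_real (1 / sqrt r * (1 / sqrt r * r))"
      unfolding e'l[OF e'V] we of_real_mult ..
    also have "1 / sqrt r * (1 / sqrt r * r) = 1"
      using r by simp
    finally have ee1: "ip e' e' = 1"
      by simp
    have ee2: "ip (e j) e' = 0" if "j < n" for j
      using herm[OF e'V e(1)[OF that]] ee[OF that] by simp
    show ?case
      using e e'V ee ee1 ee2 by (intro exI[of _ "e(n := e')"]) (auto simp: less_Suc_eq)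
  qed simp
  then show ?thesis
    by blast
qed

lemma pos_def_Cauchy_Schwarz:
  fixes A :: "real ^ 'n::finite ^ 'n"
  assumes sym: "transpose A = A" and pos: "\<And>v. v \<noteq> 0 \<Longrightarrow> 0 < v \<bullet> (A *v v)"
  shows "(v \<bullet> (A *v w))\<^sup>2 \<le> (v \<bullet> (A *v v)) * (w \<bullet> (A *v w))"
proof (cases "w = 0")
  case False
  define q where "q x y = x \<bullet> (A *v y)" for x y
  have sq: "q x y = q y x" for x y
  proof -
    have "q x y = (transpose A *v x) \<bullet> y"
      by (simp add: q_def dot_lmul_matrix)
    then show ?thesis
      by (simp add: sym q_def inner_commute)
  qed
  have nonneg: "0 \<le> q x x" for x
    using pos[of x] by (cases "x = 0") (auto simp: q_def less_imp_le)
  have qw: "0 < q w w"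
    using pos[OF False] by (simp add: q_def)
  have exp: "q (v - t *\<^sub>R w) (v - t *\<^sub>R w) = q v v - 2 * t * q v w + t\<^sup>2 * q w w" for t
    using sq[of w v] unfolding q_def
    by (simp add: matrix_vector_mult_diff_distrib matrix_vector_mult_scaleR inner_diff_left inner_diff_right
        power2_eq_square algebra_simps)
  have "0 \<le> q v v - 2 * (q v w / q w w) * q v w + (q v w / q w w)\<^sup>2 * q w w"
    using nonneg exp by metis
  also have "\<dots> = q v v - (q v w)\<^sup>2 / q w w"
    using qw by (simp add: power2_eq_square)
  finally have "(q v w)\<^sup>2 \<le> q v v * q w w"
    using qw by (simp add: divide_le_eq)
  then show ?thesis
    by (simp add: q_def)
qed simp

context riemannian_manifold
begin

lemma smooth_fun_chart: "smooth_fun u \<Longrightarrow> c \<in> \<A> \<Longrightarrow> smooth_on (snd c ` fst c) (u \<circ> chart_inv c)"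
  by (simp add: smooth_fun_def)

lemma smooth_fun_continuous:
  assumes "smooth_fun u"
  shows "continuous_on UNIV u"
proof (rule continuous_on_locallyI)
  fix p
  obtain c where c: "c \<in> \<A>" "p \<in> fst c"
    using cover by blast
  have "continuous_on (fst c) (\<lambda>q. (u \<circ> chart_inv c) (snd c q))"
    by (rule continuous_on_compose2[OF smooth_on_continuous_on[OF smooth_fun_chart[OF assms c(1)]] continuous_on_chart[OF c(1)]])
      auto
  then have "continuous_on (fst c) u"
    by (rule continuous_on_eq) (simp add: chart_inv_left[OF c(1)])
  then show "\<exists>U. open U \<and> p \<in> U \<and> continuous_on (UNIV \<inter> U) u"
    using open_chart[OF c(1)] c(2) by auto
qed

lemma smooth_fun_bounded_linear:
  assumes "bounded_linear L" "smooth_fun u"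
  shows "smooth_fun (\<lambda>x. L (u x))"
  unfolding smooth_fun_def
proof
  fix c assume c: "c \<in> \<A>"
  show "smooth_on (snd c ` fst c) ((\<lambda>x. L (u x)) \<circ> chart_inv c)"
    using smooth_on_bounded_linear[OF open_chart_image[OF c] smooth_fun_chart[OF assms(2) c] assms(1)]
    by (simp add: o_def)
qed

lemma smooth_fun_add:
  assumes "smooth_fun u" "smooth_fun v"
  shows "smooth_fun (\<lambda>x. u x + v x)"
  unfolding smooth_fun_def
proof
  fix c assume c: "c \<in> \<A>"
  show "smooth_on (snd c ` fst c) ((\<lambda>x. u x + v x) \<circ> chart_inv c)"
    using smooth_on_add[OF open_chart_image[OF c] smooth_fun_chart[OF assms(1) c] smooth_fun_chart[OF assms(2) c]]
    by (simp add: o_def)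
qed

lemma smooth_fun_zero: "smooth_fun (\<lambda>x. 0)"
  by (simp add: smooth_fun_def o_def smooth_on_zero)

lemma smooth_fun_scale: "smooth_fun u \<Longrightarrow> smooth_fun (\<lambda>x. a * u x)"
  by (rule smooth_fun_bounded_linear[OF bounded_linear_mult_right])

lemma smooth_fun_cnj: "smooth_fun u \<Longrightarrow> smooth_fun (\<lambda>x. cnj (u x))"
  by (rule smooth_fun_bounded_linear[OF bounded_linear_cnj])

lemma smooth_fun_has_derivative:
  assumes "smooth_fun u" "c \<in> \<A>" "p \<in> fst c"
  shows "(u \<circ> chart_inv c has_derivative frechet_derivative (u \<circ> chart_inv c) (at (snd c p))) (at (snd c p))"
  by (rule smooth_on_has_derivative[OF smooth_fun_chart[OF assms(1,2)]]) (use assms(3) in auto)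

lemma smooth_fun_derivative_expand:
  assumes "smooth_fun u" "c \<in> \<A>" "p \<in> fst c"
  shows "frechet_derivative (u \<circ> chart_inv c) (at (snd c p)) v = (\<Sum>i\<in>UNIV. of_real (v $ i) * partial c u p i)"
proof -
  have lin: "linear (frechet_derivative (u \<circ> chart_inv c) (at (snd c p)))"
    using smooth_fun_has_derivative[OF assms] has_derivative_linear by blast
  have "v = (\<Sum>i\<in>UNIV. v $ i *\<^sub>R axis i 1)"
    using basis_expansion[of v] by (simp add: scalar_mult_eq_scaleR)
  from arg_cong[OF this, of "frechet_derivative (u \<circ> chart_inv c) (at (snd c p))"]
  have "frechet_derivative (u \<circ> chart_inv c) (at (snd c p)) v = (\<Sum>i\<in>UNIV. v $ i *\<^sub>R partial c u p i)"
    by (simp only: linear_sum[OF lin] linear_scale[OF lin] partial_def)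
  then show ?thesis
    by (simp add: scaleR_conv_of_real)
qed

lemma partial_bounded_linear:
  assumes "bounded_linear L" "smooth_fun u" "c \<in> \<A>" "p \<in> fst c"
  shows "partial c (\<lambda>x. L (u x)) p i = L (partial c u p i)"
proof -
  have "((\<lambda>x. L ((u \<circ> chart_inv c) x)) has_derivative
      (\<lambda>v. L (frechet_derivative (u \<circ> chart_inv c) (at (snd c p)) v))) (at (snd c p))"
    by (rule bounded_linear.has_derivative[OF assms(1) smooth_fun_has_derivative[OF assms(2-4)]])
  from fun_cong[OF frechet_derivative_at[OF this], of "axis i 1"] show ?thesis
    unfolding partial_def o_def by simp
qed

lemma partial_scale: "smooth_fun u \<Longrightarrow> c \<in> \<A> \<Longrightarrow> p \<in> fst c \<Longrightarrow> partial c (\<lambda>x. a * u x) p i = a * partial c u p i"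
  by (rule partial_bounded_linear[OF bounded_linear_mult_right])

lemma partial_cnj: "smooth_fun u \<Longrightarrow> c \<in> \<A> \<Longrightarrow> p \<in> fst c \<Longrightarrow> partial c (\<lambda>x. cnj (u x)) p i = cnj (partial c u p i)"
  by (rule partial_bounded_linear[OF bounded_linear_cnj])

lemma partial_add:
  assumes "smooth_fun u" "smooth_fun v" "c \<in> \<A>" "p \<in> fst c"
  shows "partial c (\<lambda>x. u x + v x) p i = partial c u p i + partial c v p i"
proof -
  have "((\<lambda>x. (u \<circ> chart_inv c) x + (v \<circ> chart_inv c) x) has_derivative
      (\<lambda>w. frechet_derivative (u \<circ> chart_inv c) (at (snd c p)) w +
        frechet_derivative (v \<circ> chart_inv c) (at (snd c p)) w)) (at (snd c p))"
    using assms by (intro has_derivative_add smooth_fun_has_derivative)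
  from fun_cong[OF frechet_derivative_at[OF this], of "axis i 1"] show ?thesis
    unfolding partial_def o_def by simp
qed

lemma continuous_on_partial:
  assumes "smooth_fun u" "c \<in> \<A>"
  shows "continuous_on (fst c) (\<lambda>p. partial c u p i)"
  unfolding partial_def
  by (rule continuous_on_frechet_derivative[OF smooth_fun_chart[OF assms] continuous_on_chart[OF assms(2)]
    continuous_on_const]) auto

lemma partial_change_chart:
  assumes u: "smooth_fun u" and c: "c \<in> \<A>" "c' \<in> \<A>" and p: "p \<in> fst c" "p \<in> fst c'"
  defines "J \<equiv> matrix (frechet_derivative (coord_map c c' id) (at (snd c p)))"
  shows "partial c u p j = (\<Sum>k\<in>UNIV. of_real (J $ k $ j) * partial c' u p k)"
proof -
  let ?h = "coord_map c c' id" and ?D = "frechet_derivative (coord_map c c' id) (at (snd c p))"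
  have hp: "?h (snd c p) = snd c' p"
    using chart_inv_left[OF c(1) p(1)] by (simp add: coord_map_def)
  have "(?h has_derivative ?D) (at (snd c p))"
    using isometry_coord_derivative[OF isometry_id c p(1)] p(2) by simp
  moreover have "(u \<circ> chart_inv c' has_derivative frechet_derivative (u \<circ> chart_inv c') (at (snd c' p))) (at (?h (snd c p)))"
    unfolding hp by (rule smooth_fun_has_derivative[OF u c(2) p(2)])
  ultimately have "((u \<circ> chart_inv c') \<circ> ?h has_derivative frechet_derivative (u \<circ> chart_inv c') (at (snd c' p)) \<circ> ?D) (at (snd c p))"
    by (rule diff_chain_at)
  then have "(u \<circ> chart_inv c has_derivative frechet_derivative (u \<circ> chart_inv c') (at (snd c' p)) \<circ> ?D) (at (snd c p))"
  proof (rule has_derivative_transform_within_open)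
    have "snd c ` (fst c \<inter> fst c') = snd c ` fst c \<inter> chart_inv c -` fst c'"
      using chart_inv_left[OF c(1)] by force
    then show "open (snd c ` (fst c \<inter> fst c'))"
      using continuous_open_preimage[OF continuous_on_chart_inv[OF c(1)] open_chart_image[OF c(1)] open_chart[OF c(2)]] by simp
    show "snd c p \<in> snd c ` (fst c \<inter> fst c')"
      using p by blast
    show "((u \<circ> chart_inv c') \<circ> ?h) x = (u \<circ> chart_inv c) x" if "x \<in> snd c ` (fst c \<inter> fst c')" for x
      using that chart_inv_left[OF c(1)] chart_inv_left[OF c(2)] by (auto simp: coord_map_def)
  qed
  from frechet_derivative_at[OF this]
  have "partial c u p j = frechet_derivative (u \<circ> chart_inv c') (at (snd c' p)) (?D (axis j 1))"
    unfolding partial_def by (simp add: fun_eq_iff)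
  also have "\<dots> = (\<Sum>k\<in>UNIV. of_real (?D (axis j 1) $ k) * partial c' u p k)"
    by (rule smooth_fun_derivative_expand[OF u c(2) p(2)])
  also have "\<dots> = (\<Sum>k\<in>UNIV. of_real (J $ k $ j) * partial c' u p k)"
    by (simp add: J_def matrix_def)
  finally show ?thesis .
qed

lemma metric_invertible: "c \<in> \<A> \<Longrightarrow> p \<in> fst c \<Longrightarrow> invertible (g c p)"
  using pos_def_invertible metric_pos by blast

lemma metric_sym_component: "c \<in> \<A> \<Longrightarrow> p \<in> fst c \<Longrightarrow> g c p $ i $ j = g c p $ j $ i"
  using arg_cong[OF metric_sym[of c p], of "\<lambda>A. A $ i $ j"] by (simp add: transpose_def)

text \<open>
  The metric on covectors applied to the differentials of \<open>u\<close> and \<open>w\<close>.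
\<close>

definition dual_form :: "('a, 'n) chart \<Rightarrow> ('a \<Rightarrow> complex) \<Rightarrow> ('a \<Rightarrow> complex) \<Rightarrow> 'a \<Rightarrow> complex" where
  "dual_form c u w p =
    (\<Sum>j\<in>UNIV. \<Sum>l\<in>UNIV. of_real (matrix_inv (g c p) $ j $ l) * partial c u p j * partial c w p l)"

lemma metric_complex_grad:
  assumes c: "c \<in> \<A>" "p \<in> fst c"
  shows "metric_complex c p (grad c u p) (grad c w p) = dual_form c u w p"
proof -
  let ?G = "matrix_inv (g c p)"
  have id: "(\<Sum>i\<in>UNIV. of_real (g c p $ i $ j) * (grad c u p) $ i) = partial c u p j" for j
  proof -
    have GG: "(\<Sum>i\<in>UNIV. g c p $ i $ j * ?G $ i $ k) = (if j = k then 1 else 0)" for k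
    proof -
      have "(g c p ** ?G) $ j $ k = (if j = k then 1 else 0)"
        using matrix_inv_inverse(1)[OF metric_invertible[OF c]] by (simp add: mat_def)
      then show ?thesis
        by (simp add: matrix_matrix_mult_def metric_sym_component[OF c, of j])
    qed
    have "(\<Sum>i\<in>UNIV. of_real (g c p $ i $ j) * (grad c u p) $ i) =
        (\<Sum>i\<in>UNIV. \<Sum>k\<in>UNIV. of_real (g c p $ i $ j * ?G $ i $ k) * partial c u p k)"
      by (simp add: grad_def sum_distrib_left mult.assoc)
    also have "\<dots> = (\<Sum>k\<in>UNIV. \<Sum>i\<in>UNIV. of_real (g c p $ i $ j * ?G $ i $ k) * partial c u p k)"
      by (rule sum.swap)
    also have "\<dots> = (\<Sum>k\<in>UNIV. of_real (\<Sum>i\<in>UNIV. g c p $ i $ j * ?G $ i $ k) * partial c u p k)"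
      by (simp add: sum_distrib_right)
    also have "\<dots> = (\<Sum>k\<in>UNIV. if j = k then partial c u p k else 0)"
      unfolding GG by (intro sum.cong) auto
    also have "\<dots> = partial c u p j"
      by simp
    finally show ?thesis .
  qed
  have "metric_complex c p (grad c u p) (grad c w p) =
      (\<Sum>j\<in>UNIV. \<Sum>i\<in>UNIV. of_real (g c p $ i $ j) * (grad c u p) $ i * (grad c w p) $ j)"
    unfolding metric_complex_def by (rule sum.swap)
  also have "\<dots> = (\<Sum>j\<in>UNIV. partial c u p j * (grad c w p) $ j)"
    by (simp add: sum_distrib_right[symmetric] id)
  also have "\<dots> = dual_form c u w p"
    by (simp add: dual_form_def grad_def sum_distrib_left ac_simps)
  finally show ?thesis .
qed

text \<open>
  With the Jacobian \<open>J\<close> of the change of charts, the inverse matrix transforms to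
  \<open>J g\<^sup>-\<^sup>1 J\<^sup>T\<close>, while the partial derivatives transform by the
  transpose of \<open>J\<close>.
\<close>

lemma dual_form_indep:
  assumes u: "smooth_fun u" and w: "smooth_fun w" and c: "c \<in> \<A>" "c' \<in> \<A>" and p: "p \<in> fst c" "p \<in> fst c'"
  shows "dual_form c u w p = dual_form c' u w p"
proof -
  define J where "J = matrix (frechet_derivative (coord_map c c' id) (at (snd c p)))"
  let ?G = "matrix_inv (g c p)" and ?G' = "matrix_inv (g c' p)"
  have gJ: "g c p = transpose J ** g c' p ** J"
    using isometry_metric_matrix[OF isometry_id c p(1)] p(2) by (simp add: J_def)
  have "invertible J"
    using metric_invertible[OF c(1) p(1)] unfolding gJ by (simp add: invertible_det_nz det_mul)
  then obtain K where K: "J ** K = mat 1"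
    by (auto simp: invertible_def)
  have "(J ** ?G ** transpose J ** g c' p) ** J = J ** (?G ** g c p)"
    unfolding gJ by (simp add: matrix_mul_assoc)
  also have "\<dots> = J"
    using matrix_inv_inverse(2)[OF metric_invertible[OF c(1) p(1)]] by simp
  finally have "(J ** ?G ** transpose J ** g c' p) ** J ** K = J ** K"
    by simp
  then have "J ** ?G ** transpose J ** g c' p = mat 1"
    by (simp add: K flip: matrix_mul_assoc[of _ J K])
  then have "J ** ?G ** transpose J ** (g c' p ** ?G') = ?G'"
    by (simp add: matrix_mul_assoc)
  then have G': "?G' = J ** ?G ** transpose J"
    using matrix_inv_inverse(1)[OF metric_invertible[OF c(2) p(2)]] by simp
  have G'c: "?G' $ k $ m = (\<Sum>j\<in>UNIV. \<Sum>l\<in>UNIV. J $ k $ j * ?G $ j $ l * J $ m $ l)" for k m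
    unfolding G' matrix_matrix_mult_def transpose_def
    by (simp add: sum_distrib_right) (rule sum.swap)
  have pu: "partial c u p j = (\<Sum>k\<in>UNIV. of_real (J $ k $ j) * partial c' u p k)" for j
    unfolding J_def by (rule partial_change_chart[OF u c p])
  have pw: "partial c w p j = (\<Sum>k\<in>UNIV. of_real (J $ k $ j) * partial c' w p k)" for j
    unfolding J_def by (rule partial_change_chart[OF w c p])
  have "dual_form c u w p = (\<Sum>j\<in>UNIV. \<Sum>l\<in>UNIV. \<Sum>k\<in>UNIV. \<Sum>m\<in>UNIV.
      of_real (J $ k $ j * ?G $ j $ l * J $ m $ l) * partial c' u p k * partial c' w p m)"
    unfolding dual_form_def pu pw
    by (simp add: sum_distrib_left sum_distrib_right ac_simps)
  also have "\<dots> = (\<Sum>k\<in>UNIV. \<Sum>m\<in>UNIV. \<Sum>j\<in>UNIV. \<Sum>l\<in>UNIV.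
      of_real (J $ k $ j * ?G $ j $ l * J $ m $ l) * partial c' u p k * partial c' w p m)"
  proof -
    have swap: "(\<Sum>j\<in>UNIV. \<Sum>l\<in>UNIV. \<Sum>k\<in>UNIV. \<Sum>m\<in>UNIV. F j l k m) =
        (\<Sum>k\<in>UNIV. \<Sum>m\<in>UNIV. \<Sum>j\<in>UNIV. \<Sum>l\<in>UNIV. F j l k m)" for F :: "'n \<Rightarrow> 'n \<Rightarrow> 'n \<Rightarrow> 'n \<Rightarrow> complex"
    proof -
      have "(\<Sum>j\<in>UNIV. \<Sum>l\<in>UNIV. \<Sum>k\<in>UNIV. \<Sum>m\<in>UNIV. F j l k m) =
          (\<Sum>j\<in>UNIV. \<Sum>k\<in>UNIV. \<Sum>l\<in>UNIV. \<Sum>m\<in>UNIV. F j l k m)"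
        by (intro sum.cong refl sum.swap)
      also have "\<dots> = (\<Sum>k\<in>UNIV. \<Sum>j\<in>UNIV. \<Sum>l\<in>UNIV. \<Sum>m\<in>UNIV. F j l k m)"
        by (rule sum.swap)
      also have "\<dots> = (\<Sum>k\<in>UNIV. \<Sum>j\<in>UNIV. \<Sum>m\<in>UNIV. \<Sum>l\<in>UNIV. F j l k m)"
        by (intro sum.cong refl sum.swap)
      also have "\<dots> = (\<Sum>k\<in>UNIV. \<Sum>m\<in>UNIV. \<Sum>j\<in>UNIV. \<Sum>l\<in>UNIV. F j l k m)"
        by (intro sum.cong refl sum.swap)
      finally show ?thesis .
    qed
    show ?thesis
      by (rule swap)
  qed
  also have "\<dots> = dual_form c' u w p"
    unfolding dual_form_def G'c by (simp add: sum_distrib_right)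
  finally show ?thesis .
qed

lemma grad_inner_chart:
  assumes "smooth_fun u" "smooth_fun w" "c \<in> \<A>" "p \<in> fst c"
  shows "grad_inner u w p = dual_form c u w p"
  using assms chart_at_in[of p] dual_form_indep[OF assms(1,2) assms(3) chart_at_in(1) assms(4) chart_at_in(2)]
  by (simp add: grad_inner_def Let_def metric_complex_grad)

lemma continuous_on_grad_inner:
  assumes "smooth_fun u" "smooth_fun w"
  shows "continuous_on UNIV (grad_inner u w)"
proof (rule continuous_on_locallyI)
  fix p
  obtain c where c: "c \<in> \<A>" "p \<in> fst c"
    using cover by blast
  have "continuous_on (fst c) (dual_form c u w)"
    unfolding dual_form_def[abs_def]
    by (intro continuous_intros continuous_on_partial assms c
        continuous_on_matrix_inv continuous_on_metric metric_invertible)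
  then have "continuous_on (fst c) (grad_inner u w)"
    by (rule continuous_on_eq) (simp add: grad_inner_chart[OF assms c(1)])
  then show "\<exists>U. open U \<and> p \<in> U \<and> continuous_on (UNIV \<inter> U) (grad_inner u w)"
    using open_chart[OF c(1)] c(2) by auto
qed

lemma grad_inner_add:
  assumes "smooth_fun u" "smooth_fun v" "smooth_fun w"
  shows "grad_inner (\<lambda>x. u x + v x) w p = grad_inner u w p + grad_inner v w p"
  using assms chart_at_in[of p]
  by (simp add: grad_inner_chart[OF _ _ chart_at_in[of p]] smooth_fun_add dual_form_def partial_add
      algebra_simps sum.distrib)

lemma grad_inner_scale:
  assumes "smooth_fun u" "smooth_fun w"
  shows "grad_inner (\<lambda>x. a * u x) w p = a * grad_inner u w p"
  using assms chart_at_in[of p]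
  by (simp add: grad_inner_chart[OF _ _ chart_at_in[of p]] smooth_fun_scale dual_form_def partial_scale
      sum_distrib_left ac_simps)

lemma metric_complex_sym: "c \<in> \<A> \<Longrightarrow> p \<in> fst c \<Longrightarrow> metric_complex c p X Y = metric_complex c p Y X"
  unfolding metric_complex_def
  by (subst sum.swap) (simp add: metric_sym_component[of c p] ac_simps)

lemma grad_inner_hermitian:
  assumes u: "smooth_fun u" and v: "smooth_fun v"
  shows "grad_inner u (\<lambda>y. cnj (v y)) p = cnj (grad_inner v (\<lambda>y. cnj (u y)) p)"
proof -
  define c where "c = chart_at p"
  have c: "c \<in> \<A>" "p \<in> fst c"
    by (auto simp: c_def chart_at_in)
  have gc: "grad c (\<lambda>y. cnj (w y)) p $ i = cnj (grad c w p $ i)" if "smooth_fun w" for w i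
    by (simp add: grad_def partial_cnj[OF that c])
  have "cnj (metric_complex c p (grad c v p) (grad c (\<lambda>y. cnj (u y)) p)) =
      metric_complex c p (grad c (\<lambda>y. cnj (v y)) p) (grad c u p)"
    by (simp add: metric_complex_def gc u v)
  then show ?thesis
    unfolding grad_inner_def Let_def c_def[symmetric]
    using metric_complex_sym[OF c] by simp
qed

text \<open>
  Real and imaginary part of the differential are covectors \<open>a\<close> and
  \<open>b\<close>, whose squared dual norms add up to \<open>grad_inner u (cnj u)\<close>; the
  inequality of Cauchy and Schwarz is applied to each of them.
\<close>

lemma derivative_le_grad_inner:
  assumes u: "smooth_fun u" and c: "c \<in> \<A>" "p \<in> fst c"
  shows "(norm (frechet_derivative (u \<circ> chart_inv c) (at (snd c p)) v))\<^sup>2 \<le>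
    Re (grad_inner u (\<lambda>y. cnj (u y)) p) * (v \<bullet> (g c p *v v))"
proof -
  let ?G = "matrix_inv (g c p)"
  define a where "a = (\<chi> i. Re (partial c u p i))"
  define b where "b = (\<chi> i. Im (partial c u p i))"
  have CS: "(v \<bullet> x)\<^sup>2 \<le> (x \<bullet> (?G *v x)) * (v \<bullet> (g c p *v v))" for x
  proof -
    have x: "g c p *v (?G *v x) = x"
      using matrix_inv_inverse(1)[OF metric_invertible[OF c]] by (simp add: matrix_vector_mul_assoc)
    show ?thesis
      using pos_def_Cauchy_Schwarz[OF metric_sym[OF c] metric_pos[OF c], of v "?G *v x"]
      by (simp add: x inner_commute mult.commute)
  qed
  have "frechet_derivative (u \<circ> chart_inv c) (at (snd c p)) v = Complex (v \<bullet> a) (v \<bullet> b)"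
    by (simp add: smooth_fun_derivative_expand[OF u c] complex_eq_iff a_def b_def inner_vec_def)
  then have n: "(norm (frechet_derivative (u \<circ> chart_inv c) (at (snd c p)) v))\<^sup>2 = (v \<bullet> a)\<^sup>2 + (v \<bullet> b)\<^sup>2"
    by (simp add: cmod_power2)
  have "Re (grad_inner u (\<lambda>y. cnj (u y)) p) = Re (dual_form c u (\<lambda>y. cnj (u y)) p)"
    by (simp add: grad_inner_chart[OF u smooth_fun_cnj[OF u] c])
  also have "\<dots> = (\<Sum>j\<in>UNIV. \<Sum>l\<in>UNIV. ?G $ j $ l * (a $ j * a $ l + b $ j * b $ l))"
    by (simp add: dual_form_def partial_cnj[OF u c] a_def b_def algebra_simps)
  also have "\<dots> = a \<bullet> (?G *v a) + b \<bullet> (?G *v b)"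
    by (simp add: inner_vec_def matrix_vector_mult_def sum_distrib_left sum.distrib algebra_simps)
  finally show ?thesis
    unfolding n using CS[of a] CS[of b] by (simp add: distrib_right)
qed

lemma smooth_fun_along_curve:
  assumes u: "smooth_fun u" and C: "C1_curve \<gamma> a b" and t: "a < t" "t < b"
  obtains d where "((\<lambda>s. u (\<gamma> s)) has_vector_derivative d) (at t)"
    "(norm d)\<^sup>2 \<le> Re (grad_inner u (\<lambda>y. cnj (u y)) (\<gamma> t)) * (speed \<gamma> t)\<^sup>2"
proof -
  obtain c where c: "c \<in> \<A>" "\<gamma> t \<in> fst c"
    using cover by blast
  let ?v = "velocity c \<gamma> a b t" and ?D = "frechet_derivative (u \<circ> chart_inv c) (at (snd c (\<gamma> t)))"
  have ab: "a < b"
    using t by simp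
  have "((snd c \<circ> \<gamma>) has_vector_derivative ?v) (at t within {a..b})"
    using t by (intro has_velocity[OF C ab c(1) _ c(2)]) auto
  then have v: "((snd c \<circ> \<gamma>) has_vector_derivative ?v) (at t)"
    using t by (simp add: at_within_Icc_at)
  have D: "(u \<circ> chart_inv c has_derivative ?D) (at ((snd c \<circ> \<gamma>) t) within range (snd c \<circ> \<gamma>))"
    using smooth_fun_has_derivative[OF u c] by (auto intro: has_derivative_at_withinI)
  have comp: "((u \<circ> chart_inv c) \<circ> (snd c \<circ> \<gamma>) has_vector_derivative ?D ?v) (at t)"
    by (rule vector_derivative_diff_chain_within[OF v D])
  obtain U where U: "open U" "\<And>s. s \<in> {a..b} \<Longrightarrow> s \<in> U \<longleftrightarrow> \<gamma> s \<in> fst c"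
    using open_preimage_within[OF C1_curve_continuous[OF C] open_chart[OF c(1)]] by blast
  have "((\<lambda>s. u (\<gamma> s)) has_vector_derivative ?D ?v) (at t)"
  proof (rule has_vector_derivative_transform_within_open[OF comp])
    show "open (U \<inter> {a<..<b})" "t \<in> U \<inter> {a<..<b}"
      using U t c by auto
    show "((u \<circ> chart_inv c) \<circ> (snd c \<circ> \<gamma>)) s = u (\<gamma> s)" if "s \<in> U \<inter> {a<..<b}" for s
      using that U(2)[of s] chart_inv_left[OF c(1)] by simp
  qed
  moreover have "(norm (?D ?v))\<^sup>2 \<le> Re (grad_inner u (\<lambda>y. cnj (u y)) (\<gamma> t)) * (speed \<gamma> t)\<^sup>2"
  proof -
    have "(speed \<gamma> t)\<^sup>2 = ?v \<bullet> (g c (\<gamma> t) *v ?v)"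
      using speed_eq_chart_speed[OF C t c] metric_nonneg[OF c] by (simp add: chart_speed_def)
    then show ?thesis
      using derivative_le_grad_inner[OF u c, of ?v] by simp
  qed
  ultimately show ?thesis
    by (rule that)
qed

end

section \<open>Eigenspaces\<close>

context compact_riemannian_manifold
begin

definition L2 :: "('a \<Rightarrow> complex) \<Rightarrow> ('a \<Rightarrow> complex) \<Rightarrow> complex" where
  "L2 u v = (LINT x|vol. u x * cnj (v x))"

definition energy :: "('a \<Rightarrow> complex) \<Rightarrow> ('a \<Rightarrow> complex) \<Rightarrow> complex" where
  "energy u v = (LINT x|vol. grad_inner u (\<lambda>y. cnj (v y)) x)"

lemma integrable_L2:
  assumes "smooth_fun u" "smooth_fun v"
  shows "integrable vol (\<lambda>x. u x * cnj (v x))"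
  by (intro integrable_continuous_vol continuous_intros smooth_fun_continuous assms)

lemma integrable_energy:
  assumes "smooth_fun u" "smooth_fun v"
  shows "integrable vol (grad_inner u (\<lambda>y. cnj (v y)))"
  by (intro integrable_continuous_vol continuous_on_grad_inner smooth_fun_cnj assms)

lemma L2_add:
  assumes "smooth_fun u" "smooth_fun v" "smooth_fun w"
  shows "L2 (\<lambda>x. u x + v x) w = L2 u w + L2 v w"
  unfolding L2_def by (simp add: distrib_right integrable_L2 assms)

lemma L2_scale: "L2 (\<lambda>x. a * u x) w = a * L2 u w"
  unfolding L2_def by (simp add: mult.assoc)

lemma L2_hermitian: "L2 v u = cnj (L2 u v)"
proof -
  have "cnj (L2 u v) = (LINT x|vol. cnj (u x * cnj (v x)))"
    unfolding L2_def by (rule Bochner_Integration.integral_cnj[symmetric])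
  then show ?thesis
    by (simp add: L2_def mult.commute)
qed

lemma energy_add:
  assumes "smooth_fun u" "smooth_fun v" "smooth_fun w"
  shows "energy (\<lambda>x. u x + v x) w = energy u w + energy v w"
proof -
  have "grad_inner (\<lambda>x. u x + v x) (\<lambda>y. cnj (w y)) =
      (\<lambda>x. grad_inner u (\<lambda>y. cnj (w y)) x + grad_inner v (\<lambda>y. cnj (w y)) x)"
    using assms by (intro ext grad_inner_add smooth_fun_cnj)
  then show ?thesis
    unfolding energy_def using assms by (simp add: integrable_energy)
qed

lemma energy_scale:
  assumes "smooth_fun u" "smooth_fun w"
  shows "energy (\<lambda>x. a * u x) w = a * energy u w"
proof -
  have "grad_inner (\<lambda>x. a * u x) (\<lambda>y. cnj (w y)) = (\<lambda>x. a * grad_inner u (\<lambda>y. cnj (w y)) x)"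
    using assms by (intro ext grad_inner_scale smooth_fun_cnj)
  then show ?thesis
    unfolding energy_def by simp
qed

lemma energy_hermitian:
  assumes "smooth_fun u" "smooth_fun v"
  shows "energy v u = cnj (energy u v)"
proof -
  have "cnj (energy u v) = (LINT x|vol. cnj (grad_inner u (\<lambda>y. cnj (v y)) x))"
    unfolding energy_def by (rule Bochner_Integration.integral_cnj[symmetric])
  also have "\<dots> = energy v u"
    unfolding energy_def using grad_inner_hermitian[OF assms(2,1)]
    by (intro Bochner_Integration.integral_cong) auto
  finally show ?thesis ..
qed

lemma L2_self:
  assumes "smooth_fun u"
  shows "L2 u u = of_real (LINT x|vol. (norm (u x))\<^sup>2)"
  unfolding L2_def complex_norm_square[symmetric] by (rule integral_complex_of_real)

lemma L2_pos:
  assumes u: "smooth_fun u" and "u p \<noteq> 0"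
  shows "0 < Re (L2 u u)"
proof -
  have uc: "continuous_on UNIV u"
    by (rule smooth_fun_continuous[OF u])
  then have int: "integrable vol (\<lambda>x. (norm (u x))\<^sup>2)"
    by (intro integrable_continuous_vol continuous_intros)
  have U: "open {x. u x \<noteq> 0}"
    by (intro open_Collect_neq uc continuous_on_const)
  have "(LINT x|vol. (norm (u x))\<^sup>2) \<noteq> 0"
  proof
    assume "(LINT x|vol. (norm (u x))\<^sup>2) = 0"
    then have "AE x in vol. u x = 0"
      using integral_nonneg_eq_0_iff_AE[OF int] by simp
    then have "emeasure vol {x. u x \<noteq> 0} = 0"
      using U by (subst (asm) AE_iff_measurable[OF _ refl]) auto
    then show False
      using emeasure_vol_open_pos[OF U] assms(2) by auto
  qed
  moreover have "0 \<le> (LINT x|vol. (norm (u x))\<^sup>2)"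
    by simp
  ultimately have "0 < (LINT x|vol. (norm (u x))\<^sup>2)"
    by linarith
  then show ?thesis
    by (simp add: L2_self[OF u])
qed

lemma smooth_fun_sum:
  "finite I \<Longrightarrow> (\<And>i. i \<in> I \<Longrightarrow> smooth_fun (f i)) \<Longrightarrow> smooth_fun (\<lambda>x. \<Sum>i\<in>I. f i x)"
  by (induction I rule: finite_induct) (auto intro: smooth_fun_add smooth_fun_zero)

lemma L2_sum:
  assumes "finite I" "\<And>i. i \<in> I \<Longrightarrow> smooth_fun (f i)" "smooth_fun w"
  shows "L2 (\<lambda>x. \<Sum>i\<in>I. f i x) w = (\<Sum>i\<in>I. L2 (f i) w)"
  unfolding L2_def sum_distrib_right using assms
  by (intro Bochner_Integration.integral_sum integrable_L2)

lemma L2_sum_right: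
  assumes "finite I" "\<And>i. i \<in> I \<Longrightarrow> smooth_fun (f i)" "smooth_fun w"
  shows "L2 w (\<lambda>x. \<Sum>i\<in>I. f i x) = (\<Sum>i\<in>I. L2 w (f i))"
  using L2_sum[OF assms] L2_hermitian[of w] by simp

lemma energy_sum:
  assumes "finite I" "\<And>i. i \<in> I \<Longrightarrow> smooth_fun (f i)" "smooth_fun w"
  shows "energy (\<lambda>x. \<Sum>i\<in>I. f i x) w = (\<Sum>i\<in>I. energy (f i) w)"
  using assms(1,2)
proof (induction I rule: finite_induct)
  case empty
  then show ?case
    using energy_scale[OF smooth_fun_zero assms(3), of 0] by simp
next
  case (insert i I)
  then show ?case
    using energy_add[OF _ smooth_fun_sum assms(3), of "f i" I f] by simp
qed

lemma eigenspaceD: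
  assumes "u \<in> eigenspace \<kappa>"
  shows eigenspace_smooth: "smooth_fun u"
    and eigenspace_weak: "\<And>v. smooth_fun v \<Longrightarrow> energy u v = of_real \<kappa> * L2 u v"
proof -
  have u: "has_laplacian u (\<lambda>x. of_real \<kappa> * u x)"
    using assms by (simp add: eigenspace_def)
  then show "smooth_fun u"
    by (simp add: has_laplacian_def)
  fix v assume v: "smooth_fun v"
  have "compact (closure {x. v x \<noteq> 0})"
    using compact_Int_closed[OF compact_UNIV closed_closure] by simp
  then have "L2 (\<lambda>x. of_real \<kappa> * u x) v = energy u v"
    using u v by (simp add: has_laplacian_def L2_def energy_def)
  then show "energy u v = of_real \<kappa> * L2 u v"
    by (simp add: L2_scale)
qed

lemma eigenspaceI:
  assumes "smooth_fun u" "\<And>v. smooth_fun v \<Longrightarrow> energy u v = of_real \<kappa> * L2 u v"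
  shows "u \<in> eigenspace \<kappa>"
  using assms L2_scale[of "of_real \<kappa>" u]
  by (simp add: eigenspace_def has_laplacian_def smooth_fun_scale L2_def energy_def)

lemma eigenspace_add:
  assumes "u \<in> eigenspace \<kappa>" "v \<in> eigenspace \<kappa>"
  shows "(\<lambda>x. u x + v x) \<in> eigenspace \<kappa>"
  using assms by (intro eigenspaceI)
    (simp_all add: eigenspace_smooth smooth_fun_add energy_add L2_add eigenspace_weak distrib_left)

lemma eigenspace_scale:
  assumes "u \<in> eigenspace \<kappa>"
  shows "(\<lambda>x. a * u x) \<in> eigenspace \<kappa>"
  using assms by (intro eigenspaceI)
    (simp_all add: eigenspace_smooth smooth_fun_scale energy_scale L2_scale eigenspace_weak)

text \<open>
  The energy of the pair is both \<open>\<kappa>\<close> and \<open>\<kappa>'\<close> times the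
  inner product.
\<close>

lemma eigenspaces_orthogonal:
  assumes "u \<in> eigenspace \<kappa>" "v \<in> eigenspace \<kappa>'" "\<kappa> \<noteq> \<kappa>'"
  shows "L2 u v = 0"
proof -
  note s = eigenspace_smooth[OF assms(1)] eigenspace_smooth[OF assms(2)]
  have "of_real \<kappa> * L2 u v = cnj (energy v u)"
    using eigenspace_weak[OF assms(1) s(2)] energy_hermitian[OF s(2,1)] by simp
  also have "\<dots> = of_real \<kappa>' * L2 u v"
    using eigenspace_weak[OF assms(2) s(1)] L2_hermitian[of v u] by simp
  finally show ?thesis
    using assms(3) by simp
qed

lemma eigenspace_sum_decomposition:
  assumes "u \<in> eigenspace_sum lam"
  obtains K f where "finite K" "K \<subseteq> {..lam}" "\<And>\<kappa>. \<kappa> \<in> K \<Longrightarrow> f \<kappa> \<in> eigenspace \<kappa>" "u = (\<lambda>x. \<Sum>\<kappa>\<in>K. f \<kappa> x)"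
proof -
  define P where "P u \<longleftrightarrow> (\<exists>K f. finite K \<and> K \<subseteq> {..lam} \<and> (\<forall>\<kappa>\<in>K. f \<kappa> \<in> eigenspace \<kappa>) \<and> u = (\<lambda>x. \<Sum>\<kappa>\<in>K. f \<kappa> x))" for u :: "'a \<Rightarrow> complex"
  have "P u"
    using assms unfolding eigenspace_sum_def
  proof (induction rule: cfun.span_induct_alt)
    case base
    show ?case
      unfolding P_def by (intro exI[of _ "{}"]) (auto simp: zero_fun_def)
  next
    case (step a v w)
    then obtain \<kappa>0 K f where \<kappa>0: "\<kappa>0 \<le> lam" "v \<in> eigenspace \<kappa>0" and K: "finite K" "K \<subseteq> {..lam}"
      and f: "\<forall>\<kappa>\<in>K. f \<kappa> \<in> eigenspace \<kappa>" and w: "w = (\<lambda>x. \<Sum>\<kappa>\<in>K. f \<kappa> x)"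
      unfolding P_def by blast
    define h where "h = (\<lambda>\<kappa>. if \<kappa> = \<kappa>0 then (if \<kappa>0 \<in> K then (\<lambda>x. a * v x + f \<kappa>0 x) else (\<lambda>x. a * v x)) else f \<kappa>)"
    have "h \<kappa> \<in> eigenspace \<kappa>" if "\<kappa> \<in> insert \<kappa>0 K" for \<kappa>
      using that f eigenspace_scale[OF \<kappa>0(2)] eigenspace_add by (auto simp: h_def)
    moreover have "(\<lambda>x. a * v x) + w = (\<lambda>x. \<Sum>\<kappa>\<in>insert \<kappa>0 K. h \<kappa> x)"
    proof
      fix x
      have r: "(\<Sum>\<kappa>\<in>K - {\<kappa>0}. h \<kappa> x) = (\<Sum>\<kappa>\<in>K - {\<kappa>0}. f \<kappa> x)"
        by (intro sum.cong) (auto simp: h_def)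
      have "(\<Sum>\<kappa>\<in>insert \<kappa>0 K. h \<kappa> x) = h \<kappa>0 x + (\<Sum>\<kappa>\<in>K - {\<kappa>0}. f \<kappa> x)"
        unfolding sum.insert_remove[OF K(1)] r ..
      also have "\<dots> = a * v x + (\<Sum>\<kappa>\<in>K. f \<kappa> x)"
        using K(1) by (cases "\<kappa>0 \<in> K") (auto simp: h_def sum.remove)
      finally show "((\<lambda>x. a * v x) + w) x = (\<Sum>\<kappa>\<in>insert \<kappa>0 K. h \<kappa> x)"
        by (simp add: w)
    qed
    ultimately show ?case
      unfolding P_def using K \<kappa>0 by (intro exI[of _ "insert \<kappa>0 K"] exI[of _ h]) auto
  qed
  then show ?thesis
    unfolding P_def using that by blast
qed

text \<open>
  Different eigenspaces are orthogonal for the inner product and for the energy, so only the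
  diagonal terms contribute, each with its eigenvalue as factor.
\<close>

lemma eigenspace_sum_energy_le:
  assumes "u \<in> eigenspace_sum lam"
  shows eigenspace_sum_smooth: "smooth_fun u"
    and eigenspace_sum_energy: "Re (energy u u) \<le> lam * Re (L2 u u)"
proof -
  obtain K f where K: "finite K" "K \<subseteq> {..lam}" and f: "\<And>\<kappa>. \<kappa> \<in> K \<Longrightarrow> f \<kappa> \<in> eigenspace \<kappa>"
    and u: "u = (\<lambda>x. \<Sum>\<kappa>\<in>K. f \<kappa> x)"
    using eigenspace_sum_decomposition[OF assms] by metis
  have s: "smooth_fun (f \<kappa>)" if "\<kappa> \<in> K" for \<kappa>
    using eigenspace_smooth[OF f[OF that]] .
  show us: "smooth_fun u"
    unfolding u by (rule smooth_fun_sum[OF K(1) s])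
  have diag: "L2 (f \<kappa>) u = L2 (f \<kappa>) (f \<kappa>)" if \<kappa>: "\<kappa> \<in> K" for \<kappa>
  proof -
    have "L2 (f \<kappa>) u = (\<Sum>\<kappa>'\<in>K. L2 (f \<kappa>) (f \<kappa>'))"
      unfolding u using L2_sum_right[of K f "f \<kappa>"] K(1) s \<kappa> by simp
    also have "\<dots> = (\<Sum>\<kappa>'\<in>K. if \<kappa>' = \<kappa> then L2 (f \<kappa>) (f \<kappa>) else 0)"
      using eigenspaces_orthogonal[OF f[OF \<kappa>] f] by (intro sum.cong) auto
    finally show ?thesis
      using K(1) \<kappa> by simp
  qed
  have "L2 u u = (\<Sum>\<kappa>\<in>K. L2 (f \<kappa>) u)"
    using L2_sum[of K f u] K(1) s us by (simp flip: u)
  also have "\<dots> = (\<Sum>\<kappa>\<in>K. L2 (f \<kappa>) (f \<kappa>))"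
    by (intro sum.cong refl diag)
  finally have LL: "L2 u u = (\<Sum>\<kappa>\<in>K. L2 (f \<kappa>) (f \<kappa>))" .
  have "energy u u = (\<Sum>\<kappa>\<in>K. energy (f \<kappa>) u)"
    using energy_sum[of K f u] K(1) s us by (simp flip: u)
  also have "\<dots> = (\<Sum>\<kappa>\<in>K. of_real \<kappa> * L2 (f \<kappa>) (f \<kappa>))"
    using eigenspace_weak[OF f us] diag by (intro sum.cong) auto
  finally have "Re (energy u u) = (\<Sum>\<kappa>\<in>K. \<kappa> * Re (L2 (f \<kappa>) (f \<kappa>)))"
    by simp
  also have "\<dots> \<le> (\<Sum>\<kappa>\<in>K. lam * Re (L2 (f \<kappa>) (f \<kappa>)))"
    using K(2) s by (intro sum_mono mult_right_mono) (auto simp: L2_self)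
  also have "\<dots> = lam * Re (L2 u u)"
    by (simp add: LL sum_distrib_left)
  finally show "Re (energy u u) \<le> lam * Re (L2 u u)" .
qed

text \<open>
  All spectral information that the estimate of the dimension uses.
\<close>

lemma orthonormal_low_energy_family:
  assumes B: "finite B" "B \<subseteq> eigenspace_sum lam" "cfun.independent B"
  obtains e :: "nat \<Rightarrow> 'a \<Rightarrow> complex"
  where "\<And>i. i < card B \<Longrightarrow> smooth_fun (e i)" "\<And>i. i < card B \<Longrightarrow> Re (energy (e i) (e i)) \<le> lam"
    "\<And>i j. i < card B \<Longrightarrow> j < card B \<Longrightarrow> L2 (e i) (e j) = (if i = j then 1 else 0)"
proof -
  have "\<exists>e::nat \<Rightarrow> 'a \<Rightarrow> complex. (\<forall>i<card B. e i \<in> eigenspace_sum lam) \<and>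
    (\<forall>i<card B. \<forall>j<card B. L2 (e i) (e j) = (if i = j then 1 else 0))"
  proof (rule orthonormal_family_exists)
    show "cfun.subspace (eigenspace_sum lam)"
      unfolding eigenspace_sum_def by (rule cfun.subspace_span)
    show "L2 (u + v) w = L2 u w + L2 v w"
      if "u \<in> eigenspace_sum lam" "v \<in> eigenspace_sum lam" "w \<in> eigenspace_sum lam" for u v w
      using L2_add[of u v w] that eigenspace_sum_smooth by (simp add: plus_fun_def)
    show "0 < Re (L2 u u)" if "u \<in> eigenspace_sum lam" "u \<noteq> 0" for u
      using that L2_pos[OF eigenspace_sum_smooth] by (auto simp: fun_eq_iff)
  qed (use B in \<open>auto intro: L2_scale L2_hermitian\<close>)
  then obtain e :: "nat \<Rightarrow> 'a \<Rightarrow> complex" where e: "\<And>i. i < card B \<Longrightarrow> e i \<in> eigenspace_sum lam"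
    "\<And>i j. i < card B \<Longrightarrow> j < card B \<Longrightarrow> L2 (e i) (e j) = (if i = j then 1 else 0)"
    by blast
  show ?thesis
    by (rule that[of e]) (use e eigenspace_sum_smooth eigenspace_sum_energy in \<open>force+\<close>)
qed

end

section \<open>The angle estimate\<close>

lemma sum_list_map_eq_sum_nth: "(\<Sum>\<tau>\<leftarrow>L. h \<tau>) = (\<Sum>a<length L. h (L ! a))"
  by (simp add: sum_list_sum_nth atLeast0LessThan)

lemma norm_sum_squared_le:
  fixes z :: "'i \<Rightarrow> 'b::real_normed_vector"
  shows "(norm (\<Sum>i\<in>I. z i))\<^sup>2 \<le> real (card I) * (\<Sum>i\<in>I. (norm (z i))\<^sup>2)"
proof -
  have "(norm (\<Sum>i\<in>I. z i))\<^sup>2 \<le> (\<Sum>i\<in>I. 1 * norm (z i))\<^sup>2"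
    using norm_sum[of z I] by (intro power_mono) auto
  also have "\<dots> \<le> (\<Sum>i\<in>I. 1\<^sup>2) * (\<Sum>i\<in>I. (norm (z i))\<^sup>2)"
    by (rule Cauchy_Schwarz_ineq_sum)
  finally show ?thesis
    by simp
qed

context compact_riemannian_manifold
begin

text \<open>
  The hermitian inner product of \<open>\<Phi> y\<close> and \<open>\<Phi> x\<close>, where
  \<open>\<Phi>\<close> has the components \<open>e j \<circ> \<tau>\<close> for \<open>j <
  N\<close> and \<open>\<tau>\<close> in \<open>L\<close>.
\<close>

definition kernel_sum :: "(nat \<Rightarrow> 'a \<Rightarrow> complex) \<Rightarrow> nat \<Rightarrow> ('a \<Rightarrow> 'a) list \<Rightarrow> 'a \<Rightarrow> 'a \<Rightarrow> complex" where
  "kernel_sum e N L x y = (\<Sum>a<length L. \<Sum>j<N. e j ((L ! a) y) * cnj (e j ((L ! a) x)))"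

definition spectral_density :: "(nat \<Rightarrow> 'a \<Rightarrow> complex) \<Rightarrow> nat \<Rightarrow> 'a \<Rightarrow> real" where
  "spectral_density e N x = (\<Sum>j<N. (norm (e j x))\<^sup>2)"

text \<open>
  The squared Hilbert-Schmidt norm of the differential of \<open>(e 0, \<dots>, e (N -
  1))\<close>.
\<close>

definition gradient_density :: "(nat \<Rightarrow> 'a \<Rightarrow> complex) \<Rightarrow> nat \<Rightarrow> 'a \<Rightarrow> real" where
  "gradient_density e N x = (\<Sum>j<N. Re (grad_inner (e j) (\<lambda>y. cnj (e j y)) x))"

lemma kernel_sum_diag:
  assumes "L \<noteq> []"
  shows "Re (kernel_sum e N L x x) = real (length L) * list_avg L (spectral_density e N) x"
proof -
  have "Re (kernel_sum e N L x x) = (\<Sum>a<length L. spectral_density e N ((L ! a) x))"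
    by (simp add: kernel_sum_def spectral_density_def complex_norm_square[symmetric] flip: of_real_power)
  then show ?thesis
    using assms by (simp add: list_avg_def sum_list_map_eq_sum_nth)
qed

text \<open>
  Along a curve of speed \<open>\<sigma>\<close> the vector \<open>\<Phi>\<close> moves with
  squared speed at most \<open>length L * d * \<sigma>\<^sup>2\<close>, since motions keep the
  speed, and its squared norm is at least \<open>length L * k\<close>. By the choice of
  \<open>\<Lambda>\<close> its speed is at most \<open>\<Lambda> \<sigma>\<close> times its norm
  and it turns by an angle of at most \<open>\<Lambda>\<close> times the length of the curve.
\<close>

lemma kernel_sum_ge_cos:
  assumes e: "\<And>j. j < N \<Longrightarrow> smooth_fun (e j)" and L: "L \<noteq> []" "set L \<subseteq> Collect motion"
    and D: "\<And>x. list_avg L (gradient_density e N) x \<le> d"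
    and K: "\<And>x. k \<le> list_avg L (spectral_density e N) x" and k: "0 < k"
    and \<Lambda>: "0 \<le> \<Lambda>" "d \<le> \<Lambda>\<^sup>2 * k"
    and xy: "rdist x y < ennreal s" and s: "\<Lambda> * s \<le> pi"
  shows "sqrt (Re (kernel_sum e N L x x)) * sqrt (Re (kernel_sum e N L y y)) * cos (\<Lambda> * s) \<le>
    Re (kernel_sum e N L x y)"
proof -
  let ?m = "length L"
  obtain \<gamma> where \<gamma>: "piecewise_C1_curve \<gamma>" "\<gamma> 0 = x" "\<gamma> 1 = y" "curve_length \<gamma> < s"
    using xy unfolding rdist_less_iff by blast
  have mot: "motion (L ! a)" if "a < ?m" for a
    using L(2) nth_mem[OF that] by blast
  define u where "u a j t = e j ((L ! a) (\<gamma> t))" for a j t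
  \<comment> \<open>The real coordinates of \<open>\<Phi>\<close>: the Boolean selects real or imaginary part.\<close>
  define I where "I = {..<?m} \<times> {..<N} \<times> (UNIV :: bool set)"
  define f where "f = (\<lambda>(a, j, b) t. if b then Re (u a j t) else Im (u a j t))"
  define f' where "f' = (\<lambda>(a, j, b) t. if b then Re (vector_derivative (u a j) (at t)) else Im (vector_derivative (u a j) (at t)))"
  have sumI: "(\<Sum>i\<in>I. F i) = (\<Sum>a<?m. \<Sum>j<N. F (a, j, True) + F (a, j, False))" for F :: "nat \<times> nat \<times> bool \<Rightarrow> real"
    unfolding I_def by (simp add: sum.cartesian_product' UNIV_bool add.commute)
  have S: "(\<Sum>i\<in>I. (f i t)\<^sup>2) = real ?m * list_avg L (spectral_density e N) (\<gamma> t)" for t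
    using L(1) unfolding sumI
    by (simp add: f_def u_def cmod_power2[symmetric] list_avg_def sum_list_map_eq_sum_nth spectral_density_def)
  obtain X where X: "finite X" "\<forall>t\<in>{0..1} - X. \<exists>a b. a < t \<and> t < b \<and> C1_curve \<gamma> a b"
    using piecewise_C1_pieces[OF \<gamma>(1)] by (elim exE conjE)
  have der: "(u a j has_vector_derivative vector_derivative (u a j) (at t)) (at t) \<and>
      (norm (vector_derivative (u a j) (at t)))\<^sup>2 \<le>
        Re (grad_inner (e j) (\<lambda>y. cnj (e j y)) ((L ! a) (\<gamma> t))) * (speed \<gamma> t)\<^sup>2"
    if t: "t \<in> {0<..<1} - X" and aj: "a < ?m" "j < N" for a j t
  proof -
    have "t \<in> {0..1} - X"
      using t by auto
    from bspec[OF X(2) this] obtain p q where pq: "p < t" "t < q" "C1_curve \<gamma> p q"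
      by (elim exE conjE)
    have "p < q"
      using pq by simp
    note mc = motion_curve[OF mot[OF aj(1)] this pq(3)]
    obtain d where d: "((\<lambda>s. e j (((L ! a) \<circ> \<gamma>) s)) has_vector_derivative d) (at t)"
      "(norm d)\<^sup>2 \<le> Re (grad_inner (e j) (\<lambda>y. cnj (e j y)) (((L ! a) \<circ> \<gamma>) t)) * (speed ((L ! a) \<circ> \<gamma>) t)\<^sup>2"
      by (rule smooth_fun_along_curve[OF e[OF aj(2)] mc(1) pq(1,2)])
    have "(u a j has_vector_derivative d) (at t)"
      using d(1) by (simp add: u_def[abs_def])
    then show ?thesis
      using d(2) mc(2)[OF pq(1,2)] by (simp add: vector_derivative_at)
  qed
  have "sqrt (\<Sum>i\<in>I. (f i 0)\<^sup>2) * sqrt (\<Sum>i\<in>I. (f i 1)\<^sup>2) * cos (\<Lambda> * curve_length \<gamma>) \<le> (\<Sum>i\<in>I. f i 0 * f i 1)"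
  proof (rule sphere_path_inner_ge_cos[OF _ X(1)])
    show "finite I"
      by (simp add: I_def)
    fix i assume i: "i \<in> I"
    obtain a j b where ajb: "i = (a, j, b)"
      by (cases i)
    have aj: "a < ?m" "j < N"
      using i by (auto simp: ajb I_def)
    have "continuous_on {0..1} (u a j)"
      unfolding u_def
      by (rule continuous_on_compose2[OF smooth_fun_continuous[OF e[OF aj(2)]]
          continuous_on_compose2[OF motion_continuous[OF mot[OF aj(1)]] piecewise_C1_continuous[OF \<gamma>(1)]]]) auto
    then show "continuous_on {0..1} (f i)"
      unfolding f_def ajb by (cases b) (auto intro!: continuous_intros)
    fix t assume t: "t \<in> {0<..<1} - X"
    have "(u a j has_vector_derivative vector_derivative (u a j) (at t)) (at t)"
      using der[OF t aj] by blast
    then show "(f i has_real_derivative f' i t) (at t)"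
      unfolding f_def f'_def ajb
      by (cases b) (auto simp: has_vector_derivative_complex_iff has_real_derivative_iff_has_vector_derivative)
  next
    fix t assume t: "t \<in> {0<..<1} - X"
    have "(\<Sum>i\<in>I. (f' i t)\<^sup>2) = (\<Sum>a<?m. \<Sum>j<N. (norm (vector_derivative (u a j) (at t)))\<^sup>2)"
      unfolding sumI by (simp add: f'_def cmod_power2)
    also have "\<dots> \<le> (\<Sum>a<?m. \<Sum>j<N. Re (grad_inner (e j) (\<lambda>y. cnj (e j y)) ((L ! a) (\<gamma> t))) * (speed \<gamma> t)\<^sup>2)"
      using der[OF t] by (intro sum_mono) auto
    also have "\<dots> = (real ?m * list_avg L (gradient_density e N) (\<gamma> t)) * (speed \<gamma> t)\<^sup>2"
      using L(1) by (simp add: list_avg_def sum_list_map_eq_sum_nth gradient_density_def sum_distrib_right)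
    also have "\<dots> \<le> (real ?m * (\<Lambda>\<^sup>2 * list_avg L (spectral_density e N) (\<gamma> t))) * (speed \<gamma> t)\<^sup>2"
    proof (intro mult_right_mono mult_left_mono)
      have "list_avg L (gradient_density e N) (\<gamma> t) \<le> \<Lambda>\<^sup>2 * k"
        using D \<Lambda>(2) order_trans by blast
      also have "\<dots> \<le> \<Lambda>\<^sup>2 * list_avg L (spectral_density e N) (\<gamma> t)"
        using K by (intro mult_left_mono) auto
      finally show "list_avg L (gradient_density e N) (\<gamma> t) \<le> \<Lambda>\<^sup>2 * list_avg L (spectral_density e N) (\<gamma> t)" .
    qed auto
    also have "\<dots> = (\<Lambda> * speed \<gamma> t)\<^sup>2 * (\<Sum>i\<in>I. (f i t)\<^sup>2)"
      unfolding S by (simp add: power_mult_distrib)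
    finally show "(\<Sum>i\<in>I. (f' i t)\<^sup>2) \<le> (\<Lambda> * speed \<gamma> t)\<^sup>2 * (\<Sum>i\<in>I. (f i t)\<^sup>2)" .
  next
    show "0 < (\<Sum>i\<in>I. (f i t)\<^sup>2)" for t
      unfolding S using L(1) k K[of "\<gamma> t"] by (intro mult_pos_pos) auto
    show "((\<lambda>t. \<Lambda> * speed \<gamma> t) has_integral \<Lambda> * curve_length \<gamma>) {0..1}"
      unfolding curve_length_def
      by (rule has_integral_mult_right[OF integrable_integral[OF piecewise_C1_integrable[OF \<gamma>(1)]]])
    show "0 \<le> \<Lambda> * speed \<gamma> t" for t
      using \<Lambda>(1) speed_nonneg by simp
    have "\<Lambda> * curve_length \<gamma> \<le> \<Lambda> * s"
      using \<gamma>(4) \<Lambda>(1) by (intro mult_left_mono) auto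
    then show "\<Lambda> * curve_length \<gamma> \<le> pi"
      using s by simp
  qed
  moreover have "(\<Sum>i\<in>I. f i 0 * f i 1) = Re (kernel_sum e N L x y)"
    unfolding sumI by (simp add: f_def u_def kernel_sum_def \<gamma>(2,3) mult.commute)
  moreover have "cos (\<Lambda> * s) \<le> cos (\<Lambda> * curve_length \<gamma>)"
  proof (rule cos_monotone_0_pi_le)
    have "0 \<le> curve_length \<gamma>"
      unfolding curve_length_def
      by (rule integral_nonneg[OF piecewise_C1_integrable[OF \<gamma>(1)]]) (rule speed_nonneg)
    then show "0 \<le> \<Lambda> * curve_length \<gamma>"
      using \<Lambda>(1) by simp
    show "\<Lambda> * curve_length \<gamma> \<le> \<Lambda> * s"
      using \<gamma>(4) \<Lambda>(1) by (intro mult_left_mono) auto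
  qed (rule s)
  then have "sqrt (Re (kernel_sum e N L x x)) * sqrt (Re (kernel_sum e N L y y)) * cos (\<Lambda> * s) \<le>
      sqrt (Re (kernel_sum e N L x x)) * sqrt (Re (kernel_sum e N L y y)) * cos (\<Lambda> * curve_length \<gamma>)"
    using K k less_imp_le[OF less_le_trans[OF k K]]
    by (intro mult_left_mono) (auto simp: kernel_sum_diag[OF L(1)])
  ultimately show ?thesis
    unfolding S kernel_sum_diag[OF L(1)] \<gamma>(2,3) by linarith
qed

text \<open>
  Parseval's identity.
\<close>

lemma L2_orthonormal_combination:
  fixes e :: "nat \<Rightarrow> 'a \<Rightarrow> complex"
  assumes e: "\<And>j. j < N \<Longrightarrow> smooth_fun (e j)"
    and on: "\<And>i j. i < N \<Longrightarrow> j < N \<Longrightarrow> L2 (e i) (e j) = (if i = j then 1 else 0)"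
  shows "(LINT y|vol. (norm (\<Sum>j<N. c j * e j y))\<^sup>2) = (\<Sum>j<N. (norm (c j))\<^sup>2)"
proof -
  define G where "G = (\<lambda>y. \<Sum>j<N. c j * e j y)"
  have ce: "smooth_fun (\<lambda>y. c j * e j y)" if "j < N" for j
    using e[OF that] by (rule smooth_fun_scale)
  have G: "smooth_fun G"
    unfolding G_def using ce by (intro smooth_fun_sum) auto
  have inner: "L2 (e i) G = cnj (c i)" if i: "i < N" for i
  proof -
    have "L2 (e i) G = (\<Sum>j<N. L2 (e i) (\<lambda>y. c j * e j y))"
      unfolding G_def using ce e i by (intro L2_sum_right) auto
    also have "\<dots> = (\<Sum>j<N. if j = i then cnj (c i) else 0)"
      using on i by (intro sum.cong refl) (subst L2_hermitian, auto simp: L2_scale)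
    finally show ?thesis
      using i by simp
  qed
  have "L2 G G = (\<Sum>j<N. L2 (\<lambda>y. c j * e j y) G)"
    using L2_sum[of "{..<N}" "\<lambda>j y. c j * e j y" G] ce G by (simp flip: G_def)
  also have "\<dots> = (\<Sum>j<N. of_real ((norm (c j))\<^sup>2))"
    using inner by (intro sum.cong refl) (simp add: L2_scale complex_norm_square del: of_real_power)
  finally have "of_real (LINT y|vol. (norm (G y))\<^sup>2) = (of_real (\<Sum>j<N. (norm (c j))\<^sup>2) :: complex)"
    unfolding L2_self[OF G] by simp
  then show ?thesis
    unfolding of_real_eq_iff G_def .
qed

lemma kernel_sum_continuous:
  assumes e: "\<And>j. j < N \<Longrightarrow> smooth_fun (e j)" and L: "set L \<subseteq> Collect motion"
  shows "continuous_on UNIV (\<lambda>y. kernel_sum e N L x y)"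
  unfolding kernel_sum_def
proof (intro continuous_intros)
  fix a j assume "a \<in> {..<length L}" "j \<in> {..<N}"
  then have "motion (L ! a)" "smooth_fun (e j)"
    using L e nth_mem by auto
  then show "continuous_on UNIV (\<lambda>y. e j ((L ! a) y))"
    by (intro continuous_on_compose2[OF smooth_fun_continuous motion_continuous]) auto
qed

text \<open>
  For each single motion equality holds by Parseval's identity and the invariance of the volume.
  The inequality of Cauchy and Schwarz over the list costs a factor \<open>length L\<close>, the
  same factor by which \<open>kernel_sum\<close> exceeds an average.
\<close>

lemma kernel_sum_Bessel:
  assumes e: "\<And>j. j < N \<Longrightarrow> smooth_fun (e j)"
    and on: "\<And>i j. i < N \<Longrightarrow> j < N \<Longrightarrow> L2 (e i) (e j) = (if i = j then 1 else 0)"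
    and L: "L \<noteq> []" "set L \<subseteq> Collect motion"
  shows "(LINT y|vol. (norm (kernel_sum e N L x y))\<^sup>2) \<le> real (length L) * Re (kernel_sum e N L x x)"
proof -
  let ?m = "length L"
  define G where "G a z = (\<Sum>j<N. cnj (e j ((L ! a) x)) * e j z)" for a z
  have mot: "motion (L ! a)" if "a < ?m" for a
    using L(2) nth_mem[OF that] by blast
  have Gc: "continuous_on UNIV (G a)" for a
    unfolding G_def by (intro continuous_intros smooth_fun_continuous e) auto
  have Gmc: "continuous_on UNIV (\<lambda>y. G a ((L ! a) y))" if "a < ?m" for a
    by (rule continuous_on_compose2[OF Gc motion_continuous[OF mot[OF that]]]) simp
  have ker: "kernel_sum e N L x y = (\<Sum>a<?m. G a ((L ! a) y))" for y
    by (simp add: kernel_sum_def G_def mult.commute)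
  have int: "integrable vol (\<lambda>y. (norm (G a ((L ! a) y)))\<^sup>2)" if "a < ?m" for a
    using Gmc[OF that] by (intro integrable_continuous_vol continuous_intros)
  have "(LINT y|vol. (norm (kernel_sum e N L x y))\<^sup>2) \<le>
      (LINT y|vol. real ?m * (\<Sum>a<?m. (norm (G a ((L ! a) y)))\<^sup>2))"
  proof (rule integral_mono)
    show "integrable vol (\<lambda>y. (norm (kernel_sum e N L x y))\<^sup>2)"
      by (intro integrable_continuous_vol continuous_intros kernel_sum_continuous e L(2))
    show "integrable vol (\<lambda>y. real ?m * (\<Sum>a<?m. (norm (G a ((L ! a) y)))\<^sup>2))"
      using int by (intro integrable_mult_right Bochner_Integration.integrable_sum) auto
    show "(norm (kernel_sum e N L x y))\<^sup>2 \<le> real ?m * (\<Sum>a<?m. (norm (G a ((L ! a) y)))\<^sup>2)" for y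
      unfolding ker using norm_sum_squared_le[of "\<lambda>a. G a ((L ! a) y)" "{..<?m}"] by simp
  qed
  also have "\<dots> = real ?m * (\<Sum>a<?m. LINT y|vol. (norm (G a ((L ! a) y)))\<^sup>2)"
    using int by (simp add: Bochner_Integration.integral_sum)
  also have "\<dots> = real ?m * (\<Sum>a<?m. \<Sum>j<N. (norm (e j ((L ! a) x)))\<^sup>2)"
  proof (intro arg_cong2[of _ _ _ _ "(*)"] refl sum.cong)
    fix a assume "a \<in> {..<?m}"
    then have "motion (L ! a)"
      using mot by simp
    moreover have "continuous_on UNIV (\<lambda>z. (norm (G a z))\<^sup>2)"
      by (intro continuous_intros Gc)
    ultimately have "(LINT y|vol. (norm (G a ((L ! a) y)))\<^sup>2) = (LINT z|vol. (norm (G a z))\<^sup>2)"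
      by (rule integral_motion)
    also have "\<dots> = (\<Sum>j<N. (norm (cnj (e j ((L ! a) x))))\<^sup>2)"
      unfolding G_def by (rule L2_orthonormal_combination[OF e on])
    finally show "(LINT y|vol. (norm (G a ((L ! a) y)))\<^sup>2) = (\<Sum>j<N. (norm (e j ((L ! a) x)))\<^sup>2)"
      by simp
  qed
  also have "\<dots> = real ?m * Re (kernel_sum e N L x x)"
    by (simp add: kernel_sum_def complex_norm_square[symmetric] flip: of_real_power)
  finally show ?thesis .
qed

lemma measurable_rdist: "rdist p \<in> borel_measurable vol"
proof (rule borel_measurableI_less)
  fix a :: ennreal
  have "open {y. rdist p y < a}"
  proof (cases a rule: ennreal_cases)
    case (real r)
    then show ?thesis
      using open_rball[of p r] by (simp add: rball_def)
  next
    case top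
    have "{y. rdist p y < top} = (\<Union>n. rball p (real n))"
    proof (intro set_eqI iffI)
      fix y assume "y \<in> {y. rdist p y < top}"
      then obtain n where "rdist p y < of_nat n"
        using ennreal_Ex_less_of_nat[of "rdist p y"] by auto
      then show "y \<in> (\<Union>n. rball p (real n))"
        by (auto simp: rball_def ennreal_of_nat_eq_real_of_nat)
    next
      fix y assume "y \<in> (\<Union>n. rball p (real n))"
      then show "y \<in> {y. rdist p y < top}"
        by (auto simp: rball_def intro: less_trans)
    qed
    then show ?thesis
      using top open_rball[of p] by (simp add: open_UN)
  qed
  then show "{y \<in> space vol. rdist p y < a} \<in> sets vol"
    by simp
qed

text \<open>
  The distance cut off at \<open>T\<close>, as a real number; the cut-off also gives a value where the distance
  is infinite.
\<close>

definition cut_dist :: "real \<Rightarrow> 'a \<Rightarrow> 'a \<Rightarrow> real" where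
  "cut_dist T p y = enn2real (min (rdist p y) (ennreal T))"

lemma measurable_cut_dist [measurable]: "cut_dist T p \<in> borel_measurable vol"
  unfolding cut_dist_def[abs_def] using measurable_rdist[of p] by measurable

lemma cut_dist_nonneg: "0 \<le> cut_dist T p y"
  by (simp add: cut_dist_def)

lemma cut_dist_le: "0 \<le> T \<Longrightarrow> cut_dist T p y \<le> T"
  by (simp add: cut_dist_def enn2real_leI)

lemma cut_dist_less_iff:
  assumes "0 \<le> T" "s \<le> T"
  shows "cut_dist T p y < s \<longleftrightarrow> y \<in> rball p s"
proof (cases "rdist p y < ennreal T")
  case True
  then obtain r where r: "rdist p y = ennreal r" "0 \<le> r"
    by (cases "rdist p y" rule: ennreal_cases) auto
  then have "cut_dist T p y = r"
    using True by (simp add: cut_dist_def min_def less_imp_le)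
  then show ?thesis
    using r by (auto simp: rball_def ennreal_less_iff)
next
  case False
  then have "cut_dist T p y = T"
    using assms(1) by (simp add: cut_dist_def min_absorb2 not_less)
  moreover have "\<not> rdist p y < ennreal s"
    using False assms(2) by (meson ennreal_leI less_le_trans)
  ultimately show ?thesis
    using assms(2) by (auto simp: rball_def)
qed

text \<open>The squared cosine of the spherical angle, which vanishes from a right angle on.\<close>

definition cos2_weight :: "real \<Rightarrow> real \<Rightarrow> 'a \<Rightarrow> 'a \<Rightarrow> real" where
  "cos2_weight \<Lambda> T p y = (cos (min (\<Lambda> * cut_dist T p y) (pi / 2)))\<^sup>2"

lemma cos2_weight_bounds: "0 \<le> cos2_weight \<Lambda> T p y" "cos2_weight \<Lambda> T p y \<le> 1"
  by (auto simp: cos2_weight_def power_le_one_iff abs_square_le_1)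

lemma measurable_cos2_weight [measurable]: "cos2_weight \<Lambda> T p \<in> borel_measurable vol"
  unfolding cos2_weight_def[abs_def] by measurable

lemma integrable_cos2_weight: "integrable vol (cos2_weight \<Lambda> T p)"
proof -
  interpret finite_measure vol
    by (rule finite_measure_vol)
  show ?thesis
    using cos2_weight_bounds[of \<Lambda> T p] by (intro integrable_const_bound[of _ 1]) auto
qed

text \<open>
  The angle estimate holds for all radii greater than the distance and hence, by continuity of
  the cosine, for the distance itself. From a right angle on the weight is \<open>0\<close>.
\<close>

lemma kernel_sum_weight_le:
  assumes e: "\<And>j. j < N \<Longrightarrow> smooth_fun (e j)" and L: "L \<noteq> []" "set L \<subseteq> Collect motion"
    and D: "\<And>x. list_avg L (gradient_density e N) x \<le> d"
    and K: "\<And>x. k \<le> list_avg L (spectral_density e N) x" and k: "0 < k"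
    and \<Lambda>: "0 < \<Lambda>" "d \<le> \<Lambda>\<^sup>2 * k" and T: "0 \<le> T" "pi / 2 \<le> \<Lambda> * T"
  shows "Re (kernel_sum e N L p p) * Re (kernel_sum e N L y y) * cos2_weight \<Lambda> T p y \<le>
    (norm (kernel_sum e N L p y))\<^sup>2"
proof (cases "\<Lambda> * cut_dist T p y < pi / 2")
  case False
  then have "min (\<Lambda> * cut_dist T p y) (pi / 2) = pi / 2"
    by (intro min_absorb2) simp
  then show ?thesis
    by (simp add: cos2_weight_def)
next
  case True
  define r where "r = cut_dist T p y"
  define h where "h = pi / 2 / \<Lambda> - r"
  have h: "0 < h"
    using True \<Lambda>(1) by (simp add: h_def r_def field_simps)
  let ?q = "\<lambda>z. Re (kernel_sum e N L z z)"
  have q: "0 \<le> ?q z" for z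
    using L(1) k K[of z] by (simp add: kernel_sum_diag)
  define s where "s n = r + h * inverse (real (Suc n))" for n
  have "sqrt (?q p) * sqrt (?q y) * cos (\<Lambda> * s n) \<le> Re (kernel_sum e N L p y)" for n
  proof -
    have hn: "0 < h * inverse (real (Suc n))" "h * inverse (real (Suc n)) \<le> h"
      using h by (auto simp: field_simps)
    have sn: "s n \<le> pi / 2 / \<Lambda>"
      using hn by (simp add: s_def h_def)
    have "pi / 2 / \<Lambda> \<le> T"
      using T(2) \<Lambda>(1) by (simp add: field_simps)
    then have "rdist p y < ennreal (s n)"
      using cut_dist_less_iff[of T "s n" p y] T(1) sn hn(1) by (simp add: s_def r_def rball_def)
    moreover have "\<Lambda> * s n \<le> pi"
    proof -
      have "\<Lambda> * s n \<le> pi / 2"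
        using sn \<Lambda>(1) by (simp add: field_simps)
      then show ?thesis
        using pi_gt_zero by linarith
    qed
    ultimately show ?thesis
      using \<Lambda> by (intro kernel_sum_ge_cos[OF e L D K k]) auto
  qed
  moreover have "(\<lambda>n. sqrt (?q p) * sqrt (?q y) * cos (\<Lambda> * s n)) \<longlonglongrightarrow> sqrt (?q p) * sqrt (?q y) * cos (\<Lambda> * (r + h * 0))"
    unfolding s_def by (intro tendsto_intros LIMSEQ_inverse_real_of_nat)
  ultimately have le: "sqrt (?q p) * sqrt (?q y) * cos (\<Lambda> * r) \<le> Re (kernel_sum e N L p y)"
    by (auto intro: LIMSEQ_le_const2)
  have c: "0 \<le> cos (\<Lambda> * r)"
    using True \<Lambda>(1) cut_dist_nonneg[of T p y] by (intro cos_ge_zero) (auto simp: r_def intro: order_trans[of _ 0])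
  have "?q p * ?q y * cos2_weight \<Lambda> T p y = (sqrt (?q p) * sqrt (?q y) * cos (\<Lambda> * r))\<^sup>2"
    using True q by (simp add: cos2_weight_def power_mult_distrib r_def min_def)
  also have "\<dots> \<le> (Re (kernel_sum e N L p y))\<^sup>2"
    using le c q by (intro power_mono) auto
  also have "\<dots> \<le> (norm (kernel_sum e N L p y))\<^sup>2"
    by (simp add: cmod_power2)
  finally show ?thesis .
qed

end

section \<open>The bound on the number of eigenvalues\<close>

context compact_riemannian_manifold
begin

text \<open>
  Layer cake: \<open>cos\<^sup>2 s\<close> is the integral of \<open>sin (2 \<theta>)\<close> from \<open>s\<close> to a right angle.
\<close>

lemma sin_double_layer:
  fixes s :: real
  assumes s: "0 \<le> s" "s \<le> pi / 2"
  shows "(\<integral>\<^sup>+\<theta>. ennreal (if s < \<theta> \<and> \<theta> \<le> pi / 2 then sin (2 * \<theta>) else 0) \<partial>lborel) = ennreal ((cos s)\<^sup>2)"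
proof -
  have pos: "0 \<le> sin (2 * \<theta>)" if "s \<le> \<theta>" "\<theta> \<le> pi / 2" for \<theta>
    using s that by (intro sin_ge_zero) auto
  have "(\<integral>\<^sup>+\<theta>. ennreal (if s < \<theta> \<and> \<theta> \<le> pi / 2 then sin (2 * \<theta>) else 0) \<partial>lborel) =
      (\<integral>\<^sup>+\<theta>. ennreal (sin (2 * \<theta>)) * indicator {s..pi / 2} \<theta> \<partial>lborel)"
    using AE_lborel_singleton[of s] by (intro nn_integral_cong_AE) (auto simp: indicator_def elim: eventually_mono)
  also have "\<dots> = ennreal (- (cos (pi / 2))\<^sup>2 - (- (cos s)\<^sup>2))"
  proof (rule nn_integral_FTC_Icc)
    show "((\<lambda>\<theta>. - (cos \<theta>)\<^sup>2) has_real_derivative sin (2 * \<theta>)) (at \<theta>)" for \<theta>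
      by (auto intro!: derivative_eq_intros simp: sin_double)
  qed (use s pos in \<open>auto\<close>)
  finally show ?thesis
    by simp
qed

text \<open>
  Fubini's theorem for the layers: a point \<open>y\<close> at distance \<open>d\<close>
  contributes to the layers \<open>\<theta> > \<surd>lam d\<close>, which means that
  \<open>y\<close> lies in the ball of radius \<open>\<theta> / \<surd>lam\<close>.
\<close>

lemma integral_cos2_weight:
  assumes lam: "0 < lam"
  shows "(LINT y|vol. cos2_weight (sqrt lam) (pi / 2 / sqrt lam) p y) =
    integral {0..pi / 2} (\<lambda>\<theta>. measure vol (rball p (\<theta> / sqrt lam)) * sin (2 * \<theta>))"
proof -
  interpret finite_measure vol
    by (rule finite_measure_vol)
  interpret pair_sigma_finite vol "lborel :: real measure"
    by unfold_locales
  define T where "T = pi / 2 / sqrt lam"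
  define s where "s y = sqrt lam * cut_dist T p y" for y
  define V where "V \<theta> = measure vol (rball p (\<theta> / sqrt lam))" for \<theta>
  have T: "0 \<le> T" "sqrt lam * T = pi / 2"
    using lam by (auto simp: T_def)
  have s: "0 \<le> s y" "s y \<le> pi / 2" for y
  proof -
    show "0 \<le> s y"
      using lam cut_dist_nonneg by (simp add: s_def)
    have "s y \<le> sqrt lam * T"
      unfolding s_def using lam cut_dist_le[OF T(1)] by (intro mult_left_mono) auto
    then show "s y \<le> pi / 2"
      by (simp add: T)
  qed
  have w: "cos2_weight (sqrt lam) T p y = (cos (s y))\<^sup>2" for y
    using s(2)[of y] by (simp add: cos2_weight_def s_def min_absorb1)
  have [measurable]: "s \<in> borel_measurable vol"
    unfolding s_def[abs_def] by measurable
  have sub: "{y. s y < \<theta>} = rball p (\<theta> / sqrt lam)" if "\<theta> \<le> pi / 2" for \<theta>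
  proof -
    have "\<theta> / sqrt lam \<le> T"
      unfolding T_def using lam that by (intro divide_right_mono) auto
    then have "cut_dist T p y < \<theta> / sqrt lam \<longleftrightarrow> y \<in> rball p (\<theta> / sqrt lam)" for y
      by (rule cut_dist_less_iff[OF T(1)])
    moreover have "s y < \<theta> \<longleftrightarrow> cut_dist T p y < \<theta> / sqrt lam" for y
      using lam by (simp add: s_def pos_less_divide_eq mult.commute)
    ultimately show ?thesis
      by auto
  qed
  have "ennreal (LINT y|vol. cos2_weight (sqrt lam) T p y) = (\<integral>\<^sup>+y. ennreal (cos2_weight (sqrt lam) T p y) \<partial>vol)"
    using cos2_weight_bounds by (intro nn_integral_eq_integral[symmetric] integrable_cos2_weight) auto
  also have "\<dots> = (\<integral>\<^sup>+y. \<integral>\<^sup>+\<theta>. ennreal (if s y < \<theta> \<and> \<theta> \<le> pi / 2 then sin (2 * \<theta>) else 0) \<partial>lborel \<partial>vol)"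
    unfolding w sin_double_layer[OF s] ..
  also have "\<dots> = (\<integral>\<^sup>+\<theta>. \<integral>\<^sup>+y. ennreal (if s y < \<theta> \<and> \<theta> \<le> pi / 2 then sin (2 * \<theta>) else 0) \<partial>vol \<partial>lborel)"
    by (rule Fubini'[symmetric]) measurable
  also have "\<dots> = (\<integral>\<^sup>+\<theta>\<in>{0..pi / 2}. ennreal (V \<theta> * sin (2 * \<theta>)) \<partial>lborel)"
  proof (rule nn_integral_cong)
    fix \<theta> :: real
    show "(\<integral>\<^sup>+y. ennreal (if s y < \<theta> \<and> \<theta> \<le> pi / 2 then sin (2 * \<theta>) else 0) \<partial>vol) =
        ennreal (V \<theta> * sin (2 * \<theta>)) * indicator {0..pi / 2} \<theta>"
    proof (cases "\<theta> \<in> {0..pi / 2}")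
      case True
      then have sn: "0 \<le> sin (2 * \<theta>)"
        by (intro sin_ge_zero) auto
      have "(\<integral>\<^sup>+y. ennreal (if s y < \<theta> \<and> \<theta> \<le> pi / 2 then sin (2 * \<theta>) else 0) \<partial>vol) =
          (\<integral>\<^sup>+y. ennreal (sin (2 * \<theta>)) * indicator (rball p (\<theta> / sqrt lam)) y \<partial>vol)"
        using True sub[of \<theta>] by (intro nn_integral_cong) (auto simp: indicator_def)
      also have "\<dots> = ennreal (sin (2 * \<theta>)) * emeasure vol (rball p (\<theta> / sqrt lam))"
        using open_rball by (intro nn_integral_cmult_indicator) auto
      also have "\<dots> = ennreal (V \<theta> * sin (2 * \<theta>))"
        using sn by (simp add: V_def emeasure_eq_measure ennreal_mult'[symmetric] mult.commute)
      finally show ?thesis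
        using True by simp
    next
      case False
      then have z: "(if s y < \<theta> \<and> \<theta> \<le> pi / 2 then sin (2 * \<theta>) else 0) = 0" for y
        using s(1)[of y] by auto
      show ?thesis
        unfolding z using False by simp
    qed
  qed
  also have "\<dots> = ennreal (integral {0..pi / 2} (\<lambda>\<theta>. V \<theta> * sin (2 * \<theta>)))"
  proof (rule set_nn_integral_lborel_eq_integral)
    have "mono V"
      unfolding V_def
    proof (intro monoI finite_measure_mono)
      fix a b :: real assume "a \<le> b"
      then have "ennreal (a / sqrt lam) \<le> ennreal (b / sqrt lam)"
        using lam by (intro ennreal_leI divide_right_mono) auto
      then show "rball p (a / sqrt lam) \<subseteq> rball p (b / sqrt lam)"
        by (auto simp: rball_def)
    qed (use open_rball in auto)
    then have [measurable]: "V \<in> borel_measurable borel"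
      by (rule borel_measurable_mono)
    show "set_borel_measurable borel {0..pi / 2} (\<lambda>\<theta>. V \<theta> * sin (2 * \<theta>))"
      unfolding set_borel_measurable_def by measurable
    show "0 \<le> V \<theta> * sin (2 * \<theta>)" if "\<theta> \<in> {0..pi / 2}" for \<theta>
      using that by (intro mult_nonneg_nonneg sin_ge_zero) (auto simp: V_def)
    show "(\<integral>\<^sup>+\<theta>\<in>{0..pi / 2}. ennreal (V \<theta> * sin (2 * \<theta>)) \<partial>lborel) < \<infinity>"
      using calculation by (metis ennreal_less_top infinity_ennreal_def)
  qed
  finally have "ennreal (LINT y|vol. cos2_weight (sqrt lam) T p y) =
      ennreal (integral {0..pi / 2} (\<lambda>\<theta>. V \<theta> * sin (2 * \<theta>)))" .
  moreover have "0 \<le> (LINT y|vol. cos2_weight (sqrt lam) T p y)"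
    using cos2_weight_bounds by (intro integral_nonneg_AE) auto
  moreover have "0 \<le> integral {0..pi / 2} (\<lambda>\<theta>. V \<theta> * sin (2 * \<theta>))"
  proof (cases "(\<lambda>\<theta>. V \<theta> * sin (2 * \<theta>)) integrable_on {0..pi / 2}")
    case True
    then show ?thesis
      by (rule Henstock_Kurzweil_Integration.integral_nonneg) (auto simp: V_def intro!: mult_nonneg_nonneg sin_ge_zero)
  qed (simp add: not_integrable_integral)
  ultimately show ?thesis
    by (simp add: T_def V_def)
qed

lemma cos2_ball_volume_le:
  assumes lam: "0 < lam" and \<alpha>: "0 < \<alpha>" "\<alpha> < pi / 2"
  shows "(cos \<alpha>)\<^sup>2 * measure vol (rball p (\<alpha> / sqrt lam)) \<le>
    (LINT y|vol. cos2_weight (sqrt lam) (pi / 2 / sqrt lam) p y)"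
proof -
  interpret finite_measure vol
    by (rule finite_measure_vol)
  let ?T = "pi / 2 / sqrt lam" and ?B = "rball p (\<alpha> / sqrt lam)"
  have B: "?B \<in> sets vol"
    using open_rball by simp
  have T: "0 \<le> ?T" "\<alpha> / sqrt lam \<le> ?T"
    using lam \<alpha> by (simp, intro divide_right_mono) auto
  have "(cos \<alpha>)\<^sup>2 * measure vol ?B = (LINT y|vol. (cos \<alpha>)\<^sup>2 * indicator ?B y)"
    using B by simp
  also have "\<dots> \<le> (LINT y|vol. cos2_weight (sqrt lam) ?T p y)"
  proof (rule integral_mono)
    show "integrable vol (\<lambda>y. (cos \<alpha>)\<^sup>2 * indicator ?B y)"
      using B by (intro integrable_mult_right integrable_real_indicator) (auto simp: emeasure_eq_measure)
    show "integrable vol (cos2_weight (sqrt lam) ?T p)"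
      by (rule integrable_cos2_weight)
    fix y
    show "(cos \<alpha>)\<^sup>2 * indicator ?B y \<le> cos2_weight (sqrt lam) ?T p y"
    proof (cases "y \<in> ?B")
      case True
      then have "cut_dist ?T p y < \<alpha> / sqrt lam"
        using cut_dist_less_iff[OF T] by simp
      then have s: "sqrt lam * cut_dist ?T p y < \<alpha>"
        using lam by (simp add: pos_less_divide_eq mult.commute)
      have s0: "0 \<le> sqrt lam * cut_dist ?T p y"
        using lam cut_dist_nonneg by simp
      have "cos \<alpha> \<le> cos (sqrt lam * cut_dist ?T p y)"
        using s s0 \<alpha> by (intro cos_monotone_0_pi_le) auto
      then have "(cos \<alpha>)\<^sup>2 \<le> (cos (sqrt lam * cut_dist ?T p y))\<^sup>2"
        using \<alpha> by (intro power_mono cos_ge_zero) auto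
      then show ?thesis
        using True s \<alpha> by (simp add: cos2_weight_def min_absorb1)
    qed (simp add: cos2_weight_bounds)
  qed
  finally show ?thesis .
qed

end

context compact_homogeneous_manifold
begin

text \<open>
  The argument of the introduction, with error \<open>\<epsilon>\<close>. After averaging,
  \<open>k\<close> is a lower bound for the spectral density and \<open>d\<close> an upper bound
  for the gradient density; \<open>\<surd>(d / k)\<close> takes the place of
  \<open>\<surd>lam\<close>. The cut-off of the distance stays at \<open>\<pi>/2 /
  \<surd>lam\<close>, which suffices because \<open>lam \<le> d / k\<close>.
\<close>

lemma weight_integral_le_perturbed:
  assumes e: "\<And>j. j < N \<Longrightarrow> smooth_fun (e j)" "\<And>j. j < N \<Longrightarrow> Re (energy (e j) (e j)) \<le> lam"
    and on: "\<And>i j. i < N \<Longrightarrow> j < N \<Longrightarrow> L2 (e i) (e j) = (if i = j then 1 else 0)"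
    and lam: "0 < lam" and \<epsilon>: "0 < \<epsilon>" "\<epsilon> < real N / total_volume"
  defines "k \<equiv> real N / total_volume - \<epsilon>" and "d \<equiv> lam * (real N / total_volume) + \<epsilon>"
  shows "k * (LINT y|vol. cos2_weight (sqrt (d / k)) (pi / 2 / sqrt lam) p y) \<le> 1"
proof -
  let ?K = "spectral_density e N" and ?D = "gradient_density e N" and ?T = "pi / 2 / sqrt lam"
  define \<Lambda> where "\<Lambda> = sqrt (d / k)"
  have k: "0 < k"
    using \<epsilon> by (simp add: k_def)
  have d: "lam * k \<le> d"
    using \<epsilon> lam by (simp add: k_def d_def algebra_simps)
  then have \<Lambda>: "sqrt lam \<le> \<Lambda>" "0 < \<Lambda>" "d \<le> \<Lambda>\<^sup>2 * k"
  proof -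
    have "lam \<le> d / k"
      using d k by (simp add: le_divide_eq)
    then show "sqrt lam \<le> \<Lambda>" "0 < \<Lambda>" "d \<le> \<Lambda>\<^sup>2 * k"
      using lam k by (auto simp: \<Lambda>_def)
  qed
  have Kc: "continuous_on UNIV ?K"
    unfolding spectral_density_def[abs_def] by (intro continuous_intros smooth_fun_continuous e) auto
  have Dc: "continuous_on UNIV ?D"
    unfolding gradient_density_def[abs_def]
    by (intro continuous_intros continuous_on_grad_inner smooth_fun_cnj e) auto
  have "(LINT x|vol. ?K x) = (\<Sum>j<N. LINT x|vol. (norm (e j x))\<^sup>2)"
    unfolding spectral_density_def
    by (intro Bochner_Integration.integral_sum integrable_continuous_vol continuous_intros smooth_fun_continuous e) auto
  also have "\<dots> = (\<Sum>j<N. 1)"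
  proof (rule sum.cong[OF refl])
    fix j assume "j \<in> {..<N}"
    then have "complex_of_real (LINT x|vol. (norm (e j x))\<^sup>2) = of_real 1"
      using L2_self[OF e(1), of j] on[of j j] by simp
    then show "(LINT x|vol. (norm (e j x))\<^sup>2) = 1"
      unfolding of_real_eq_iff .
  qed
  finally have meanK: "vol_mean ?K = real N / total_volume"
    by (simp add: vol_mean_def)
  have "(LINT x|vol. ?D x) = (\<Sum>j<N. LINT x|vol. Re (grad_inner (e j) (\<lambda>y. cnj (e j y)) x))"
    unfolding gradient_density_def
    by (intro Bochner_Integration.integral_sum integrable_continuous_vol continuous_intros
        continuous_on_grad_inner smooth_fun_cnj e) auto
  also have "\<dots> = (\<Sum>j<N. Re (energy (e j) (e j)))"
    unfolding energy_def using e(1) by (intro sum.cong refl integral_Re integrable_energy) auto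
  also have "\<dots> \<le> real N * lam"
    using sum_bounded_above[of "{..<N}" "\<lambda>j. Re (energy (e j) (e j))" lam] e(2) by simp
  finally have "vol_mean ?D \<le> real N * lam / total_volume"
    unfolding vol_mean_def using total_volume_pos by (intro divide_right_mono) auto
  then have meanD: "vol_mean ?D \<le> lam * (real N / total_volume)"
    by (simp add: mult.commute)
  obtain L where L: "L \<noteq> []" "set L \<subseteq> Collect motion"
    "\<And>x. list_avg L ?D x \<le> vol_mean ?D + \<epsilon>" "\<And>x. vol_mean ?K - \<epsilon> \<le> list_avg L ?K x"
    using list_avg_near_means[OF Dc Kc \<epsilon>(1)] by metis
  have LD: "list_avg L ?D x \<le> d" for x
    using L(3)[of x] meanD by (simp add: d_def)
  have LK: "k \<le> list_avg L ?K x" for x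
    using L(4)[of x] by (simp add: meanK k_def)
  let ?m = "real (length L)" and ?q = "\<lambda>y. Re (kernel_sum e N L y y)"
  have m: "0 < ?m"
    using L(1) by simp
  have q: "?m * k \<le> ?q y" for y
    using LK[of y] by (simp add: kernel_sum_diag[OF L(1)] mult_left_mono)
  have qp: "0 < ?q p"
    using q[of p] m k by (meson less_le_trans mult_pos_pos)
  have T: "0 \<le> ?T" "pi / 2 \<le> \<Lambda> * ?T"
  proof -
    show "0 \<le> ?T"
      using lam by simp
    have "sqrt lam * ?T \<le> \<Lambda> * ?T"
      using \<Lambda>(1) lam by (intro mult_right_mono) auto
    then show "pi / 2 \<le> \<Lambda> * ?T"
      using lam by simp
  qed
  have "?q p * (?m * k) * (LINT y|vol. cos2_weight \<Lambda> ?T p y) = (LINT y|vol. ?q p * (?m * k) * cos2_weight \<Lambda> ?T p y)"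
    by simp
  also have "\<dots> \<le> (LINT y|vol. (norm (kernel_sum e N L p y))\<^sup>2)"
  proof (rule integral_mono)
    show "integrable vol (\<lambda>y. ?q p * (?m * k) * cos2_weight \<Lambda> ?T p y)"
      by (intro integrable_mult_right integrable_cos2_weight)
    show "integrable vol (\<lambda>y. (norm (kernel_sum e N L p y))\<^sup>2)"
      by (intro integrable_continuous_vol continuous_intros kernel_sum_continuous e L(2))
    fix y
    have "?q p * (?m * k) * cos2_weight \<Lambda> ?T p y \<le> ?q p * ?q y * cos2_weight \<Lambda> ?T p y"
      using qp q[of y] by (intro mult_right_mono mult_left_mono cos2_weight_bounds) auto
    also have "\<dots> \<le> (norm (kernel_sum e N L p y))\<^sup>2"
      by (rule kernel_sum_weight_le[OF e(1) L(1,2) LD LK k \<Lambda>(2,3) T])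
    finally show "?q p * (?m * k) * cos2_weight \<Lambda> ?T p y \<le> (norm (kernel_sum e N L p y))\<^sup>2" .
  qed
  also have "\<dots> \<le> ?m * ?q p"
    by (rule kernel_sum_Bessel[OF e(1) on L(1,2)])
  finally have "(?m * ?q p) * (k * (LINT y|vol. cos2_weight \<Lambda> ?T p y)) \<le> (?m * ?q p) * 1"
    by (simp add: ac_simps)
  then show ?thesis
    using m qp mult_le_cancel_left_pos[of "?m * ?q p"] by (simp add: \<Lambda>_def)
qed

text \<open>
  Dominated convergence for \<open>\<epsilon>\<close> tending to \<open>0\<close>.
\<close>

lemma card_weight_integral_le:
  assumes B: "finite B" "B \<subseteq> eigenspace_sum lam" "cfun.independent B" and lam: "0 < lam"
  shows "real (card B) * (LINT y|vol. cos2_weight (sqrt lam) (pi / 2 / sqrt lam) p y) \<le> total_volume"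
proof (cases "card B = 0")
  case True
  then show ?thesis
    using total_volume_pos by simp
next
  case False
  interpret finite_measure vol
    by (rule finite_measure_vol)
  let ?N = "card B" and ?T = "pi / 2 / sqrt lam"
  define K where "K = real ?N / total_volume"
  have K: "0 < K"
    using False total_volume_pos by (simp add: K_def)
  obtain e :: "nat \<Rightarrow> 'a \<Rightarrow> complex"
    where e: "\<And>i. i < ?N \<Longrightarrow> smooth_fun (e i)" "\<And>i. i < ?N \<Longrightarrow> Re (energy (e i) (e i)) \<le> lam"
      "\<And>i j. i < ?N \<Longrightarrow> j < ?N \<Longrightarrow> L2 (e i) (e j) = (if i = j then 1 else 0)"
    using orthonormal_low_energy_family[OF B] by metis
  define \<epsilon> where "\<epsilon> n = K * inverse (real (Suc (Suc n)))" for n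
  define \<Lambda> where "\<Lambda> n = sqrt ((lam * K + \<epsilon> n) / (K - \<epsilon> n))" for n
  have \<epsilon>0: "\<epsilon> \<longlonglongrightarrow> 0"
    unfolding \<epsilon>_def using tendsto_mult_right_zero[OF LIMSEQ_Suc[OF LIMSEQ_inverse_real_of_nat], of K] by simp
  have \<epsilon>: "0 < \<epsilon> n" "\<epsilon> n < K" for n
  proof -
    show "0 < \<epsilon> n"
      using K by (simp add: \<epsilon>_def)
    have "inverse (real (Suc (Suc n))) < 1"
      by (simp add: inverse_less_1_iff)
    then show "\<epsilon> n < K"
      using K by (simp add: \<epsilon>_def)
  qed
  have "\<Lambda> \<longlonglongrightarrow> sqrt ((lam * K + 0) / (K - 0))"
    unfolding \<Lambda>_def using K by (intro tendsto_intros \<epsilon>0) auto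
  then have \<Lambda>: "\<Lambda> \<longlonglongrightarrow> sqrt lam"
    using K by simp
  have "(\<lambda>n. LINT y|vol. cos2_weight (\<Lambda> n) ?T p y) \<longlonglongrightarrow> (LINT y|vol. cos2_weight (sqrt lam) ?T p y)"
  proof (rule integral_dominated_convergence[where w = "\<lambda>_. 1"])
    show "AE y in vol. (\<lambda>n. cos2_weight (\<Lambda> n) ?T p y) \<longlonglongrightarrow> cos2_weight (sqrt lam) ?T p y"
      unfolding cos2_weight_def by (intro AE_I2 tendsto_intros \<Lambda>)
    show "AE y in vol. norm (cos2_weight (\<Lambda> n) ?T p y) \<le> 1" for n
      using cos2_weight_bounds by auto
  qed auto
  then have "(\<lambda>n. (K - \<epsilon> n) * (LINT y|vol. cos2_weight (\<Lambda> n) ?T p y)) \<longlonglongrightarrow>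
      (K - 0) * (LINT y|vol. cos2_weight (sqrt lam) ?T p y)"
    by (intro tendsto_mult tendsto_diff tendsto_const \<epsilon>0)
  moreover have "(K - \<epsilon> n) * (LINT y|vol. cos2_weight (\<Lambda> n) ?T p y) \<le> 1" for n
    unfolding \<Lambda>_def K_def
    by (rule weight_integral_le_perturbed[OF e lam]) (use \<epsilon>[of n] in \<open>auto simp: K_def\<close>)
  ultimately have "K * (LINT y|vol. cos2_weight (sqrt lam) ?T p y) \<le> 1"
    by (auto intro: LIMSEQ_le_const2)
  then show ?thesis
    using total_volume_pos by (simp add: K_def divide_le_eq)
qed

end

theorem theorem1p1:
  fixes \<A> :: "('a::{t2_space, second_countable_topology}, 'n::finite) chart set"
    and g :: "('a, 'n) chart \<Rightarrow> 'a \<Rightarrow> real ^ 'n ^ 'n"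
    and p :: 'a and \<alpha> lam :: real
  assumes "riemannian_manifold \<A> g"
    and "compact (UNIV :: 'a set)"
    and "connected (UNIV :: 'a set)"
    and "riemannian_manifold.homogeneous \<A> g"
    and "0 < \<alpha>" and "\<alpha> < pi / 2" and "0 < lam"
  shows "let N = riemannian_manifold.counting_function \<A> g;
             V = riemannian_manifold.ball_volume \<A> g p;
             volM = measure (riemannian_manifold.vol \<A> g) UNIV;
             I = integral {0..pi/2} (\<lambda>\<theta>. V (\<theta> / sqrt lam) * sin (2 * \<theta>))
         in ereal_of_enat (N lam) \<le> ereal (volM / I) \<and>
            volM / I \<le> volM / ((cos \<alpha>)\<^sup>2 * V (\<alpha> * lam powr (-1/2)))"
proof -
  interpret riemannian_manifold \<A> g
    by fact
  interpret compact_homogeneous_manifold \<A> g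
    by unfold_locales fact+
  interpret finite_measure vol
    by (rule finite_measure_vol)
  let ?J = "(cos \<alpha>)\<^sup>2 * ball_volume p (\<alpha> * lam powr (-1/2))"
  define I where "I = integral {0..pi/2} (\<lambda>\<theta>. ball_volume p (\<theta> / sqrt lam) * sin (2 * \<theta>))"
  have I: "I = (LINT y|vol. cos2_weight (sqrt lam) (pi / 2 / sqrt lam) p y)"
    unfolding I_def ball_volume_def by (rule integral_cos2_weight[symmetric]) fact
  have "lam powr (-1/2) = 1 / sqrt lam"
  proof -
    have "lam powr (-1/2) = inverse (lam powr (1/2))"
      using powr_minus[of lam "1/2"] by simp
    then show ?thesis
      using powr_half_sqrt[of lam] \<open>0 < lam\<close> by (simp add: inverse_eq_divide)
  qed
  then have JI: "?J \<le> I"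
    unfolding I ball_volume_def
    using cos2_ball_volume_le[OF \<open>0 < lam\<close> \<open>0 < \<alpha>\<close> \<open>\<alpha> < pi / 2\<close>, of p] by simp
  have J: "0 < ?J"
  proof (rule mult_pos_pos)
    show "0 < (cos \<alpha>)\<^sup>2"
      using cos_gt_zero_pi[of \<alpha>] \<open>0 < \<alpha>\<close> \<open>\<alpha> < pi / 2\<close> by (intro zero_less_power) simp
    have "p \<in> rball p (\<alpha> * lam powr (-1/2))"
      using \<open>0 < \<alpha>\<close> \<open>0 < lam\<close> by (intro center_in_rball) simp
    then have "0 < emeasure vol (rball p (\<alpha> * lam powr (-1/2)))"
      by (intro emeasure_vol_open_pos open_rball) auto
    then show "0 < ball_volume p (\<alpha> * lam powr (-1/2))"
      by (simp add: ball_volume_def emeasure_eq_measure)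
  qed
  have "ereal_of_enat (counting_function lam) \<le> ereal (measure vol UNIV / I)"
  proof -
    let ?\<B> = "{B. finite B \<and> B \<subseteq> eigenspace_sum lam \<and> cfun.independent B}"
    have "{} \<in> ?\<B>"
      by (simp add: cfun.independent_empty)
    then have "ereal_of_enat (counting_function lam) = (SUP B\<in>?\<B>. ereal_of_enat (enat (card B)))"
      unfolding counting_function_def cdim_def by (subst ereal_of_enat_SUP) auto
    also have "\<dots> \<le> ereal (measure vol UNIV / I)"
    proof (rule SUP_least)
      fix B assume "B \<in> ?\<B>"
      then have "real (card B) * I \<le> measure vol UNIV"
        unfolding I using card_weight_integral_le[of B lam p] \<open>0 < lam\<close> by (simp add: total_volume_def)
      then show "ereal_of_enat (enat (card B)) \<le> ereal (measure vol UNIV / I)"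
        using J JI by (simp add: pos_le_divide_eq)
    qed
    finally show ?thesis .
  qed
  moreover have "measure vol UNIV / I \<le> measure vol UNIV / ?J"
    using J JI by (intro divide_left_mono) auto
  ultimately show ?thesis
    unfolding Let_def I_def by blast
qed

end
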